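(* Let $k\geq 2$ be an integer, let $d=O(1)$ be a constant that is sufficiently large, let $p=\frac{d}{\binom{n-1}{k-1}}$ and $m=\binom{n}{k}p$, and let $H=H_{n,m;k}$. Define $$\alpha=\left(\frac{(k-1)d}{\log d-5(k-1)\log \log d}\right)^{\frac{1}{k-1}},\qquad \beta=3\log^{3k}d.$$ Then: (i) If $q\geq \alpha+\beta+1$ then with high probability (as $n\to\infty$) the graph $\Gamma_q(H)$ is connected. (ii) If $q\geq \alpha+2\beta+1$ then with high probability the diameter of $\Gamma_q(H)$ is $O(n)$.
   Context: $H_{n,m;k}$ denotes the random $k$-uniform hypergraph with vertex set $[n]=\{1,\dots,n\}$ whose edge set consists of $m$ distinct $k$-subsets of $[n]$ chosen uniformly at random. A proper $[q]$-coloring of a hypergraph $H$ is a map $\sigma:V(H)\to[q]$ such that no edge is monochromatic, i.e. $|\sigma(e)|\geq 2$ for every edge $e$. $\Omega_q(H)$ is the set of proper $[q]$-colorings of $H$, and $\Gamma_q(H)$ is the graph with vertex set $\Omega_q(H)$ in which $\sigma,\tau$ are adjacent iff their Hamming distance $|\{v:\sigma(v)\neq\tau(v)\}|$ equals $1$. "With high probability" means with probability tending to $1$ as $n\to\infty$. *)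

theory Defs
  imports "HOL-Probability.Probability" "Graph_Theory.Graph_Theory"
begin

type_synonym 'v hypergraph = "'v set \<times> 'v set set"

definition uniform_hypergraphs :: "nat \<Rightarrow> nat \<Rightarrow> nat \<Rightarrow> nat hypergraph set" where
  "uniform_hypergraphs n m k =
     {({1..n}, E) | E. E \<subseteq> {e. e \<subseteq> {1..n} \<and> card e = k} \<and> card E = m}"

text \<open>The set is finite, and nonempty iff \<open>m \<le> n choose k\<close>. If it is empty, \<^const>\<open>pmf_of_set\<close>
  is unspecified.\<close>

definition random_hypergraph :: "nat \<Rightarrow> nat \<Rightarrow> nat \<Rightarrow> nat hypergraph pmf" where
  "random_hypergraph n m k = pmf_of_set (uniform_hypergraphs n m k)"

text \<open>Colorings are taken extensional, so that two colorings are equal as functions iff they agree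
  on every vertex.\<close>

definition proper_colorings :: "nat \<Rightarrow> 'v hypergraph \<Rightarrow> ('v \<Rightarrow> nat) set" where
  "proper_colorings q H = {\<sigma> \<in> fst H \<rightarrow>\<^sub>E {1..q}. \<forall>e \<in> snd H. card (\<sigma> ` e) \<ge> 2}"

definition hamming_dist :: "'v set \<Rightarrow> ('v \<Rightarrow> 'c) \<Rightarrow> ('v \<Rightarrow> 'c) \<Rightarrow> nat" where
  "hamming_dist V \<sigma> \<tau> = card {v \<in> V. \<sigma> v \<noteq> \<tau> v}"

text \<open>As usual in \<^theory>\<open>Graph_Theory.Digraph\<close>, an undirected graph is a symmetric digraph.\<close>

definition coloring_pair_graph :: "nat \<Rightarrow> 'v hypergraph \<Rightarrow> ('v \<Rightarrow> nat) pair_pre_digraph" where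
  "coloring_pair_graph q H =
     \<lparr> pverts = proper_colorings q H,
       parcs = {(\<sigma>, \<tau>). \<sigma> \<in> proper_colorings q H \<and> \<tau> \<in> proper_colorings q H \<and>
                         hamming_dist (fst H) \<sigma> \<tau> = 1} \<rparr>"

definition coloring_graph ::
    "nat \<Rightarrow> 'v hypergraph \<Rightarrow> ('v \<Rightarrow> nat, ('v \<Rightarrow> nat) \<times> ('v \<Rightarrow> nat)) pre_digraph" where
  "coloring_graph q H = with_proj (coloring_pair_graph q H)"

lemma pair_graph_coloring_pair_graph:
  assumes "finite (fst H)"
  shows "pair_graph (coloring_pair_graph q H)"
proof
  have fin: "finite (proper_colorings q H)"
    unfolding proper_colorings_def
    by (rule finite_subset[OF _ finite_PiE[OF assms, of "\<lambda>_. {1..q}"]]) auto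
  then show "finite (pverts (coloring_pair_graph q H))"
    by (simp add: coloring_pair_graph_def)
  show "finite (parcs (coloring_pair_graph q H))"
    by (rule finite_subset[OF _ finite_cartesian_product[OF fin fin]])
       (auto simp: coloring_pair_graph_def)
  have "hamming_dist V \<sigma> \<tau> = hamming_dist V \<tau> \<sigma>" for V and \<sigma> \<tau> :: "'a \<Rightarrow> nat"
    unfolding hamming_dist_def by (rule arg_cong[where f = card]) auto
  then show "symmetric (with_proj (coloring_pair_graph q H))"
    by (auto simp: symmetric_def sym_def coloring_pair_graph_def)
qed (auto simp: coloring_pair_graph_def hamming_dist_def)

text \<open>The distance is the least number of arcs of a walk, and \<open>\<infinity>\<close> between different components.
  Hence the diameter is \<open>\<infinity>\<close> for a disconnected graph (and \<open>-\<infinity>\<close> for the graph without vertices,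
  which is not \<^const>\<open>Digraph_Component.connected\<close>).\<close>

definition graph_dist :: "('a, 'b) pre_digraph \<Rightarrow> 'a \<Rightarrow> 'a \<Rightarrow> ereal" where
  "graph_dist G u v = wf_digraph.\<mu> G (\<lambda>_. 1) u v"

definition graph_diameter :: "('a, 'b) pre_digraph \<Rightarrow> ereal" where
  "graph_diameter G = (SUP (u, v) \<in> verts G \<times> verts G. graph_dist G u v)"

definition edge_prob :: "nat \<Rightarrow> real \<Rightarrow> nat \<Rightarrow> real" where
  "edge_prob k d n = d / real ((n - 1) choose (k - 1))"

text \<open>The number \<open>(n choose k) * p = d * n / k\<close> need not be an integer, so it is rounded down.\<close>

definition edge_count :: "nat \<Rightarrow> real \<Rightarrow> nat \<Rightarrow> nat" where
  "edge_count k d n = nat \<lfloor>real (n choose k) * edge_prob k d n\<rfloor>"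

definition whp :: "nat \<Rightarrow> real \<Rightarrow> (nat \<Rightarrow> nat hypergraph \<Rightarrow> bool) \<Rightarrow> bool" where
  "whp k d P \<longleftrightarrow>
     (\<lambda>n. measure_pmf.prob (random_hypergraph n (edge_count k d n) k) {H. P n H}) \<longlonglongrightarrow> 1"

definition color_alpha :: "nat \<Rightarrow> real \<Rightarrow> real" where
  "color_alpha k d =
     ((real k - 1) * d / (ln d - 5 * (real k - 1) * ln (ln d))) powr (1 / (real k - 1))"

definition color_beta :: "nat \<Rightarrow> real \<Rightarrow> real" where
  "color_beta k d = 3 * ln d ^ (3 * k)"

end

theory Submission
  imports Defs "HOL-Real_Asymp.Real_Asymp"
begin

text \<open>Recoloring vertices one at a time, every coloring can be made greedy: for \<open>a \<approx> \<alpha>\<close> prescribed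
  colors, each class in turn is enlarged until it is a maximal independent set in what the previous
  classes leave over. With high probability the remainder \<open>R\<close> of every such process is degenerate of
  degree \<open>D < log\<^sup>3\<^sup>k d\<close>. As at least \<open>2D + 3\<close> colors are left, \<open>R\<close> can be recolored arbitrarily in
  \<open>O(n)\<close> steps, even so that one chosen color becomes unused. Hence the greedy classes of a target
  coloring can be installed one by one, each in a freed color, and finally \<open>R\<close> is recolored to the
  target. Since \<open>2D + 3 \<le> \<beta>\<close>, the number of colors in (i) already gives the diameter bound of (ii).

  For the degeneracy of \<open>R\<close>: a vertex set \<open>S\<close> survives classes \<open>V\<^sub>1, \<dots>, V\<^sub>t\<close> of total size \<open>wn\<close> with
  probability at most \<open>exp (- |S| \<Lambda>)\<close>, where \<open>\<Lambda>\<close> is essentially \<open>t exp (- d (w/t)\<^sup>k\<^sup>-\<^sup>1)\<close>. A union bound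
  with all but a \<open>1 / log d\<close> fraction of the classes shows that \<open>O(n / log\<^sup>2 d)\<close> vertices remain; a
  second union bound inside this set with the other classes leaves at most \<open>n log\<^sup>3 d / \<alpha>\<close> vertices,
  and sets as small as that are too sparse to contain a subhypergraph of large minimum degree.\<close>

section \<open>Recoloring degenerate hypergraphs\<close>

text \<open>The diameter is linear because each vertex of the remainder moves at most 2D + 2 times,
  whatever n is. A vertex v added in degeneracy order has at most D watched neighbors: D colors are
  blocked by them now, D + 1 more by looking D + 1 of their moves ahead, and one is left. So v moves
  once per D + 1 neighbor moves and twice more at the ends, and 2D + 2 solves f = D f / (D + 1) + 2.
  With one color to be freed this makes a + 2D + 3 colors.

  One stage would not do: a union bound over all (t + 1)^n assignments costs order n log d, while
  \<Lambda> for about \<alpha> classes on n vertices is only a power of log d, so the bound leaves n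
  divided by a power of log d, far above n log^3 d / \<alpha>. On O(n / log^2 d) vertices the
  entropy is below n, and \<alpha> / log d classes are so small on average there that d (w/t)^(k-1)
  stays bounded; then \<Lambda> is of order \<alpha> / log^2 d.\<close>

definition bichromatic :: "('v \<Rightarrow> nat) \<Rightarrow> 'v set \<Rightarrow> bool" where
  "bichromatic \<sigma> e \<longleftrightarrow> (\<exists>u\<in>e. \<exists>w\<in>e. \<sigma> u \<noteq> \<sigma> w)"

definition proper_on :: "'v set set \<Rightarrow> 'v set \<Rightarrow> ('v \<Rightarrow> nat) \<Rightarrow> bool" where
  "proper_on E S \<sigma> \<longleftrightarrow> (\<forall>e\<in>E. e \<subseteq> S \<longrightarrow> bichromatic \<sigma> e)"

definition degenerate :: "'v set set \<Rightarrow> nat \<Rightarrow> 'v set \<Rightarrow> bool" where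
  "degenerate E D S \<longleftrightarrow> (\<forall>T\<subseteq>S. T \<noteq> {} \<longrightarrow> (\<exists>v\<in>T. card {e \<in> E. e \<subseteq> T \<and> v \<in> e} \<le> D))"

fun recolor :: "('v \<times> nat) list \<Rightarrow> ('v \<Rightarrow> nat) \<Rightarrow> 'v \<Rightarrow> nat" where
  "recolor [] \<sigma> = \<sigma>"
| "recolor ((w, c) # ms) \<sigma> = recolor ms (\<sigma>(w := c))"

text \<open>\<open>P\<close> constrains only the newly given colors, so \<sigma> itself may use
  others on \<open>S\<close>. A move may repeat the present color; the constructions below need not
  exclude this.\<close>

fun moves_ok :: "'v set set \<Rightarrow> 'v set \<Rightarrow> nat set \<Rightarrow> ('v \<Rightarrow> nat) \<Rightarrow> ('v \<times> nat) list \<Rightarrow> bool" where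
  "moves_ok E S P \<sigma> [] \<longleftrightarrow> proper_on E S \<sigma>"
| "moves_ok E S P \<sigma> ((w, c) # ms) \<longleftrightarrow>
     proper_on E S \<sigma> \<and> w \<in> S \<and> c \<in> P \<and> moves_ok E S P (\<sigma>(w := c)) ms"

definition move_count :: "'v \<Rightarrow> ('v \<times> nat) list \<Rightarrow> nat" where
  "move_count x ms = length (filter (\<lambda>m. fst m = x) ms)"

lemma move_count_simps [simp]:
  "move_count x [] = 0"
  "move_count x ((w, c) # ms) = (if w = x then Suc (move_count x ms) else move_count x ms)"
  "move_count x (ms @ ms') = move_count x ms + move_count x ms'"
  by (auto simp: move_count_def)

lemma bichromatic_cong: "(\<And>x. x \<in> e \<Longrightarrow> \<sigma> x = \<tau> x) \<Longrightarrow> bichromatic \<sigma> e = bichromatic \<tau> e"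
  unfolding bichromatic_def by auto

lemma proper_on_cong: "(\<And>x. x \<in> S \<Longrightarrow> \<sigma> x = \<tau> x) \<Longrightarrow> proper_on E S \<sigma> = proper_on E S \<tau>"
  unfolding proper_on_def by (metis bichromatic_cong subsetD)

lemma proper_on_mono: "proper_on E S \<sigma> \<Longrightarrow> T \<subseteq> S \<Longrightarrow> proper_on E T \<sigma>"
  unfolding proper_on_def by auto

lemma degenerate_mono: "degenerate E D S \<Longrightarrow> T \<subseteq> S \<Longrightarrow> degenerate E D T"
  unfolding degenerate_def by auto

lemma recolor_cong: "\<sigma> x = \<tau> x \<Longrightarrow> recolor ms \<sigma> x = recolor ms \<tau> x"
proof (induction ms arbitrary: \<sigma> \<tau>)
  case (Cons m ms)
  obtain w c where "m = (w, c)" by (cases m)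
  moreover have "recolor ms (\<sigma>(w := c)) x = recolor ms (\<tau>(w := c)) x"
    by (rule Cons.IH) (use Cons.prems in simp)
  ultimately show ?case by simp
qed simp

lemma recolor_append [simp]: "recolor (ms @ ms') \<sigma> = recolor ms' (recolor ms \<sigma>)"
  by (induction ms arbitrary: \<sigma>) auto

lemma moves_ok_append [simp]:
  "moves_ok E S P \<sigma> (ms @ ms') \<longleftrightarrow> moves_ok E S P \<sigma> ms \<and> moves_ok E S P (recolor ms \<sigma>) ms'"
proof (induction ms arbitrary: \<sigma>)
  case Nil
  then show ?case by (cases ms') auto
qed auto

lemma moves_ok_cong:
  "(\<And>x. x \<in> S \<Longrightarrow> \<sigma> x = \<tau> x) \<Longrightarrow> moves_ok E S P \<sigma> ms = moves_ok E S P \<tau> ms"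
proof (induction ms arbitrary: \<sigma> \<tau>)
  case Nil
  then show ?case using proper_on_cong[of S \<sigma> \<tau>] by simp
next
  case (Cons m ms)
  obtain w c where "m = (w, c)" by (cases m)
  have "moves_ok E S P (\<sigma>(w := c)) ms = moves_ok E S P (\<tau>(w := c)) ms"
    by (rule Cons.IH) (use Cons.prems in auto)
  with Cons.prems proper_on_cong[of S \<sigma> \<tau>] \<open>m = (w, c)\<close> show ?case by simp
qed

lemma moves_ok_proper: "moves_ok E S P \<sigma> ms \<Longrightarrow> proper_on E S \<sigma>"
  by (cases ms) auto

lemma moves_ok_proper_end: "moves_ok E S P \<sigma> ms \<Longrightarrow> proper_on E S (recolor ms \<sigma>)"
  using moves_ok_append[of E S P \<sigma> ms "[]"] by simp

lemma moves_ok_subset: "moves_ok E S P \<sigma> ms \<Longrightarrow> fst ` set ms \<subseteq> S"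
  by (induction ms arbitrary: \<sigma>) fastforce+

lemma proper_on_insert:
  assumes "proper_on E S \<sigma>"
    and "\<And>e. e \<in> E \<Longrightarrow> e \<subseteq> insert v S \<Longrightarrow> v \<in> e \<Longrightarrow> U \<inter> e \<noteq> {}"
    and "\<forall>u\<in>U. \<sigma> v \<noteq> \<sigma> u"
  shows "proper_on E (insert v S) \<sigma>"
  unfolding proper_on_def
proof (intro ballI impI)
  fix e assume e: "e \<in> E" "e \<subseteq> insert v S"
  show "bichromatic \<sigma> e"
  proof (cases "v \<in> e")
    case True
    with assms(2) e obtain u where "u \<in> U" "u \<in> e" by blast
    with assms(3) True show ?thesis unfolding bichromatic_def by metis
  next
    case False
    with e assms(1) show ?thesis unfolding proper_on_def by blast
  qed
qed

text \<open>The color of the new vertex \<open>v\<close> avoids the next \<open>r\<close> colors given to vertices of \<open>U\<close>; whenever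
  \<open>r = 0\<close> it is refreshed with a color that is safe for the next \<open>L\<close> moves in \<open>U\<close>.\<close>

lemma insert_vertex_lookahead:
  assumes vS: "v \<notin> S" and finU: "finite U" and US: "U \<subseteq> S" and cardU: "card U \<le> D"
    and hit: "\<And>e. e \<in> E \<Longrightarrow> e \<subseteq> insert v S \<Longrightarrow> v \<in> e \<Longrightarrow> U \<inter> e \<noteq> {}"
    and finP: "finite P" and cardP: "card P \<ge> D + L + 1" and L: "L \<ge> 1"
  shows "moves_ok E S P \<sigma> ms \<Longrightarrow> \<forall>u\<in>U. \<sigma> v \<noteq> \<sigma> u \<Longrightarrow> r \<le> L \<Longrightarrow>
     \<sigma> v \<notin> snd ` set (take r (filter (\<lambda>m. fst m \<in> U) ms)) \<Longrightarrow>
     \<exists>ms'. moves_ok E (insert v S) P \<sigma> ms' \<and> (\<forall>x. x \<noteq> v \<longrightarrow> recolor ms' \<sigma> x = recolor ms \<sigma> x) \<and>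
       (\<forall>x. x \<noteq> v \<longrightarrow> move_count x ms' = move_count x ms) \<and>
       move_count v ms' * L \<le> length (filter (\<lambda>m. fst m \<in> U) ms) + L - 1 - r"
proof (induction ms arbitrary: \<sigma> r)
  case Nil
  then have "moves_ok E (insert v S) P \<sigma> []" using proper_on_insert[of E S \<sigma> v U] hit by simp
  then show ?case by (intro exI[of _ "[]"]) simp
next
  case (Cons m ms)
  obtain w c where m: "m = (w, c)" by (cases m)
  have wS: "w \<in> S" and cP: "c \<in> P" and ok: "moves_ok E S P (\<sigma>(w := c)) ms"
    and pS: "proper_on E S \<sigma>"
    using Cons.prems(1) m by auto
  have wv: "w \<noteq> v" using wS vS by auto
  have vU: "v \<notin> U" using US vS by auto
  have pv: "proper_on E (insert v S) \<sigma>" using proper_on_insert[OF pS hit Cons.prems(2)] .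
  show ?case
  proof (cases "w \<in> U")
    case False
    have "\<exists>ms'. moves_ok E (insert v S) P (\<sigma>(w := c)) ms' \<and>
       (\<forall>x. x \<noteq> v \<longrightarrow> recolor ms' (\<sigma>(w := c)) x = recolor ms (\<sigma>(w := c)) x) \<and>
       (\<forall>x. x \<noteq> v \<longrightarrow> move_count x ms' = move_count x ms) \<and>
       move_count v ms' * L \<le> length (filter (\<lambda>m. fst m \<in> U) ms) + L - 1 - r"
      by (rule Cons.IH[OF ok _ Cons.prems(3)]) (use Cons.prems False m wv vU in auto)
    then obtain ms' where "moves_ok E (insert v S) P (\<sigma>(w := c)) ms'"
       "\<forall>x. x \<noteq> v \<longrightarrow> recolor ms' (\<sigma>(w := c)) x = recolor ms (\<sigma>(w := c)) x"
       "\<forall>x. x \<noteq> v \<longrightarrow> move_count x ms' = move_count x ms"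
       "move_count v ms' * L \<le> length (filter (\<lambda>m. fst m \<in> U) ms) + L - 1 - r" by blast
    then show ?thesis using pv wS cP False wv unfolding m
      by (intro exI[of _ "(w, c) # ms'"] conjI) simp_all
  next
    case True
    show ?thesis
    proof (cases r)
      case (Suc r')
      have cv: "\<sigma> v \<noteq> c" "\<sigma> v \<notin> snd ` set (take r' (filter (\<lambda>m. fst m \<in> U) ms))"
        using Cons.prems(4) True m Suc by auto
      have "\<exists>ms'. moves_ok E (insert v S) P (\<sigma>(w := c)) ms' \<and>
         (\<forall>x. x \<noteq> v \<longrightarrow> recolor ms' (\<sigma>(w := c)) x = recolor ms (\<sigma>(w := c)) x) \<and>
         (\<forall>x. x \<noteq> v \<longrightarrow> move_count x ms' = move_count x ms) \<and>
         move_count v ms' * L \<le> length (filter (\<lambda>m. fst m \<in> U) ms) + L - 1 - r'"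
        by (rule Cons.IH[OF ok]) (use Cons.prems m wv vU cv Suc in auto)
      then obtain ms' where "moves_ok E (insert v S) P (\<sigma>(w := c)) ms'"
         "\<forall>x. x \<noteq> v \<longrightarrow> recolor ms' (\<sigma>(w := c)) x = recolor ms (\<sigma>(w := c)) x"
         "\<forall>x. x \<noteq> v \<longrightarrow> move_count x ms' = move_count x ms"
         "move_count v ms' * L \<le> length (filter (\<lambda>m. fst m \<in> U) ms) + L - 1 - r'" by blast
      then show ?thesis using pv wS cP True wv Suc unfolding m
        by (intro exI[of _ "(w, c) # ms'"] conjI) simp_all
    next
      case 0
      \<comment> \<open>At most D colors sit on \<open>U\<close> and at most L come up in its next L
        moves, so \<open>cardP\<close> leaves a color for \<open>v\<close> that is safe until all of
        these are over.\<close>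
      let ?X = "\<sigma> ` U \<union> snd ` set (take L (filter (\<lambda>m. fst m \<in> U) (m # ms)))"
      have "card (\<sigma> ` U) \<le> D" using card_image_le[OF finU] cardU le_trans by blast
      moreover have "card (snd ` set (take L (filter (\<lambda>m. fst m \<in> U) (m # ms)))) \<le> L"
        by (rule le_trans[OF card_image_le]) (auto intro: le_trans[OF card_length])
      ultimately have "card ?X \<le> D + L"
        by (meson card_Un_le add_mono le_trans)
      then have "\<not> P \<subseteq> ?X"
        using card_mono[of ?X P] finU cardP by (auto simp del: filter.simps take_Cons)
      then obtain c' where c': "c' \<in> P" "c' \<notin> ?X" by blast
      obtain L' where L': "L = Suc L'" using L by (cases L) auto
      define \<sigma>' where "\<sigma>' = \<sigma>(v := c')"
      have c'2: "c' \<noteq> c" "c' \<notin> snd ` set (take L' (filter (\<lambda>m. fst m \<in> U) ms))"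
        using c' True m L' by auto
      have ok': "moves_ok E S P (\<sigma>'(w := c)) ms"
        by (rule moves_ok_cong[THEN iffD1, OF _ ok]) (use vS in \<open>auto simp: \<sigma>'_def\<close>)
      \<comment> \<open>The move \<open>(w, c)\<close> already uses up one of the L safe moves,
        hence \<open>L'\<close> = L - 1. In the count, the summand L - 1 - r is the share of the
        next refresh that is not yet paid for: with r = 0 the present move completes the payment of
        L.\<close>
      have "\<exists>ms'. moves_ok E (insert v S) P (\<sigma>'(w := c)) ms' \<and>
         (\<forall>x. x \<noteq> v \<longrightarrow> recolor ms' (\<sigma>'(w := c)) x = recolor ms (\<sigma>'(w := c)) x) \<and>
         (\<forall>x. x \<noteq> v \<longrightarrow> move_count x ms' = move_count x ms) \<and>
         move_count v ms' * L \<le> length (filter (\<lambda>m. fst m \<in> U) ms) + L - 1 - L'"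
        by (rule Cons.IH[OF ok']) (use c' c'2 wv vU L' in \<open>auto simp: \<sigma>'_def\<close>)
      then obtain ms' where ms': "moves_ok E (insert v S) P (\<sigma>'(w := c)) ms'"
         "\<forall>x. x \<noteq> v \<longrightarrow> recolor ms' (\<sigma>'(w := c)) x = recolor ms (\<sigma>'(w := c)) x"
         "\<forall>x. x \<noteq> v \<longrightarrow> move_count x ms' = move_count x ms"
         "move_count v ms' * L \<le> length (filter (\<lambda>m. fst m \<in> U) ms) + L - 1 - L'" by blast
      have "proper_on E S \<sigma>'"
        by (rule proper_on_cong[THEN iffD1, OF _ pS]) (use vS in \<open>auto simp: \<sigma>'_def\<close>)
      then have pv': "proper_on E (insert v S) \<sigma>'"
        by (rule proper_on_insert[OF _ hit]) (use c' vU in \<open>auto simp: \<sigma>'_def\<close>)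
      have "recolor ms' (\<sigma>'(w := c)) x = recolor ms (\<sigma>(w := c)) x" if "x \<noteq> v" for x
        using ms'(2) recolor_cong[of "\<sigma>'(w := c)" x "\<sigma>(w := c)" ms] that by (simp add: \<sigma>'_def)
      moreover have "moves_ok E (insert v S) P \<sigma> ((v, c') # (w, c) # ms')"
        using ms'(1) pv pv' wS cP c'(1) by (simp add: \<sigma>'_def)
      moreover have "move_count v ((v, c') # (w, c) # ms') * L
          \<le> length (filter (\<lambda>m. fst m \<in> U) (m # ms)) + L - 1 - r"
        using ms'(4) True wv 0 L' by (simp add: m)
      ultimately show ?thesis using ms'(3) wv unfolding m
        by (intro exI[of _ "(v, c') # (w, c) # ms'"] conjI) (simp_all add: \<sigma>'_def)
    qed
  qed
qed

lemma length_filter_sum_move_count: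
  assumes "finite U"
  shows "length (filter (\<lambda>m. fst m \<in> U) ms) = (\<Sum>u\<in>U. move_count u ms)"
proof (induction ms)
  case (Cons m ms)
  obtain w c where m: "m = (w, c)" by (cases m)
  have "(\<Sum>u\<in>U. move_count u (m # ms)) = (\<Sum>u\<in>U. (if u = w then 1 else 0) + move_count u ms)"
    by (rule sum.cong) (auto simp: m)
  then show ?case using Cons assms by (simp add: sum.distrib m)
qed simp

text \<open>An initial refresh of \<open>v\<close> provides the full credit r = L, and a last move
  gives \<open>v\<close> its target color. These two moves are the summand 2; every move in between
  is paid for by L moves in \<open>U\<close>.\<close>

lemma insert_vertex:
  assumes vS: "v \<notin> S" and finU: "finite U" and US: "U \<subseteq> S" and cardU: "card U \<le> D"
    and hit: "\<And>e. e \<in> E \<Longrightarrow> e \<subseteq> insert v S \<Longrightarrow> v \<in> e \<Longrightarrow> U \<inter> e \<noteq> {}"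
    and finP: "finite P" and cardP: "card P \<ge> D + L + 1" and L: "L \<ge> 1"
    and ok: "moves_ok E S P \<sigma> ms" and p\<sigma>: "proper_on E (insert v S) \<sigma>"
    and p\<tau>: "proper_on E (insert v S) \<tau>" and \<tau>v: "\<tau> v \<in> P"
    and \<tau>: "\<And>x. x \<noteq> v \<Longrightarrow> recolor ms \<sigma> x = \<tau> x"
  shows "\<exists>ms'. moves_ok E (insert v S) P \<sigma> ms' \<and> recolor ms' \<sigma> = \<tau> \<and>
       (\<forall>x. x \<noteq> v \<longrightarrow> move_count x ms' = move_count x ms) \<and>
       move_count v ms' \<le> (\<Sum>u\<in>U. move_count u ms) div L + 2"
proof -
  let ?X = "\<sigma> ` U \<union> snd ` set (take L (filter (\<lambda>m. fst m \<in> U) ms))"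
  have vU: "v \<notin> U" using US vS by auto
  have "card (\<sigma> ` U) \<le> D" using card_image_le[OF finU] cardU le_trans by blast
  moreover have "card (snd ` set (take L (filter (\<lambda>m. fst m \<in> U) ms))) \<le> L"
    by (rule le_trans[OF card_image_le]) (auto intro: le_trans[OF card_length])
  ultimately have "card ?X \<le> D + L"
    by (meson card_Un_le add_mono le_trans)
  then have "\<not> P \<subseteq> ?X"
    using card_mono[of ?X P] finU cardP by auto
  then obtain c' where c': "c' \<in> P" "c' \<notin> ?X" by blast
  define \<sigma>' where "\<sigma>' = \<sigma>(v := c')"
  have ok': "moves_ok E S P \<sigma>' ms"
    by (rule moves_ok_cong[THEN iffD1, OF _ ok]) (use vS in \<open>auto simp: \<sigma>'_def\<close>)
  have "\<exists>ms'. moves_ok E (insert v S) P \<sigma>' ms' \<and>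
       (\<forall>x. x \<noteq> v \<longrightarrow> recolor ms' \<sigma>' x = recolor ms \<sigma>' x) \<and>
       (\<forall>x. x \<noteq> v \<longrightarrow> move_count x ms' = move_count x ms) \<and>
       move_count v ms' * L \<le> length (filter (\<lambda>m. fst m \<in> U) ms) + L - 1 - L"
  proof (rule insert_vertex_lookahead[OF vS finU US cardU hit finP cardP L ok'])
    show "\<forall>u\<in>U. \<sigma>' v \<noteq> \<sigma>' u" using c'(2) vU by (auto simp: \<sigma>'_def)
    show "\<sigma>' v \<notin> snd ` set (take L (filter (\<lambda>m. fst m \<in> U) ms))"
      using c'(2) by (simp add: \<sigma>'_def)
  qed auto
  then obtain ms' where ms': "moves_ok E (insert v S) P \<sigma>' ms'"
       "\<forall>x. x \<noteq> v \<longrightarrow> recolor ms' \<sigma>' x = recolor ms \<sigma>' x"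
       "\<forall>x. x \<noteq> v \<longrightarrow> move_count x ms' = move_count x ms"
       "move_count v ms' * L \<le> length (filter (\<lambda>m. fst m \<in> U) ms) + L - 1 - L" by blast
  have "move_count v ms' * L \<le> (\<Sum>u\<in>U. move_count u ms)"
    using ms'(4) length_filter_sum_move_count[OF finU, of ms] by linarith
  then have cnt: "move_count v ms' \<le> (\<Sum>u\<in>U. move_count u ms) div L"
    using L by (simp add: less_eq_div_iff_mult_less_eq)
  have eq: "(recolor ms' \<sigma>')(v := \<tau> v) = \<tau>"
  proof
    fix x show "((recolor ms' \<sigma>')(v := \<tau> v)) x = \<tau> x"
      using ms'(2) \<tau>[of x] recolor_cong[of \<sigma>' x \<sigma> ms] by (auto simp: \<sigma>'_def)
  qed
  let ?ms = "(v, c') # ms' @ [(v, \<tau> v)]"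
  have "moves_ok E (insert v S) P \<sigma> ?ms"
    using p\<sigma> p\<tau> \<tau>v c' ms'(1) moves_ok_proper_end[OF ms'(1)] eq by (auto simp: \<sigma>'_def)
  moreover have "recolor ?ms \<sigma> = \<tau>" using eq by (simp add: \<sigma>'_def)
  ultimately show ?thesis using ms'(3) cnt by (intro exI[of _ ?ms]) auto
qed

text \<open>\<open>U\<close> takes one further vertex from each of the at most D edges at
  \<open>v\<close>. If \<open>v\<close> differs in color from all of \<open>U\<close>, no edge at
  \<open>v\<close> is monochromatic, so hyperedges can be handled like graph edges from
  \<open>v\<close> to \<open>U\<close>.\<close>

lemma degenerate_vertex:
  assumes "degenerate E D S" "S \<noteq> {}" "finite S" "\<forall>e\<in>E. card e \<ge> 2"
  obtains v U where "v \<in> S" "finite U" "U \<subseteq> S - {v}" "card U \<le> D"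
    "\<And>e. e \<in> E \<Longrightarrow> e \<subseteq> S \<Longrightarrow> v \<in> e \<Longrightarrow> U \<inter> e \<noteq> {}"
proof -
  obtain v where v: "v \<in> S" "card {e \<in> E. e \<subseteq> S \<and> v \<in> e} \<le> D"
    using assms(1,2) unfolding degenerate_def by blast
  let ?F = "{e \<in> E. e \<subseteq> S \<and> v \<in> e}"
  have "\<exists>u. u \<in> e \<and> u \<noteq> v" if "e \<in> E" for e
  proof (rule ccontr)
    assume "\<nexists>u. u \<in> e \<and> u \<noteq> v"
    then have "e \<subseteq> {v}" by auto
    then have "card e \<le> 1" using card_mono[of "{v}" e] by auto
    with assms(4) that show False by fastforce
  qed
  then obtain f where f: "\<And>e. e \<in> E \<Longrightarrow> f e \<in> e \<and> f e \<noteq> v" by metis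
  have "finite ?F" by (rule finite_subset[of _ "Pow S"]) (use assms(3) in auto)
  then have "card (f ` ?F) \<le> D" "finite (f ` ?F)" using v(2) card_image_le le_trans by (blast, simp)
  with f v(1) show ?thesis by (intro that[of v "f ` ?F"]) auto
qed

text \<open>Vertices are added in degeneracy order with lookahead L = D + 1. If each of the at most
  D vertices of \<open>U\<close> moves at most 2D + 2 times, then \<open>v\<close> moves at most D
  (2D + 2) / (D + 1) + 2 = 2D + 2 times, so the bound does not grow with \<open>S\<close>.\<close>

lemma degenerate_recoloring:
  assumes "finite S" "degenerate E D S" and E2: "\<forall>e\<in>E. card e \<ge> 2"
    and P: "finite P" "card P \<ge> 2 * D + 2"
    and "proper_on E S \<sigma>" "proper_on E S \<tau>" "\<tau> ` S \<subseteq> P" "\<And>x. x \<notin> S \<Longrightarrow> \<tau> x = \<sigma> x"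
  shows "\<exists>ms. moves_ok E S P \<sigma> ms \<and> recolor ms \<sigma> = \<tau> \<and> (\<forall>x. move_count x ms \<le> 2 * D + 2)"
  using assms(1,2,6-)
proof (induction S arbitrary: \<tau> rule: finite_psubset_induct)
  case (psubset S)
  show ?case
  proof (cases "S = {}")
    case True
    with psubset.prems have "\<tau> = \<sigma>" by auto
    with True psubset.prems show ?thesis by (intro exI[of _ "[]"]) auto
  next
    case False
    obtain v U where v: "v \<in> S" "finite U" "U \<subseteq> S - {v}" "card U \<le> D"
      and hit: "\<And>e. e \<in> E \<Longrightarrow> e \<subseteq> S \<Longrightarrow> v \<in> e \<Longrightarrow> U \<inter> e \<noteq> {}"
      using degenerate_vertex[OF psubset.prems(1) False psubset.hyps E2] by metis
    let ?S = "S - {v}"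
    have ins: "insert v ?S = S" using v(1) by auto
    \<comment> \<open>Outside \<open>?S\<close> the target must agree with \<sigma>, hence the
      update at \<open>v\<close>; \<open>insert_vertex\<close> corrects it afterwards.\<close>
    have "\<exists>ms. moves_ok E ?S P \<sigma> ms \<and> recolor ms \<sigma> = \<tau>(v := \<sigma> v) \<and>
        (\<forall>x. move_count x ms \<le> 2 * D + 2)"
    proof (rule psubset.IH)
      show "proper_on E ?S (\<tau>(v := \<sigma> v))"
        using proper_on_cong[of ?S "\<tau>(v := \<sigma> v)" \<tau> E] proper_on_mono[OF psubset.prems(3)] by auto
      show "degenerate E D ?S" by (rule degenerate_mono[OF psubset.prems(1)]) auto
      show "proper_on E ?S \<sigma>" by (rule proper_on_mono[OF psubset.prems(2)]) auto
      show "(\<tau>(v := \<sigma> v)) ` ?S \<subseteq> P" using psubset.prems(4) by auto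
      show "(\<tau>(v := \<sigma> v)) x = \<sigma> x" if "x \<notin> ?S" for x using psubset.prems(5)[of x] that by auto
    qed (use v(1) in auto)
    then obtain ms where ms: "moves_ok E ?S P \<sigma> ms" "recolor ms \<sigma> = \<tau>(v := \<sigma> v)"
      "\<forall>x. move_count x ms \<le> 2 * D + 2" by blast
    have "\<exists>ms'. moves_ok E (insert v ?S) P \<sigma> ms' \<and> recolor ms' \<sigma> = \<tau> \<and>
       (\<forall>x. x \<noteq> v \<longrightarrow> move_count x ms' = move_count x ms) \<and>
       move_count v ms' \<le> (\<Sum>u\<in>U. move_count u ms) div (D + 1) + 2"
    proof (rule insert_vertex[OF _ v(2,3,4) _ P(1) _ _ ms(1)])
      show "U \<inter> e \<noteq> {}" if "e \<in> E" "e \<subseteq> insert v ?S" "v \<in> e" for e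
        using hit that ins by simp
      show "proper_on E (insert v ?S) \<sigma>" "proper_on E (insert v ?S) \<tau>"
        unfolding ins by fact+
      show "recolor ms \<sigma> x = \<tau> x" if "x \<noteq> v" for x using ms(2) that by simp
    qed (use v(1) P psubset.prems(4) in auto)
    then obtain ms' where ms': "moves_ok E S P \<sigma> ms'" "recolor ms' \<sigma> = \<tau>"
       "\<forall>x. x \<noteq> v \<longrightarrow> move_count x ms' = move_count x ms"
       "move_count v ms' \<le> (\<Sum>u\<in>U. move_count u ms) div (D + 1) + 2"
      unfolding ins by blast
    have "(\<Sum>u\<in>U. move_count u ms) \<le> card U * (2 * D + 2)"
      using sum_bounded_above[of U "\<lambda>u. move_count u ms" "2 * D + 2"] ms(3) by auto
    also have "\<dots> \<le> D * (2 * D + 2)" using v(4) by (rule mult_right_mono) simp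
    also have "\<dots> = 2 * D * (D + 1)" by algebra
    finally have "(\<Sum>u\<in>U. move_count u ms) div (D + 1) \<le> (2 * D * (D + 1)) div (D + 1)"
      by (rule div_le_mono)
    also have "\<dots> = 2 * D" by (rule nonzero_mult_div_cancel_right) simp
    finally have "move_count v ms' \<le> 2 * D + 2" using ms'(4) by linarith
    with ms' ms(3) show ?thesis by (metis)
  qed
qed

lemma degenerate_coloring:
  assumes "finite S" "degenerate E D S" and E2: "\<forall>e\<in>E. card e \<ge> 2"
    and P: "finite P" "card P \<ge> D + 1"
  shows "\<exists>\<tau>. proper_on E S \<tau> \<and> \<tau> ` S \<subseteq> P \<and> (\<forall>x. x \<notin> S \<longrightarrow> \<tau> x = \<sigma> x)"
  using assms(1,2)
proof (induction S rule: finite_psubset_induct)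
  case (psubset S)
  show ?case
  proof (cases "S = {}")
    case True
    then have "proper_on E S \<sigma>" using E2 by (auto simp: proper_on_def)
    then show ?thesis using True by blast
  next
    case False
    obtain v U where v: "v \<in> S" "finite U" "U \<subseteq> S - {v}" "card U \<le> D"
      and hit: "\<And>e. e \<in> E \<Longrightarrow> e \<subseteq> S \<Longrightarrow> v \<in> e \<Longrightarrow> U \<inter> e \<noteq> {}"
      using degenerate_vertex[OF psubset.prems(1) False psubset.hyps E2] by metis
    let ?S = "S - {v}"
    have ins: "insert v ?S = S" using v(1) by auto
    have "\<exists>\<tau>. proper_on E ?S \<tau> \<and> \<tau> ` ?S \<subseteq> P \<and> (\<forall>x. x \<notin> ?S \<longrightarrow> \<tau> x = \<sigma> x)"
      by (rule psubset.IH) (use v(1) psubset.prems in \<open>auto intro: degenerate_mono\<close>)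
    then obtain \<tau> where \<tau>: "proper_on E ?S \<tau>" "\<tau> ` ?S \<subseteq> P" "\<forall>x. x \<notin> ?S \<longrightarrow> \<tau> x = \<sigma> x" by blast
    have "card (\<tau> ` U) \<le> D" using card_image_le[OF v(2)] v(4) le_trans by blast
    then have "\<not> P \<subseteq> \<tau> ` U" using card_mono[of "\<tau> ` U" P] v(2) P by auto
    then obtain c where c: "c \<in> P" "c \<notin> \<tau> ` U" by blast
    have "proper_on E ?S (\<tau>(v := c))" using \<tau>(1) proper_on_cong[of ?S "\<tau>(v := c)" \<tau>] by auto
    then have "proper_on E (insert v ?S) (\<tau>(v := c))"
      by (rule proper_on_insert[where U = U]) (use hit c v ins in auto)
    moreover have "(\<tau>(v := c)) ` S \<subseteq> P" "\<forall>x. x \<notin> S \<longrightarrow> (\<tau>(v := c)) x = \<sigma> x"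
      using \<tau> c v(1) by auto
    ultimately show ?thesis unfolding ins by blast
  qed
qed

section \<open>The coloring graph when greedy remainders are degenerate\<close>

locale edge_hypergraph =
  fixes V :: "'v set" and E :: "'v set set"
  assumes finite_V: "finite V"
    and edge_subset: "e \<in> E \<Longrightarrow> e \<subseteq> V"
    and edge_card: "e \<in> E \<Longrightarrow> card e \<ge> 2"
begin

abbreviation colorings :: "nat \<Rightarrow> ('v \<Rightarrow> nat) set" where
  "colorings q \<equiv> proper_colorings q (V, E)"

text \<open>The number bounds the length from above, and a step may leave the coloring unchanged;
  this makes walks monotone in it and lets moves of any kind count as steps. Agreement off
  \<open>v\<close> is demanded on the whole type, which fits extensional colorings.\<close>

inductive walk :: "nat \<Rightarrow> nat \<Rightarrow> ('v \<Rightarrow> nat) \<Rightarrow> ('v \<Rightarrow> nat) \<Rightarrow> bool" for q where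
  walk_refl: "\<sigma> \<in> colorings q \<Longrightarrow> walk q l \<sigma> \<sigma>"
| walk_step: "walk q l \<sigma> \<tau> \<Longrightarrow> v \<in> V \<Longrightarrow> \<tau>' \<in> colorings q \<Longrightarrow> \<forall>x. x \<noteq> v \<longrightarrow> \<tau>' x = \<tau> x \<Longrightarrow>
    walk q (Suc l) \<sigma> \<tau>'"

text \<open>A vertex not absorbed by the first i + 1 classes would complete an edge in class i, so
  class i is maximal in what the earlier ones leave. Only maximality is recorded, independence being
  a matter of properness; the probabilistic part can then range over arbitrary assignments.\<close>

definition maximal_classes :: "nat list \<Rightarrow> ('v \<Rightarrow> nat) \<Rightarrow> bool" where
  "maximal_classes ds \<sigma> \<longleftrightarrow> (\<forall>i<length ds. \<forall>v\<in>V. \<sigma> v \<notin> set (take (Suc i) ds) \<longrightarrow>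
     (\<exists>e\<in>E. v \<in> e \<and> (\<forall>u\<in>e - {v}. \<sigma> u = ds ! i)))"

definition same_classes :: "nat set \<Rightarrow> ('v \<Rightarrow> nat) \<Rightarrow> ('v \<Rightarrow> nat) \<Rightarrow> bool" where
  "same_classes C \<sigma> \<tau> \<longleftrightarrow> (\<forall>v\<in>V. \<sigma> v \<in> C \<or> \<tau> v \<in> C \<longrightarrow> \<sigma> v = \<tau> v)"

lemma colorings_iff: "\<sigma> \<in> colorings q \<longleftrightarrow> \<sigma> \<in> V \<rightarrow>\<^sub>E {1..q} \<and> proper_on E V \<sigma>"
proof -
  have "card (\<sigma> ` e) \<ge> 2 \<longleftrightarrow> bichromatic \<sigma> e" if "e \<in> E" for e
  proof
    have fin: "finite e" using finite_subset[OF edge_subset[OF that] finite_V] .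
    show "bichromatic \<sigma> e" if c: "card (\<sigma> ` e) \<ge> 2"
    proof (rule ccontr)
      assume n: "\<not> bichromatic \<sigma> e"
      obtain u where u: "u \<in> e" using c by (cases "e = {}") auto
      have "\<sigma> ` e \<subseteq> {\<sigma> u}" using n u unfolding bichromatic_def by blast
      then have "card (\<sigma> ` e) \<le> card {\<sigma> u}" by (intro card_mono) auto
      with c show False by simp
    qed
    assume "bichromatic \<sigma> e"
    then obtain u w where uw: "u \<in> e" "w \<in> e" "\<sigma> u \<noteq> \<sigma> w" unfolding bichromatic_def by blast
    then have "card {\<sigma> u, \<sigma> w} \<le> card (\<sigma> ` e)" using fin by (intro card_mono) auto
    with uw show "card (\<sigma> ` e) \<ge> 2" by simp
  qed
  then show ?thesis unfolding proper_colorings_def proper_on_def using edge_subset by auto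
qed

lemma walk_ends: "walk q l \<sigma> \<tau> \<Longrightarrow> \<sigma> \<in> colorings q \<and> \<tau> \<in> colorings q"
  by (induction rule: walk.induct) auto

lemma walk_mono: "walk q l \<sigma> \<tau> \<Longrightarrow> l \<le> l' \<Longrightarrow> walk q l' \<sigma> \<tau>"
proof (induction arbitrary: l' rule: walk.induct)
  case (walk_step l \<sigma> \<tau> v \<tau>')
  then obtain l'' where "l' = Suc l''" "l \<le> l''" by (cases l') auto
  with walk_step show ?case by (auto intro: walk.walk_step)
qed (rule walk_refl)

lemma walk_trans: "walk q l' \<tau> \<rho> \<Longrightarrow> walk q l \<sigma> \<tau> \<Longrightarrow> walk q (l + l') \<sigma> \<rho>"
proof (induction rule: walk.induct)
  case (walk_refl \<tau> l')
  then show ?case by (auto intro: walk_mono)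
next
  case (walk_step l' \<sigma>' \<tau> v \<tau>')
  then show ?case by (auto intro: walk.walk_step)
qed

lemma walk_single:
  assumes "\<sigma> \<in> colorings q" "v \<in> V" "\<tau> \<in> colorings q" "\<forall>x. x \<noteq> v \<longrightarrow> \<tau> x = \<sigma> x"
  shows "walk q (Suc l) \<sigma> \<tau>"
  using walk_step[OF walk_refl] assms by blast

lemma walk_sym: "walk q l \<sigma> \<tau> \<Longrightarrow> walk q l \<tau> \<sigma>"
proof (induction rule: walk.induct)
  case (walk_step l \<sigma> \<tau> v \<tau>')
  have "walk q (Suc 0) \<tau>' \<tau>"
    by (rule walk_single[of _ _ v]) (use walk_step walk_ends in auto)
  then show ?case using walk_trans[OF walk_step.IH, of "Suc 0"] by simp
qed (rule walk_refl)

lemma same_classes_trans: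
  "same_classes C \<sigma> \<tau> \<Longrightarrow> same_classes C \<tau> \<rho> \<Longrightarrow> same_classes C \<sigma> \<rho>"
  unfolding same_classes_def by metis

lemma same_classes_refl: "same_classes C \<sigma> \<sigma>"
  unfolding same_classes_def by auto

lemma same_classes_mono: "same_classes C \<sigma> \<tau> \<Longrightarrow> C' \<subseteq> C \<Longrightarrow> same_classes C' \<sigma> \<tau>"
  unfolding same_classes_def by blast

lemma same_classes_sym: "same_classes C \<sigma> \<tau> \<Longrightarrow> same_classes C \<tau> \<sigma>"
  unfolding same_classes_def by metis

lemma maximal_classes_cong:
  assumes same: "same_classes (set ds) \<sigma> \<tau>" and max: "maximal_classes ds \<sigma>"
  shows "maximal_classes ds \<tau>"
  unfolding maximal_classes_def
proof (intro allI impI ballI)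
  fix i v assume i: "i < length ds" and v: "v \<in> V" "\<tau> v \<notin> set (take (Suc i) ds)"
  have "\<sigma> v \<notin> set (take (Suc i) ds)"
    using same v set_take_subset[of "Suc i" ds] unfolding same_classes_def by (metis subsetD)
  then obtain e where e: "e \<in> E" "v \<in> e" "\<forall>u\<in>e - {v}. \<sigma> u = ds ! i"
    using max i v(1) unfolding maximal_classes_def by blast
  have "\<tau> u = ds ! i" if "u \<in> e - {v}" for u
  proof -
    have "\<sigma> u = ds ! i" "u \<in> V" using e edge_subset that by auto
    moreover have "ds ! i \<in> set ds" using i by simp
    ultimately show ?thesis using same unfolding same_classes_def by metis
  qed
  with e show "\<exists>e\<in>E. v \<in> e \<and> (\<forall>u\<in>e - {v}. \<tau> u = ds ! i)" by blast
qed

lemma maximal_classes_append: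
  "maximal_classes (ds @ [c]) \<sigma> \<longleftrightarrow> maximal_classes ds \<sigma> \<and>
     (\<forall>v\<in>V. \<sigma> v \<notin> set ds \<longrightarrow> \<sigma> v \<noteq> c \<longrightarrow> (\<exists>e\<in>E. v \<in> e \<and> (\<forall>u\<in>e - {v}. \<sigma> u = c)))"
  unfolding maximal_classes_def by (auto simp: less_Suc_eq nth_append)

lemma maximal_classes_prefix: "maximal_classes (ds @ cs) \<sigma> \<Longrightarrow> maximal_classes ds \<sigma>"
proof (induction cs arbitrary: ds)
  case (Cons c cs)
  from Cons.IH[of "ds @ [c]"] Cons.prems show ?case by (simp add: maximal_classes_append)
qed simp

text \<open>An edge not inside the remainder has a vertex u in a class of \<open>C\<close>. Some
  vertex w of it is outside that class under \<sigma>, and \<tau> cannot put w there because the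
  class is the same.\<close>

lemma proper_on_glue:
  assumes p\<sigma>: "proper_on E V \<sigma>" and same: "same_classes C \<sigma> \<tau>"
    and p\<tau>: "proper_on E {v \<in> V. \<sigma> v \<notin> C} \<tau>"
  shows "proper_on E V \<tau>"
  unfolding proper_on_def
proof (intro ballI impI)
  fix e assume e: "e \<in> E" "e \<subseteq> V"
  show "bichromatic \<tau> e"
  proof (cases "e \<subseteq> {v \<in> V. \<sigma> v \<notin> C}")
    case True
    with p\<tau> e show ?thesis unfolding proper_on_def by blast
  next
    case False
    then obtain u where u: "u \<in> e" "\<sigma> u \<in> C" using e by blast
    obtain w where w: "w \<in> e" "\<sigma> w \<noteq> \<sigma> u"
      using p\<sigma> e unfolding proper_on_def bichromatic_def by metis
    have V: "u \<in> V" "w \<in> V" using u w e by auto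
    have "\<tau> u = \<sigma> u" using same u V unfolding same_classes_def by metis
    moreover have "\<tau> w \<noteq> \<sigma> u" using same w u V unfolding same_classes_def by metis
    ultimately show ?thesis unfolding bichromatic_def using u w by metis
  qed
qed

text \<open>While class \<open>c\<close> is not maximal, some vertex outside it and outside
  \<open>ds\<close> can safely be given the color \<open>c\<close>. Each such move removes one
  vertex from the set whose size bounds the walk.\<close>

lemma extend_one:
  assumes "\<sigma> \<in> colorings q" "c \<in> {1..q}" "c \<notin> set ds" "maximal_classes ds \<sigma>"
  shows "\<exists>\<sigma>'. walk q (card {v \<in> V. \<sigma> v \<notin> insert c (set ds)}) \<sigma> \<sigma>' \<and>
    same_classes (set ds) \<sigma> \<sigma>' \<and> maximal_classes (ds @ [c]) \<sigma>'"
  using assms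
proof (induction "card {v \<in> V. \<sigma> v \<notin> insert c (set ds)}" arbitrary: \<sigma> rule: less_induct)
  case less
  let ?R = "{v \<in> V. \<sigma> v \<notin> insert c (set ds)}"
  show ?case
  proof (cases "maximal_classes (ds @ [c]) \<sigma>")
    case True
    with less.prems show ?thesis using walk_refl same_classes_refl by blast
  next
    case False
    with less.prems(4) have "\<exists>v\<in>V. \<sigma> v \<notin> set ds \<and> \<sigma> v \<noteq> c \<and>
        \<not> (\<exists>e\<in>E. v \<in> e \<and> (\<forall>u\<in>e - {v}. \<sigma> u = c))"
      by (simp add: maximal_classes_append)
    then obtain v where v: "v \<in> V" "\<sigma> v \<notin> set ds" "\<sigma> v \<noteq> c"
      and ne: "\<not> (\<exists>e\<in>E. v \<in> e \<and> (\<forall>u\<in>e - {v}. \<sigma> u = c))" by (elim bexE conjE)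
    let ?\<sigma> = "\<sigma>(v := c)"
    have "proper_on E V ?\<sigma>" unfolding proper_on_def
    proof (intro ballI impI)
      fix e assume e: "e \<in> E" "e \<subseteq> V"
      show "bichromatic ?\<sigma> e"
      proof (cases "v \<in> e")
        case True
        with ne e(1) obtain u where "u \<in> e" "u \<noteq> v" "\<sigma> u \<noteq> c" by blast
        with True show ?thesis unfolding bichromatic_def by (metis fun_upd_apply)
      next
        case False
        have "bichromatic \<sigma> e" using less.prems(1) e unfolding colorings_iff proper_on_def by blast
        moreover have "bichromatic \<sigma> e = bichromatic ?\<sigma> e"
          by (rule bichromatic_cong) (use False in auto)
        ultimately show ?thesis by simp
      qed
    qed
    then have col: "?\<sigma> \<in> colorings q"
      using less.prems(1,2) v(1) unfolding colorings_iff by (auto simp: PiE_iff extensional_def)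
    have R: "{x \<in> V. ?\<sigma> x \<notin> insert c (set ds)} = ?R - {v}" by auto
    have finR: "finite ?R" using finite_V by simp
    have vR: "v \<in> ?R" using v by simp
    have cardR: "card ?R = Suc (card (?R - {v}))"
      using card.remove[OF finR vR] .
    have same: "same_classes (set ds) \<sigma> ?\<sigma>"
      using v less.prems(3) unfolding same_classes_def by auto
    have "\<exists>\<sigma>'. walk q (card {x \<in> V. ?\<sigma> x \<notin> insert c (set ds)}) ?\<sigma> \<sigma>' \<and>
        same_classes (set ds) ?\<sigma> \<sigma>' \<and> maximal_classes (ds @ [c]) \<sigma>'"
    proof (rule less.hyps)
      show "card {x \<in> V. ?\<sigma> x \<notin> insert c (set ds)} < card ?R" unfolding R cardR by simp
      show "maximal_classes ds ?\<sigma>" using maximal_classes_cong[OF same less.prems(4)] .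
    qed (rule col less.prems(2,3))+
    then obtain \<sigma>' where \<sigma>': "walk q (card (?R - {v})) ?\<sigma> \<sigma>'"
      "same_classes (set ds) ?\<sigma> \<sigma>'" "maximal_classes (ds @ [c]) \<sigma>'" unfolding R by blast
    have "walk q (Suc 0) \<sigma> ?\<sigma>" by (rule walk_single[OF less.prems(1) v(1) col]) simp
    from walk_trans[OF \<sigma>'(1) this]
    have "walk q (card ?R) \<sigma> \<sigma>'" unfolding cardR by simp
    with \<sigma>' same_classes_trans[OF same \<sigma>'(2)] show ?thesis by blast
  qed
qed

lemma maximal_classes_Nil: "maximal_classes [] \<sigma>"
  unfolding maximal_classes_def by simp

lemma extend:
  assumes "\<sigma> \<in> colorings q" "distinct (ds @ cs)" "set cs \<subseteq> {1..q}" "maximal_classes ds \<sigma>"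
  shows "\<exists>\<sigma>'. walk q (length cs * card V) \<sigma> \<sigma>' \<and> same_classes (set ds) \<sigma> \<sigma>' \<and>
    maximal_classes (ds @ cs) \<sigma>'"
  using assms
proof (induction cs arbitrary: ds \<sigma>)
  case Nil
  then show ?case using walk_refl[OF Nil.prems(1), of 0] same_classes_refl[of "set ds" \<sigma>]
    by (intro exI[of _ \<sigma>]) simp
next
  case (Cons c cs)
  obtain \<sigma>1 where 1: "walk q (card {v \<in> V. \<sigma> v \<notin> insert c (set ds)}) \<sigma> \<sigma>1"
    "same_classes (set ds) \<sigma> \<sigma>1" "maximal_classes (ds @ [c]) \<sigma>1"
    using extend_one[of \<sigma> q c ds] Cons.prems by auto
  have "walk q (card V) \<sigma> \<sigma>1" by (rule walk_mono[OF 1(1)]) (auto intro: card_mono finite_V)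
  moreover obtain \<sigma>2 where 2: "walk q (length cs * card V) \<sigma>1 \<sigma>2"
    "same_classes (set (ds @ [c])) \<sigma>1 \<sigma>2" "maximal_classes ((ds @ [c]) @ cs) \<sigma>2"
    using Cons.IH[of \<sigma>1 "ds @ [c]"] Cons.prems 1 walk_ends by fastforce
  ultimately have "walk q (card V + length cs * card V) \<sigma> \<sigma>2" using walk_trans by blast
  moreover have "same_classes (set ds) \<sigma> \<sigma>2"
    by (rule same_classes_trans[OF 1(2) same_classes_mono[OF 2(2)]]) auto
  ultimately show ?case using 2(3) by auto
qed

lemma moves_walk:
  assumes "\<sigma> \<in> colorings q" "moves_ok E {v \<in> V. \<sigma> v \<notin> C} P \<sigma> ms" "P \<subseteq> {1..q} - C"
  shows "walk q (length ms) \<sigma> (recolor ms \<sigma>)"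
  using assms(1,2)
proof (induction ms arbitrary: \<sigma>)
  case Nil
  then show ?case by (simp add: walk_refl)
next
  case (Cons m ms)
  obtain w c where m: "m = (w, c)" by (cases m)
  let ?R = "{v \<in> V. \<sigma> v \<notin> C}" and ?\<sigma> = "\<sigma>(w := c)"
  have w: "w \<in> ?R" and c: "c \<in> P" and ok: "moves_ok E ?R P ?\<sigma> ms"
    using Cons.prems m by auto
  have R: "{v \<in> V. ?\<sigma> v \<notin> C} = ?R" using w c assms(3) by auto
  have "proper_on E V ?\<sigma>"
  proof (rule proper_on_glue)
    show "proper_on E V \<sigma>" using Cons.prems unfolding colorings_iff by blast
    show "same_classes C \<sigma> ?\<sigma>" using w c assms(3) unfolding same_classes_def by auto
    show "proper_on E ?R ?\<sigma>" using moves_ok_proper[OF ok] .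
  qed
  then have col: "?\<sigma> \<in> colorings q"
    using Cons.prems(1) w c assms(3) unfolding colorings_iff by (auto simp: PiE_iff extensional_def)
  have "walk q (length ms) ?\<sigma> (recolor ms ?\<sigma>)"
    by (rule Cons.IH[OF col]) (use ok in \<open>simp only: R\<close>)
  moreover have "walk q (Suc 0) \<sigma> ?\<sigma>"
    by (rule walk_single[OF Cons.prems(1) _ col, of w]) (use w in auto)
  ultimately show ?case using walk_trans by (fastforce simp: m)
qed

lemma rest_recolor:
  assumes \<sigma>: "\<sigma> \<in> colorings q" and \<tau>: "\<tau> \<in> colorings q" and same: "same_classes C \<sigma> \<tau>"
    and deg: "degenerate E D {v \<in> V. \<sigma> v \<notin> C}"
    and P: "P \<subseteq> {1..q} - C" "card P \<ge> 2 * D + 2" "\<tau> ` {v \<in> V. \<sigma> v \<notin> C} \<subseteq> P"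
  shows "walk q ((2 * D + 2) * card V) \<sigma> \<tau>"
proof -
  let ?R = "{v \<in> V. \<sigma> v \<notin> C}"
  have finR: "finite ?R" using finite_V by simp
  have "\<exists>ms. moves_ok E ?R P \<sigma> ms \<and> recolor ms \<sigma> = \<tau> \<and> (\<forall>x. move_count x ms \<le> 2 * D + 2)"
  proof (rule degenerate_recoloring[OF finR deg])
    show "\<forall>e\<in>E. card e \<ge> 2" using edge_card by blast
    show "finite P" using P(1) by (rule finite_subset) simp
    show "proper_on E ?R \<sigma>" "proper_on E ?R \<tau>"
      using \<sigma> \<tau> unfolding colorings_iff by (auto intro: proper_on_mono[of E V])
    show "\<tau> x = \<sigma> x" if "x \<notin> ?R" for x
    proof (cases "x \<in> V")
      case True
      then have "\<sigma> x \<in> C" using that by blast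
      then show ?thesis using True same unfolding same_classes_def by metis
    next
      case False
      then show ?thesis using \<sigma> \<tau> unfolding colorings_iff by (auto simp: PiE_iff extensional_def)
    qed
  qed (use P in auto)
  then obtain ms where ms: "moves_ok E ?R P \<sigma> ms" "recolor ms \<sigma> = \<tau>"
    "\<forall>x. move_count x ms \<le> 2 * D + 2" by blast
  \<comment> \<open>The length of the sequence is the sum of the move counts of the vertices, which
    is where the bound per vertex turns into a linear one.\<close>
  have "filter (\<lambda>m. fst m \<in> ?R) ms = ms"
    using moves_ok_subset[OF ms(1)] by (auto intro!: filter_True)
  then have "length ms = (\<Sum>u\<in>?R. move_count u ms)"
    using length_filter_sum_move_count[OF finR, of ms] by simp
  also have "\<dots> \<le> card ?R * (2 * D + 2)"
    using sum_bounded_above[of ?R "\<lambda>u. move_count u ms" "2 * D + 2"] ms(3) by auto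
  also have "\<dots> \<le> card V * (2 * D + 2)"
    by (intro mult_le_mono1 card_mono finite_V) auto
  also have "\<dots> = (2 * D + 2) * card V" by (rule mult.commute)
  finally show ?thesis using walk_mono[OF moves_walk[OF \<sigma> ms(1) P(1)]] ms(2) by simp
qed

text \<open>In every intermediate coloring class \<open>c\<close> lies inside the independent set
  \<open>B\<close>, and all other classes have only shrunk, so the order of the moves does not
  matter.\<close>

lemma paint:
  assumes \<sigma>: "\<sigma> \<in> colorings q" and c: "c \<in> {1..q}" and B: "B \<subseteq> V"
    and cB: "\<And>v. v \<in> V \<Longrightarrow> \<sigma> v = c \<Longrightarrow> v \<in> B" and indep: "\<And>e. e \<in> E \<Longrightarrow> \<not> e \<subseteq> B"
  shows "walk q (card V) \<sigma> (\<lambda>v. if v \<in> B then c else \<sigma> v)"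
proof -
  have finB: "finite B" using finite_subset[OF B finite_V] .
  have "walk q (card A) \<sigma> (\<lambda>v. if v \<in> A then c else \<sigma> v)" if "finite A" "A \<subseteq> B" for A
    using that
  proof (induction A rule: finite_induct)
    case empty
    then show ?case using walk_refl[OF \<sigma>, of 0] by simp
  next
    case (insert x A)
    let ?\<sigma> = "\<lambda>v. if v \<in> insert x A then c else \<sigma> v"
    have "proper_on E V ?\<sigma>" unfolding proper_on_def
    proof (intro ballI impI)
      fix e assume e: "e \<in> E" "e \<subseteq> V"
      obtain y where y: "y \<in> e" "y \<notin> B" using indep[OF e(1)] by blast
      have y': "?\<sigma> y \<noteq> c" using y cB[of y] e insert.prems by auto
      show "bichromatic ?\<sigma> e"
      proof (cases "e \<inter> insert x A = {}")
        case True
        have "bichromatic \<sigma> e" using \<sigma> e unfolding colorings_iff proper_on_def by blast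
        moreover have "bichromatic \<sigma> e = bichromatic ?\<sigma> e"
          by (rule bichromatic_cong) (use True in auto)
        ultimately show ?thesis by simp
      next
        case False
        then obtain z where "z \<in> e" "z \<in> insert x A" by blast
        then have z: "z \<in> e" "?\<sigma> z = c" by simp_all
        show ?thesis unfolding bichromatic_def
          by (rule bexI[OF _ y(1)], rule bexI[OF _ z(1)]) (use y' z(2) in metis)
      qed
    qed
    moreover have "?\<sigma> \<in> V \<rightarrow>\<^sub>E {1..q}"
      using \<sigma> c insert.prems B unfolding colorings_iff by (auto simp: PiE_iff extensional_def)
    ultimately have col: "?\<sigma> \<in> colorings q" unfolding colorings_iff by blast
    have "walk q (card A) \<sigma> (\<lambda>v. if v \<in> A then c else \<sigma> v)" using insert by blast
    then have "walk q (Suc (card A)) \<sigma> ?\<sigma>"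
      by (rule walk_step[where v = x]) (use insert.prems B col in auto)
    then show ?case using insert.hyps by simp
  qed
  from this[OF finB] show ?thesis
    using walk_mono card_mono[OF finite_V B] by blast
qed

end

text \<open>This is all that the recoloring argument uses of the random hypergraph. The map \<sigma>
  is arbitrary, so every start and every order of the greedy process is covered.\<close>

locale greedy_degenerate = edge_hypergraph +
  fixes a D :: nat
  assumes greedy: "length ds = a \<Longrightarrow> distinct ds \<Longrightarrow> maximal_classes ds \<sigma> \<Longrightarrow>
    degenerate E D {v \<in> V. \<sigma> v \<notin> set ds}"
begin

text \<open>The classes \<open>ds\<close> are completed to \<open>a\<close> greedy classes that
  avoid \<open>c\<close>. The remainder is then degenerate, and of the q - a colors left to it at
  least 2D + 2 differ from \<open>c\<close>, enough both for a coloring without \<open>c\<close> and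
  for a walk to it.\<close>

lemma free_color:
  assumes q: "q \<ge> a + 2 * D + 3" and \<sigma>: "\<sigma> \<in> colorings q"
    and ds: "distinct ds" "length ds \<le> a" "set ds \<subseteq> {1..q}" "maximal_classes ds \<sigma>"
    and c: "c \<in> {1..q} - set ds"
  shows "\<exists>\<sigma>'. walk q ((a + 2 * D + 2) * card V) \<sigma> \<sigma>' \<and> same_classes (set ds) \<sigma> \<sigma>' \<and>
    (\<forall>v\<in>V. \<sigma>' v \<noteq> c)"
proof -
  let ?X = "{1..q} - set ds - {c}"
  have "card ?X = q - length ds - 1"
    using c ds by (simp add: card_Diff_subset distinct_card)
  then have "a - length ds \<le> card ?X" using q by linarith
  then obtain T where T: "T \<subseteq> ?X" "card T = a - length ds" "finite T"
    by (rule obtain_subset_with_card_n)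
  obtain cs where cs: "set cs = T" "distinct cs" using finite_distinct_list[OF T(3)] by blast
  have len: "length cs = a - length ds" using cs T(2) distinct_card by fastforce
  obtain \<sigma>1 where 1: "walk q (length cs * card V) \<sigma> \<sigma>1" "same_classes (set ds) \<sigma> \<sigma>1"
    "maximal_classes (ds @ cs) \<sigma>1"
    using extend[OF \<sigma>, of ds cs] ds cs T(1) by auto
  have col1: "\<sigma>1 \<in> colorings q" using walk_ends[OF 1(1)] by blast
  let ?C = "set (ds @ cs)"
  let ?R = "{v \<in> V. \<sigma>1 v \<notin> ?C}"
  have dist: "distinct (ds @ cs)" using ds cs T(1) by auto
  have lenC: "length (ds @ cs) = a" using len ds(2) by simp
  have deg: "degenerate E D ?R" using greedy[OF lenC dist 1(3)] .
  let ?P = "{1..q} - ?C - {c}"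
  have "card ?C = a" using distinct_card[OF dist] lenC by simp
  moreover have "?C \<subseteq> {1..q}" "c \<notin> ?C" "c \<in> {1..q}" using ds(3) cs T(1) c by auto
  ultimately have "card ?P = q - a - 1" by (simp add: card_Diff_subset)
  then have cardP: "card ?P \<ge> 2 * D + 2" using q by linarith
  have "\<exists>\<tau>. proper_on E ?R \<tau> \<and> \<tau> ` ?R \<subseteq> ?P \<and> (\<forall>x. x \<notin> ?R \<longrightarrow> \<tau> x = \<sigma>1 x)"
    by (rule degenerate_coloring[OF _ deg]) (use finite_V edge_card cardP in auto)
  then obtain \<tau> where \<tau>: "proper_on E ?R \<tau>" "\<tau> ` ?R \<subseteq> ?P" "\<And>x. x \<notin> ?R \<Longrightarrow> \<tau> x = \<sigma>1 x" by blast
  have same: "same_classes ?C \<sigma>1 \<tau>"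
    unfolding same_classes_def
  proof (intro ballI impI)
    fix v assume v: "v \<in> V" "\<sigma>1 v \<in> ?C \<or> \<tau> v \<in> ?C"
    then have "v \<notin> ?R" using \<tau>(2) by blast
    then show "\<sigma>1 v = \<tau> v" using \<tau>(3) by simp
  qed
  have "\<tau> v \<in> {1..q}" if "v \<in> V" for v
    using that \<tau>(2) \<tau>(3)[of v] col1 unfolding colorings_iff by (cases "v \<in> ?R") (auto simp: PiE_iff)
  moreover have "\<tau> v = undefined" if "v \<notin> V" for v
    using that \<tau>(3)[of v] col1 unfolding colorings_iff by (auto simp: PiE_iff extensional_def)
  ultimately have "\<tau> \<in> V \<rightarrow>\<^sub>E {1..q}" by auto
  moreover have "proper_on E V \<tau>"
    by (rule proper_on_glue[OF _ same \<tau>(1)]) (use col1 colorings_iff in blast)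
  ultimately have col: "\<tau> \<in> colorings q" unfolding colorings_iff by blast
  have "walk q ((2 * D + 2) * card V) \<sigma>1 \<tau>"
    by (rule rest_recolor[OF col1 col same deg _ cardP \<tau>(2)]) auto
  from walk_trans[OF this 1(1)] have "walk q (length cs * card V + (2 * D + 2) * card V) \<sigma> \<tau>" .
  moreover have "length cs * card V + (2 * D + 2) * card V \<le> (a + 2 * D + 2) * card V"
    using len by (simp add: add_mult_distrib)
  ultimately have "walk q ((a + 2 * D + 2) * card V) \<sigma> \<tau>" by (rule walk_mono)
  moreover have "same_classes (set ds) \<sigma> \<tau>"
    by (rule same_classes_trans[OF 1(2) same_classes_mono[OF same]]) auto
  moreover have "\<tau> v \<noteq> c" if "v \<in> V" for v
  proof (cases "v \<in> ?R")
    case True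
    then show ?thesis using \<tau>(2) by blast
  next
    case False
    then have "\<tau> v \<in> ?C" using \<tau>(3)[of v] that by auto
    then show ?thesis using \<open>c \<notin> ?C\<close> by metis
  qed
  ultimately show ?thesis by blast
qed

text \<open>The first \<open>i\<close> greedy classes of \<open>\<tau>\<close> are installed one at a time, each into a freed color.\<close>

lemma install_classes:
  assumes q: "q \<ge> a + 2 * D + 3" and \<sigma>: "\<sigma> \<in> colorings q" and \<tau>: "\<tau> \<in> colorings q"
    and max: "maximal_classes [1..<Suc a] \<tau>" and i: "i \<le> a"
  shows "\<exists>\<sigma>'. walk q (i * (a + 2 * D + 3) * card V) \<sigma> \<sigma>' \<and> same_classes {1..i} \<sigma>' \<tau>"
  using i
proof (induction i)
  case 0
  then show ?case using walk_refl[OF \<sigma>] unfolding same_classes_def by auto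
next
  case (Suc i)
  then obtain \<sigma>1 where 1: "walk q (i * (a + 2 * D + 3) * card V) \<sigma> \<sigma>1" "same_classes {1..i} \<sigma>1 \<tau>"
    by auto
  let ?ds = "[1..<Suc i]" and ?c = "Suc i"
  have set_ds: "set ?ds = {1..i}" by auto
  have "[1..<Suc a] = ?ds @ [Suc i..<Suc a]"
    using upt_add_eq_append[of 1 "Suc i" "a - i"] Suc.prems by simp
  then have "maximal_classes ?ds \<tau>" using max maximal_classes_prefix by metis
  then have max1: "maximal_classes ?ds \<sigma>1"
    by (rule maximal_classes_cong[rotated]) (use 1(2) same_classes_sym set_ds in metis)
  have c: "?c \<in> {1..q}" using Suc.prems q by auto
  have "\<exists>\<sigma>2. walk q ((a + 2 * D + 2) * card V) \<sigma>1 \<sigma>2 \<and> same_classes (set ?ds) \<sigma>1 \<sigma>2 \<and>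
      (\<forall>v\<in>V. \<sigma>2 v \<noteq> ?c)"
    by (rule free_color[OF q]) (use walk_ends[OF 1(1)] max1 Suc.prems q in auto)
  then obtain \<sigma>2 where 2: "walk q ((a + 2 * D + 2) * card V) \<sigma>1 \<sigma>2"
    "same_classes {1..i} \<sigma>1 \<sigma>2" "\<forall>v\<in>V. \<sigma>2 v \<noteq> ?c" unfolding set_ds by blast
  let ?B = "{v \<in> V. \<tau> v = ?c}"
  let ?\<sigma> = "\<lambda>v. if v \<in> ?B then ?c else \<sigma>2 v"
  have 3: "walk q (card V) \<sigma>2 ?\<sigma>"
  proof (rule paint[OF _ c])
    show "\<not> e \<subseteq> ?B" if "e \<in> E" for e
    proof
      assume "e \<subseteq> ?B"
      then have "\<tau> u = ?c" if "u \<in> e" for u using that by blast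
      then have "\<not> bichromatic \<tau> e" unfolding bichromatic_def by metis
      with \<tau> that edge_subset[OF that] show False unfolding colorings_iff proper_on_def by blast
    qed
  qed (use walk_ends[OF 2(1)] 2(3) in auto)
  have "walk q (i * (a + 2 * D + 3) * card V + ((a + 2 * D + 2) * card V + card V)) \<sigma> ?\<sigma>"
    using walk_trans[OF walk_trans[OF 3 2(1)] 1(1)] .
  moreover have "same_classes {1..Suc i} ?\<sigma> \<tau>"
    unfolding same_classes_def
  proof (intro ballI impI)
    fix v assume v: "v \<in> V" and or: "?\<sigma> v \<in> {1..Suc i} \<or> \<tau> v \<in> {1..Suc i}"
    show "?\<sigma> v = \<tau> v"
    proof (cases "v \<in> ?B")
      case True
      then show ?thesis by simp
    next
      case False
      with or v 2(3) have "\<sigma>2 v \<in> {1..i} \<or> \<tau> v \<in> {1..i}" by (auto simp: le_Suc_eq)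
      moreover have "same_classes {1..i} \<sigma>2 \<tau>"
        using same_classes_trans[OF same_classes_sym[OF 2(2)] 1(2)] .
      ultimately have "\<sigma>2 v = \<tau> v" using v unfolding same_classes_def by blast
      then show ?thesis using False by simp
    qed
  qed
  ultimately show ?case by (intro exI[of _ ?\<sigma>]) (simp add: algebra_simps)
qed

text \<open>Making \<tau> greedy costs a moves per vertex, installing its a classes a (a + 2D + 3),
  and recoloring the remainder 2D + 2. The first walk is run backwards at the end.\<close>

theorem colorings_walk:
  assumes q: "q \<ge> a + 2 * D + 3" and \<sigma>: "\<sigma> \<in> colorings q" and \<tau>: "\<tau> \<in> colorings q"
  shows "walk q ((a * (a + 2 * D + 4) + 2 * D + 2) * card V) \<sigma> \<tau>"
proof -
  let ?ds = "[1..<Suc a]"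
  have set_ds: "set ?ds = {1..a}" by auto
  obtain \<tau>' where t: "walk q (a * card V) \<tau> \<tau>'" "maximal_classes ?ds \<tau>'"
    using extend[OF \<tau>, of "[]" ?ds, OF _ _ maximal_classes_Nil] q set_ds
    by (auto simp del: upt_Suc)
  have \<tau>': "\<tau>' \<in> colorings q" using walk_ends[OF t(1)] by blast
  obtain \<sigma>' where s: "walk q (a * (a + 2 * D + 3) * card V) \<sigma> \<sigma>'" "same_classes {1..a} \<sigma>' \<tau>'"
    using install_classes[OF q \<sigma> \<tau>' t(2), of a] by auto
  have \<sigma>': "\<sigma>' \<in> colorings q" using walk_ends[OF s(1)] by blast
  have "maximal_classes ?ds \<sigma>'"
    using maximal_classes_cong[OF _ t(2)] s(2) same_classes_sym unfolding set_ds by blast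
  then have deg: "degenerate E D {v \<in> V. \<sigma>' v \<notin> {1..a}}"
    using greedy[of ?ds \<sigma>'] unfolding set_ds by simp
  have "walk q ((2 * D + 2) * card V) \<sigma>' \<tau>'"
  proof (rule rest_recolor[OF \<sigma>' \<tau>' s(2) deg])
    show "\<tau>' ` {v \<in> V. \<sigma>' v \<notin> {1..a}} \<subseteq> {Suc a..q}"
    proof
      fix y assume "y \<in> \<tau>' ` {v \<in> V. \<sigma>' v \<notin> {1..a}}"
      then obtain v where v: "v \<in> V" "\<sigma>' v \<notin> {1..a}" "y = \<tau>' v" by blast
      then have "y \<notin> {1..a}" using s(2) unfolding same_classes_def by metis
      moreover have "y \<in> {1..q}" using v \<tau>' unfolding colorings_iff by auto
      ultimately show "y \<in> {Suc a..q}" by auto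
    qed
  qed (use q in auto)
  from walk_trans[OF walk_trans[OF walk_sym[OF t(1)] this] s(1)]
  show ?thesis by (rule walk_mono) (simp add: algebra_simps)
qed

text \<open>Connectedness includes having a vertex. The rainbow coloring, with as many colors as
  needed, is made greedy for the colors 1 to a; its remainder is degenerate and can be colored
  afresh with the D + 1 or more colors from a + 1 to q.\<close>

theorem colorings_nonempty:
  assumes q: "q \<ge> a + 2 * D + 3"
  shows "colorings q \<noteq> {}"
proof -
  let ?Q = "max q (card V)"
  obtain f where f: "bij_betw f V {1..card V}"
    using ex_bij_betw_finite_nat[OF finite_V] finite_same_card_bij[OF finite_V, of "{1..card V}"] by auto
  let ?f = "restrict f V"
  have "proper_on E V ?f" unfolding proper_on_def
  proof (intro ballI impI)
    fix e assume e: "e \<in> E" "e \<subseteq> V"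
    have "\<not> (\<forall>x\<in>e. \<forall>y\<in>e. x = y)"
    proof
      assume eq: "\<forall>x\<in>e. \<forall>y\<in>e. x = y"
      then have "card e \<le> Suc 0"
        using card_le_Suc0_iff_eq[of e] finite_subset[OF e(2) finite_V] by blast
      with edge_card[OF e(1)] show False by simp
    qed
    then obtain x y where xy: "x \<in> e" "y \<in> e" "x \<noteq> y" by blast
    then have "f x \<noteq> f y" using f e unfolding bij_betw_def inj_on_def by blast
    then show "bichromatic ?f e" unfolding bichromatic_def
      by (intro bexI[of _ x] bexI[of _ y]) (use xy e in auto)
  qed
  moreover have "?f \<in> V \<rightarrow>\<^sub>E {1..?Q}" using f unfolding bij_betw_def by fastforce
  ultimately have "?f \<in> colorings ?Q" unfolding colorings_iff by blast
  let ?ds = "[1..<Suc a]"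
  have set_ds: "set ?ds = {1..a}" by auto
  have aQ: "a \<le> ?Q" using q by simp
  obtain \<sigma> where \<sigma>: "walk ?Q (a * card V) ?f \<sigma>" "maximal_classes ?ds \<sigma>"
    using extend[OF \<open>?f \<in> colorings ?Q\<close>, of "[]" ?ds, OF _ _ maximal_classes_Nil] aQ set_ds
    by (auto simp del: upt_Suc)
  have col: "\<sigma> \<in> colorings ?Q" using walk_ends[OF \<sigma>(1)] by blast
  let ?R = "{v \<in> V. \<sigma> v \<notin> {1..a}}"
  have deg: "degenerate E D ?R" using greedy[of ?ds \<sigma>] \<sigma>(2) unfolding set_ds by simp
  have "\<exists>\<tau>. proper_on E ?R \<tau> \<and> \<tau> ` ?R \<subseteq> {Suc a..q} \<and> (\<forall>x. x \<notin> ?R \<longrightarrow> \<tau> x = \<sigma> x)"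
    by (rule degenerate_coloring[OF _ deg]) (use finite_V edge_card q in auto)
  then obtain \<tau> where \<tau>: "proper_on E ?R \<tau>" "\<tau> ` ?R \<subseteq> {Suc a..q}" "\<And>x. x \<notin> ?R \<Longrightarrow> \<tau> x = \<sigma> x"
    by blast
  have same: "same_classes {1..a} \<sigma> \<tau>"
    unfolding same_classes_def
  proof (intro ballI impI)
    fix v assume v: "v \<in> V" "\<sigma> v \<in> {1..a} \<or> \<tau> v \<in> {1..a}"
    then have "v \<notin> ?R" using \<tau>(2) by fastforce
    then show "\<sigma> v = \<tau> v" using \<tau>(3) by simp
  qed
  have "\<tau> v \<in> {1..q}" if "v \<in> V" for v
  proof (cases "v \<in> ?R")
    case True
    then have "\<tau> v \<in> {Suc a..q}" using \<tau>(2) by blast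
    then show ?thesis by simp
  next
    case False
    then show ?thesis using \<tau>(3)[of v] that q by auto
  qed
  moreover have "\<tau> v = undefined" if "v \<notin> V" for v
    using that \<tau>(3)[of v] col unfolding colorings_iff by (auto simp: PiE_iff extensional_def)
  ultimately have "\<tau> \<in> V \<rightarrow>\<^sub>E {1..q}" by auto
  moreover have "proper_on E V \<tau>"
    by (rule proper_on_glue[OF _ same \<tau>(1)]) (use col colorings_iff in blast)
  ultimately show ?thesis using colorings_iff by blast
qed

section \<open>Connectedness and diameter of the coloring graph as a digraph\<close>

lemma walk_awalk:
  assumes "walk q l \<sigma> \<tau>"
  shows "\<exists>p. pre_digraph.awalk (coloring_graph q (V, E)) \<sigma> p \<tau> \<and> length p \<le> l"
proof -
  interpret pair_graph "coloring_pair_graph q (V, E)"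
    by (rule pair_graph_coloring_pair_graph) (simp add: finite_V)
  from assms show ?thesis unfolding coloring_graph_def
  proof (induction rule: walk.induct)
    case (walk_refl \<sigma> l)
    then have "\<sigma> \<in> pverts (coloring_pair_graph q (V, E))" by (simp add: coloring_pair_graph_def)
    then have "awalk \<sigma> [] \<sigma>" by (simp add: awalk_Nil_iff)
    then show ?case by (intro exI[of _ "[]"]) simp
  next
    case (walk_step l \<sigma> \<tau> v \<tau>')
    then obtain p where p: "awalk \<sigma> p \<tau>" "length p \<le> l" by blast
    show ?case
    \<comment> \<open>Steps that change nothing are dropped, since arcs join colorings at Hamming
      distance exactly 1.\<close>
    proof (cases "\<tau>' v = \<tau> v")
      case True
      then have "\<tau>' = \<tau>" using walk_step.hyps(4) by (metis ext)
      with p show ?thesis by (intro exI[of _ p]) simp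
    next
      case False
      have "{x \<in> V. \<tau> x \<noteq> \<tau>' x} = {v}" using False walk_step.hyps by auto
      then have "(\<tau>, \<tau>') \<in> parcs (coloring_pair_graph q (V, E))"
        using walk_step.hyps walk_ends[OF walk_step.hyps(1)]
        by (simp add: coloring_pair_graph_def hamming_dist_def)
      then have "awalk \<tau> [(\<tau>, \<tau>')] \<tau>'"
        using arc_implies_awalk[of "(\<tau>, \<tau>')"] by simp
      with p show ?thesis by (intro exI[of _ "p @ [(\<tau>, \<tau>')]"]) auto
    qed
  qed
qed

theorem coloring_graph_diameter:
  assumes q: "q \<ge> a + 2 * D + 3"
  shows "Digraph_Component.connected (coloring_graph q (V, E))"
    and "graph_diameter (coloring_graph q (V, E))
      \<le> ereal (real (a * (a + 2 * D + 4) + 2 * D + 2) * real (card V))"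
proof -
  interpret pair_graph "coloring_pair_graph q (V, E)"
    by (rule pair_graph_coloring_pair_graph) (simp add: finite_V)
  let ?L = "(a * (a + 2 * D + 4) + 2 * D + 2) * card V"
  have verts: "verts (coloring_graph q (V, E)) = colorings q"
    by (simp add: coloring_graph_def coloring_pair_graph_def)
  have *: "\<exists>p. awalk \<sigma> p \<tau> \<and> length p \<le> ?L" if "\<sigma> \<in> colorings q" "\<tau> \<in> colorings q" for \<sigma> \<tau>
    using walk_awalk[OF colorings_walk[OF q that]] unfolding coloring_graph_def .
  have sc: "strongly_connected (coloring_graph q (V, E))"
  proof (rule strongly_connectedI)
    show "verts (coloring_graph q (V, E)) \<noteq> {}" using colorings_nonempty[OF q] verts by simp
    show "\<sigma> \<rightarrow>\<^sup>*\<^bsub>coloring_graph q (V, E)\<^esub> \<tau>"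
      if "\<sigma> \<in> verts (coloring_graph q (V, E))" "\<tau> \<in> verts (coloring_graph q (V, E))" for \<sigma> \<tau>
      using *[of \<sigma> \<tau>] that verts reachable_awalk unfolding coloring_graph_def by blast
  qed
  show "Digraph_Component.connected (coloring_graph q (V, E))"
    unfolding Digraph_Component.connected_def
  proof (rule strongly_connectedI)
    show "verts (with_proj (mk_symmetric (coloring_graph q (V, E)))) \<noteq> {}"
      using sc by (simp add: strongly_connected_def mk_symmetric_def)
    show "\<sigma> \<rightarrow>\<^sup>*\<^bsub>with_proj (mk_symmetric (coloring_graph q (V, E)))\<^esub> \<tau>"
      if "\<sigma> \<in> verts (with_proj (mk_symmetric (coloring_graph q (V, E))))"
        "\<tau> \<in> verts (with_proj (mk_symmetric (coloring_graph q (V, E))))" for \<sigma> \<tau>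
      using sc that reachable_mk_symmetricI unfolding coloring_graph_def
      by (auto simp: strongly_connected_def mk_symmetric_def)
  qed
  have "graph_dist (coloring_graph q (V, E)) \<sigma> \<tau> \<le> ereal (real ?L)"
    if st: "\<sigma> \<in> colorings q" "\<tau> \<in> colorings q" for \<sigma> \<tau>
  proof -
    obtain p where p: "awalk \<sigma> p \<tau>" "length p \<le> ?L" using *[OF st] by blast
    have cost: "awalk_cost (\<lambda>_. 1) p = real (length p)" for p :: "(('a \<Rightarrow> nat) \<times> ('a \<Rightarrow> nat)) list"
      by (induction p) (auto simp: awalk_cost_def)
    have "graph_dist (coloring_graph q (V, E)) \<sigma> \<tau> \<le> ereal (awalk_cost (\<lambda>_. 1) p)"
      unfolding graph_dist_def coloring_graph_def by (rule min_cost_le_walk_cost[OF p(1)])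
    also have "\<dots> \<le> ereal (real ?L)" using p(2) unfolding cost by (simp only: ereal_less_eq of_nat_le_iff)
    finally show ?thesis .
  qed
  then show "graph_diameter (coloring_graph q (V, E))
      \<le> ereal (real (a * (a + 2 * D + 4) + 2 * D + 2) * real (card V))"
    unfolding graph_diameter_def verts of_nat_mult[symmetric]
    by (intro SUP_least) (simp only: split_beta mem_Times_iff)
qed

end

section \<open>Counting in the uniform model\<close>

lemma power_div_fact_le_exp:
  assumes "(x::real) \<ge> 0"
  shows "x ^ u / fact u \<le> exp x"
proof -
  have "(\<Sum>n\<in>{u}. x ^ n /\<^sub>R fact n) \<le> (\<Sum>n. x ^ n /\<^sub>R fact n)"
    by (rule sum_le_suminf[OF summable_exp_generic]) (use assms in auto)
  then show ?thesis by (simp add: exp_def divide_inverse mult.commute)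
qed

lemma binomial_le_exp_power:
  assumes "u > 0"
  shows "real (n choose u) \<le> (exp 1 * n / u) ^ u"
proof -
  have "real (n choose u) * fact u \<le> real n ^ u"
    using binomial_fact_pow[of n u] by (metis of_nat_fact of_nat_le_iff of_nat_mult of_nat_power)
  then have "real (n choose u) \<le> real n ^ u / fact u" by (simp add: field_simps)
  also have "\<dots> = (real n / u) ^ u * (real u ^ u / fact u)" using assms by (simp add: power_divide)
  also have "\<dots> \<le> (real n / u) ^ u * exp (real u)"
    by (intro mult_left_mono power_div_fact_le_exp) auto
  also have "exp (real u) = exp 1 ^ u" by (metis exp_of_nat_mult mult.right_neutral)
  finally show ?thesis by (simp add: power_divide power_mult_distrib mult.commute)
qed

text \<open>With p = m / N the value m is a mode of the binomial distribution, as comparing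
  consecutive terms shows. The largest of N + 1 terms with sum 1 is at least 1 / (N + 1). This lower
  bound is what makes independent edges comparable to m random ones.\<close>

lemma binomial_mode:
  assumes m: "m \<le> N" "N > 0" and p: "p = real m / real N"
  shows "1 \<le> (real N + 1) * (real (N choose m) * p ^ m * (1 - p) ^ (N - m))"
proof -
  define T where "T j = real (N choose j) * p ^ j * (1 - p) ^ (N - j)" for j
  have p01: "0 \<le> p" "p \<le> 1" using m p by auto
  have N: "p * real N = real m" using m p by simp
  have abs: "real (Suc j) * real (N choose Suc j) = real (N - j) * real (N choose j)" for j
    using binomial_absorption[of j N] binomial_absorb_comp[of N j] by (metis of_nat_mult)
  have T: "T j = (real (N choose j) * (1 - p)) * (p ^ j * (1 - p) ^ (N - Suc j))"
    "T (Suc j) = (real (N choose Suc j) * p) * (p ^ j * (1 - p) ^ (N - Suc j))" if "j < N" for j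
  proof -
    have "N - j = Suc (N - Suc j)" using that by simp
    then show "T j = (real (N choose j) * (1 - p)) * (p ^ j * (1 - p) ^ (N - Suc j))"
      unfolding T_def by (simp only: power_Suc mult_ac)
    show "T (Suc j) = (real (N choose Suc j) * p) * (p ^ j * (1 - p) ^ (N - Suc j))"
      unfolding T_def by (simp only: power_Suc mult_ac)
  qed
  have up: "T j \<le> T (Suc j)" if j: "j < m" for j
  proof -
    have jN: "j < N" using j m by simp
    have "real (Suc j) * (1 - p) \<le> real (N - j) * p"
      using j jN N p01 by (simp add: of_nat_diff algebra_simps)
    then have "real (N choose j) * (real (Suc j) * (1 - p)) \<le> real (N choose j) * (real (N - j) * p)"
      by (rule mult_left_mono) simp
    also have "\<dots> = real (Suc j) * (real (N choose Suc j) * p)" using abs[of j] by (simp only: mult_ac)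
    finally have "real (Suc j) * (real (N choose j) * (1 - p)) \<le> real (Suc j) * (real (N choose Suc j) * p)"
      by (simp only: mult_ac)
    then have "real (N choose j) * (1 - p) \<le> real (N choose Suc j) * p"
      by (rule mult_left_le_imp_le) simp
    then show ?thesis unfolding T[OF jN] by (rule mult_right_mono) (use p01 in simp)
  qed
  have down: "T (Suc j) \<le> T j" if j: "m \<le> j" "j < N" for j
  proof -
    have "real (N - j) * p \<le> real (Suc j) * (1 - p)"
      using j N p01 by (simp add: of_nat_diff algebra_simps)
    then have "real (N choose j) * (real (N - j) * p) \<le> real (N choose j) * (real (Suc j) * (1 - p))"
      by (rule mult_left_mono) simp
    also have "real (N choose j) * (real (N - j) * p) = real (Suc j) * (real (N choose Suc j) * p)"
      using abs[of j] by (simp only: mult_ac)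
    finally have "real (Suc j) * (real (N choose Suc j) * p) \<le> real (Suc j) * (real (N choose j) * (1 - p))"
      by (simp only: mult_ac)
    then have "real (N choose Suc j) * p \<le> real (N choose j) * (1 - p)"
      by (rule mult_left_le_imp_le) simp
    then show ?thesis unfolding T[OF j(2)] by (rule mult_right_mono) (use p01 in simp)
  qed
  have max: "T j \<le> T m" if "j \<le> N" for j
  proof (cases "j \<le> m")
    case True
    then show ?thesis
      by (induction rule: inc_induct) (auto intro: order_trans[OF up])
  next
    case False
    then have "m \<le> j" by simp
    then have "j \<le> N \<longrightarrow> T j \<le> T m"
      by (induction rule: dec_induct) (auto intro: order_trans[OF down])
    then show ?thesis using that by simp
  qed
  have "1 = (p + (1 - p)) ^ N" by simp
  also have "\<dots> = (\<Sum>j\<le>N. T j)" unfolding binomial_ring T_def by simp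
  also have "\<dots> \<le> (\<Sum>j\<le>N. T m)" by (rule sum_mono) (use max in auto)
  finally show ?thesis by (simp add: T_def algebra_simps)
qed

lemma sum_Pow_binomial_weight:
  assumes "finite X"
  shows "(\<Sum>E\<in>Pow X. p ^ card E * (1 - p) ^ (card X - card E)) = (1::real)"
proof -
  have "(\<Prod>x\<in>X. p + (1 - p)) = (\<Sum>E\<in>Pow X. (\<Prod>x\<in>E. p) * (\<Prod>x\<in>X - E. 1 - p))"
    by (rule prod_add[OF assms])
  also have "\<dots> = (\<Sum>E\<in>Pow X. p ^ card E * (1 - p) ^ (card X - card E))"
    by (rule sum.cong) (use assms in \<open>auto simp: card_Diff_subset finite_subset\<close>)
  finally show ?thesis by simp
qed

text \<open>Independence of disjoint blocks of independent edges, in the form of finite sums: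
  \<open>B j\<close> is missed with probability (1 - p)^|B j|. The induction splits a set into its
  part in \<open>B i\<close> and the rest.\<close>

lemma sum_hit_blocks:
  fixes p :: real
  assumes "finite J" "finite X" "\<And>j. j \<in> J \<Longrightarrow> B j \<subseteq> X" "disjoint_family_on B J"
  shows "(\<Sum>E | E \<subseteq> X \<and> (\<forall>j\<in>J. E \<inter> B j \<noteq> {}). p ^ card E * (1 - p) ^ (card X - card E))
    = (\<Prod>j\<in>J. 1 - (1 - p) ^ card (B j))"
  using assms
proof (induction J arbitrary: X rule: finite_induct)
  case empty
  then show ?case using sum_Pow_binomial_weight[of X p] by (simp add: Pow_def)
next
  case (insert i J)
  let ?w = "\<lambda>X E. p ^ card E * (1 - p) ^ (card X - card E)"
  define X' where "X' = X - B i"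
  define \<F> where "\<F> = Pow (B i) - {{}}"
  define \<E> where "\<E> = {E. E \<subseteq> X' \<and> (\<forall>j\<in>J. E \<inter> B j \<noteq> {})}"
  have BX: "B i \<subseteq> X" using insert.prems by auto
  have finB: "finite (B i)" and finX': "finite X'"
    using insert.prems(1) BX finite_subset unfolding X'_def by auto
  have disj: "B i \<inter> B j = {}" if "j \<in> J" for j
    using insert.prems(3) insert.hyps(2) that unfolding disjoint_family_on_def by auto
  have IH: "(\<Sum>E\<in>\<E>. ?w X' E) = (\<Prod>j\<in>J. 1 - (1 - p) ^ card (B j))"
    unfolding \<E>_def
  proof (rule insert.IH[OF finX'])
    show "B j \<subseteq> X'" if "j \<in> J" for j using insert.prems(2)[of j] disj[OF that] that unfolding X'_def by auto
    show "disjoint_family_on B J" using insert.prems(3) unfolding disjoint_family_on_def by auto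
  qed
  have F: "(\<Sum>F\<in>\<F>. ?w (B i) F) = 1 - (1 - p) ^ card (B i)"
    using sum_Pow_binomial_weight[OF finB, of p] finB
    unfolding \<F>_def by (subst sum_diff1) auto
  have bij: "bij_betw (\<lambda>(F, E). F \<union> E) (\<F> \<times> \<E>)
      {E. E \<subseteq> X \<and> (\<forall>j\<in>insert i J. E \<inter> B j \<noteq> {})}"
  proof (rule bij_betw_byWitness[where f' = "\<lambda>E. (E \<inter> B i, E - B i)"])
    show "\<forall>a\<in>\<F> \<times> \<E>. (\<lambda>E. (E \<inter> B i, E - B i)) ((\<lambda>(F, E). F \<union> E) a) = a"
      unfolding \<F>_def \<E>_def X'_def by auto
    show "(\<lambda>(F, E). F \<union> E) ` (\<F> \<times> \<E>) \<subseteq> {E. E \<subseteq> X \<and> (\<forall>j\<in>insert i J. E \<inter> B j \<noteq> {})}"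
      using BX unfolding \<F>_def \<E>_def X'_def by fast
    show "(\<lambda>E. (E \<inter> B i, E - B i)) ` {E. E \<subseteq> X \<and> (\<forall>j\<in>insert i J. E \<inter> B j \<noteq> {})} \<subseteq> \<F> \<times> \<E>"
      using disj unfolding \<F>_def \<E>_def X'_def by fast
  qed auto
  have "(\<Sum>E | E \<subseteq> X \<and> (\<forall>j\<in>insert i J. E \<inter> B j \<noteq> {}). ?w X E)
      = (\<Sum>(F, E)\<in>\<F> \<times> \<E>. ?w X (F \<union> E))"
    using sum.reindex_bij_betw[OF bij, of "?w X"] by (simp add: split_beta)
  also have "\<dots> = (\<Sum>(F, E)\<in>\<F> \<times> \<E>. ?w (B i) F * ?w X' E)"
  proof (rule sum.cong[OF refl], clarify)
    fix F E assume FE: "F \<in> \<F>" "E \<in> \<E>"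
    have sub: "F \<subseteq> B i" "E \<subseteq> X'" using FE unfolding \<F>_def \<E>_def by auto
    have fin: "finite F" "finite E" using sub finB finX' finite_subset by auto
    have "card (F \<union> E) = card F + card E"
      by (rule card_Un_disjoint) (use sub fin in \<open>auto simp: X'_def\<close>)
    moreover have "card X = card (B i) + card X'"
      unfolding X'_def using BX finB card_mono[OF insert.prems(1) BX] by (simp add: card_Diff_subset)
    moreover have "card F \<le> card (B i)" "card E \<le> card X'" using sub finB finX' card_mono by auto
    ultimately have "card (F \<union> E) = card F + card E"
      "card X - card (F \<union> E) = (card (B i) - card F) + (card X' - card E)" by linarith+
    then show "?w X (F \<union> E) = ?w (B i) F * ?w X' E"
      by (simp only: power_add mult_ac)
  qed
  also have "\<dots> = (\<Sum>F\<in>\<F>. ?w (B i) F) * (\<Sum>E\<in>\<E>. ?w X' E)"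
    by (simp add: sum_product sum.cartesian_product)
  finally show ?case unfolding F IH using insert.hyps by simp
qed

text \<open>Conditioning independent edges on their number being the mode m loses at most the factor
  N + 1 of \<open>binomial_mode\<close>, which is polynomial in n and so harmless against
  exponentially small probabilities.\<close>

lemma card_hit_blocks:
  fixes p :: real
  assumes "finite J" "finite X" "\<And>j. j \<in> J \<Longrightarrow> B j \<subseteq> X" "disjoint_family_on B J"
    and m: "m \<le> card X" "card X > 0" and p: "p = real m / real (card X)"
  shows "real (card {E. E \<subseteq> X \<and> card E = m \<and> (\<forall>j\<in>J. E \<inter> B j \<noteq> {})})
    \<le> (real (card X) + 1) * real (card X choose m) * (\<Prod>j\<in>J. 1 - (1 - p) ^ card (B j))"
proof -
  let ?N = "card X" and ?A = "{E. E \<subseteq> X \<and> card E = m \<and> (\<forall>j\<in>J. E \<inter> B j \<noteq> {})}"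
  let ?w = "\<lambda>E. p ^ card E * (1 - p) ^ (?N - card E)"
  have p01: "0 \<le> p" "p \<le> 1" using m p by auto
  have "real (card ?A) * (p ^ m * (1 - p) ^ (?N - m)) = (\<Sum>E\<in>?A. ?w E)" by simp
  also have "\<dots> \<le> (\<Sum>E | E \<subseteq> X \<and> (\<forall>j\<in>J. E \<inter> B j \<noteq> {}). ?w E)"
    by (rule sum_mono2) (use assms(2) p01 in auto)
  also have "\<dots> = (\<Prod>j\<in>J. 1 - (1 - p) ^ card (B j))" by (rule sum_hit_blocks[OF assms(1-4)])
  finally have le: "real (card ?A) * (p ^ m * (1 - p) ^ (?N - m)) \<le> (\<Prod>j\<in>J. 1 - (1 - p) ^ card (B j))" .
  have "real (card ?A) * 1 \<le> real (card ?A) * ((real ?N + 1) * (real (?N choose m) * p ^ m * (1 - p) ^ (?N - m)))"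
    by (intro mult_left_mono binomial_mode m p) simp
  also have "\<dots> = (real ?N + 1) * real (?N choose m) * (real (card ?A) * (p ^ m * (1 - p) ^ (?N - m)))"
    by (simp only: mult_ac)
  also have "\<dots> \<le> (real ?N + 1) * real (?N choose m) * (\<Prod>j\<in>J. 1 - (1 - p) ^ card (B j))"
    by (rule mult_left_mono[OF le]) simp
  finally show ?thesis by simp
qed

section \<open>The union bound for one stage of the greedy process\<close>

definition edges_on :: "nat \<Rightarrow> nat \<Rightarrow> nat set set" where
  "edges_on n k = {e. e \<subseteq> {1..n} \<and> card e = k}"

lemma finite_edges_on [simp]: "finite (edges_on n k)"
  unfolding edges_on_def by simp

lemma card_edges_on [simp]: "card (edges_on n k) = n choose k"
  unfolding edges_on_def using n_subsets[of "{1..n}" k] by simp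

text \<open>Vertices of color \<open>0\<close> are those that every color class \<open>1, \<dots>, t\<close> fails to absorb.\<close>

definition blocked :: "nat set \<Rightarrow> nat \<Rightarrow> (nat \<Rightarrow> nat) \<Rightarrow> nat set set \<Rightarrow> bool" where
  "blocked U t f E \<longleftrightarrow> (\<forall>v\<in>U. f v = 0 \<longrightarrow> (\<forall>i\<in>{1..t}. \<exists>e\<in>E. v \<in> e \<and> e - {v} \<subseteq> {u \<in> U. f u = i}))"

text \<open>For an uncovered v and a class i, the block \<open>B (v, i)\<close> holds the possible
  edges of v with k - 1 vertices of class i, and must be hit. The blocks are disjoint: v is the only
  uncovered vertex of such an edge, and its other vertices, of which there is one as k \<ge> 2,
  determine i. So the probabilities multiply, and 1 - x \<le> exp (- x) collects them in
  \<Lambda>.\<close>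

lemma card_blocked:
  fixes p :: real and t :: nat
  assumes k: "k \<ge> 2" and U: "U \<subseteq> {1..n}" and m: "m \<le> n choose k" "n choose k > 0"
    and p: "p = real m / real (n choose k)"
    and \<Lambda>: "\<Lambda> \<le> (\<Sum>i=1..t. (1 - p) ^ (card {u \<in> U. f u = i} choose (k - 1)))"
  shows "real (card {E. E \<subseteq> edges_on n k \<and> card E = m \<and> blocked U t f E})
    \<le> (real (n choose k) + 1) * real ((n choose k) choose m) * exp (- \<Lambda>) ^ card {v \<in> U. f v = 0}"
proof -
  let ?X = "edges_on n k"
  define R where "R = {v \<in> U. f v = 0}"
  define W where "W i = {u \<in> U. f u = i}" for i
  define J where "J = R \<times> {1..t}"
  define B where "B = (\<lambda>(v, i). {e \<in> ?X. v \<in> e \<and> e - {v} \<subseteq> W i})"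
  have finU: "finite U" using finite_subset[OF U] by simp
  have finJ: "finite J" unfolding J_def R_def using finU by simp
  have p01: "0 \<le> p" "p \<le> 1" using m p by auto
  have cardB: "card (B (v, i)) = card (W i) choose (k - 1)" if vi: "(v, i) \<in> J" for v i
  proof -
    have v: "v \<in> R" "v \<in> {1..n}" "v \<notin> W i" using vi U unfolding J_def R_def W_def by auto
    have finW: "finite (W i)" unfolding W_def using finU by simp
    have WU: "W i \<subseteq> {1..n}" unfolding W_def using U by auto
    have "bij_betw (insert v) {T. T \<subseteq> W i \<and> card T = k - 1} (B (v, i))"
    proof (rule bij_betw_byWitness[where f' = "\<lambda>e. e - {v}"])
      show "insert v ` {T. T \<subseteq> W i \<and> card T = k - 1} \<subseteq> B (v, i)"
      proof
        fix e assume "e \<in> insert v ` {T. T \<subseteq> W i \<and> card T = k - 1}"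
        then obtain T where T: "e = insert v T" "T \<subseteq> W i" "card T = k - 1" by blast
        have "finite T" "v \<notin> T" using T finW v finite_subset by auto
        then have "card e = k" using T k by simp
        then show "e \<in> B (v, i)" unfolding B_def edges_on_def using T WU v by auto
      qed
      show "(\<lambda>e. e - {v}) ` B (v, i) \<subseteq> {T. T \<subseteq> W i \<and> card T = k - 1}"
        unfolding B_def edges_on_def by (auto simp: card_Diff_subset)
    qed (use v in \<open>auto simp: B_def\<close>)
    then have "card (B (v, i)) = card {T. T \<subseteq> W i \<and> card T = k - 1}"
      using bij_betw_same_card by metis
    also have "\<dots> = card (W i) choose (k - 1)" by (rule n_subsets[OF finW])
    finally show ?thesis .
  qed
  have disj: "disjoint_family_on B J"
    unfolding disjoint_family_on_def
  proof (intro ballI impI, rule ccontr)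
    fix x y assume xy: "x \<in> J" "y \<in> J" "x \<noteq> y" and ne: "B x \<inter> B y \<noteq> {}"
    obtain v i v' i' where [simp]: "x = (v, i)" "y = (v', i')" by (cases x, cases y)
    obtain e where e: "e \<in> ?X" "v \<in> e" "e - {v} \<subseteq> W i" "v' \<in> e" "e - {v'} \<subseteq> W i'"
      using ne unfolding B_def by auto
    have "v = v'"
    proof (rule ccontr)
      assume "v \<noteq> v'"
      then have "v' \<in> W i" using e by auto
      then show False using xy unfolding J_def R_def W_def by auto
    qed
    moreover have "e - {v} \<noteq> {}"
    proof
      assume "e - {v} = {}"
      then have "card e \<le> card {v}" by (intro card_mono) auto
      then show False using e(1) k unfolding edges_on_def by simp
    qed
    ultimately have "W i \<inter> W i' \<noteq> {}" using e by blast
    then have "i = i'" unfolding W_def by auto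
    with xy \<open>v = v'\<close> show False by simp
  qed
  have BX: "B j \<subseteq> ?X" if "j \<in> J" for j unfolding B_def by auto
  have "{E. E \<subseteq> ?X \<and> card E = m \<and> blocked U t f E} \<subseteq>
      {E. E \<subseteq> ?X \<and> card E = m \<and> (\<forall>j\<in>J. E \<inter> B j \<noteq> {})}"
    unfolding blocked_def J_def R_def B_def W_def by blast
  then have "real (card {E. E \<subseteq> ?X \<and> card E = m \<and> blocked U t f E})
      \<le> real (card {E. E \<subseteq> ?X \<and> card E = m \<and> (\<forall>j\<in>J. E \<inter> B j \<noteq> {})})"
    by (intro of_nat_mono card_mono) auto
  also have "\<dots> \<le> (real (n choose k) + 1) * real ((n choose k) choose m) *
      (\<Prod>j\<in>J. 1 - (1 - p) ^ card (B j))"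
    using card_hit_blocks[OF finJ _ BX disj, of m p] m p by simp
  also have "(\<Prod>j\<in>J. 1 - (1 - p) ^ card (B j)) \<le> exp (- \<Lambda>) ^ card R"
  proof -
    have "(\<Prod>j\<in>J. 1 - (1 - p) ^ card (B j))
        = (\<Prod>(v, i)\<in>R \<times> {1..t}. 1 - (1 - p) ^ (card (W i) choose (k - 1)))"
      unfolding J_def by (rule prod.cong[OF refl]) (use cardB in \<open>auto simp: J_def\<close>)
    also have "\<dots> = (\<Prod>v\<in>R. \<Prod>i\<in>{1..t}. 1 - (1 - p) ^ (card (W i) choose (k - 1)))"
      by (rule prod.cartesian_product[symmetric])
    also have "\<dots> = (\<Prod>i\<in>{1..t}. 1 - (1 - p) ^ (card (W i) choose (k - 1))) ^ card R" by simp
    also have "\<dots> \<le> exp (- \<Lambda>) ^ card R"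
    proof (rule power_mono)
      have "(\<Prod>i\<in>{1..t}. 1 - (1 - p) ^ (card (W i) choose (k - 1)))
          \<le> (\<Prod>i\<in>{1..t}. exp (- ((1 - p) ^ (card (W i) choose (k - 1)))))"
        by (rule prod_mono)
          (use p01 exp_ge_add_one_self[of "- ((1 - p) ^ _)"] in \<open>auto simp: power_le_one\<close>)
      also have "\<dots> = exp (- (\<Sum>i\<in>{1..t}. (1 - p) ^ (card (W i) choose (k - 1))))"
        by (simp add: exp_sum sum_negf[symmetric])
      also have "\<dots> \<le> exp (- \<Lambda>)" using \<Lambda> unfolding W_def by simp
      finally show "(\<Prod>i\<in>{1..t}. 1 - (1 - p) ^ (card (W i) choose (k - 1))) \<le> exp (- \<Lambda>)" .
      show "0 \<le> (\<Prod>i\<in>{1..t}. 1 - (1 - p) ^ (card (W i) choose (k - 1)))"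
        by (rule prod_nonneg) (use p01 in \<open>auto simp: power_le_one\<close>)
    qed
    finally show ?thesis .
  qed
  finally show ?thesis unfolding R_def by (simp add: mult_left_mono)
qed

text \<open>Markov's inequality: at most t / (1 + \<epsilon>) of the indices lie above (1 +
  \<epsilon>) times the average, and each of the others contributes \<open>g0\<close>. Jensen's
  inequality is no substitute, as exp (- c x^K) is not convex for K \<ge> 2.\<close>

lemma sum_ge_of_small_average:
  fixes N g :: "nat \<Rightarrow> real"
  assumes I: "finite I" "card I = t" "t > 0" and u: "u > 0" and \<epsilon>: "\<epsilon> > 0"
    and N: "\<And>i. i \<in> I \<Longrightarrow> N i \<ge> 0" "(\<Sum>i\<in>I. N i) \<le> u"
    and g: "\<And>i. i \<in> I \<Longrightarrow> g i \<ge> 0" "g0 \<ge> 0"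
    and small: "\<And>i. i \<in> I \<Longrightarrow> N i \<le> (1 + \<epsilon>) * u / t \<Longrightarrow> g i \<ge> g0"
  shows "(\<Sum>i\<in>I. g i) \<ge> t * \<epsilon> / (1 + \<epsilon>) * g0"
proof -
  define A where "A = {i \<in> I. N i \<le> (1 + \<epsilon>) * u / t}"
  have A: "A \<subseteq> I" "finite A" unfolding A_def using I(1) by auto
  have "real (card (I - A)) * ((1 + \<epsilon>) * u / t) \<le> (\<Sum>i\<in>I - A. N i)"
    by (rule sum_bounded_below) (auto simp: A_def)
  also have "\<dots> \<le> (\<Sum>i\<in>I. N i)" by (rule sum_mono2) (use I N in auto)
  also have "\<dots> \<le> u" by (rule N)
  finally have "u * (real (card (I - A)) * (1 + \<epsilon>)) \<le> u * t"
    using I(3) by (simp add: field_simps)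
  then have "real (card (I - A)) * (1 + \<epsilon>) \<le> t" by (rule mult_left_le_imp_le) (rule u)
  moreover have "card (I - A) = t - card A" "card A \<le> t"
    using A I card_mono[OF I(1) A(1)] by (auto simp: card_Diff_subset)
  ultimately have "t * \<epsilon> \<le> real (card A) * (1 + \<epsilon>)" by (simp add: of_nat_diff algebra_simps)
  then have "t * \<epsilon> / (1 + \<epsilon>) \<le> real (card A)" using \<epsilon> by (simp add: field_simps)
  then have "t * \<epsilon> / (1 + \<epsilon>) * g0 \<le> real (card A) * g0" by (rule mult_right_mono) (rule g(2))
  also have "\<dots> \<le> (\<Sum>i\<in>A. g i)"
    by (rule sum_bounded_below) (use small in \<open>auto simp: A_def\<close>)
  also have "\<dots> \<le> (\<Sum>i\<in>I. g i)" by (rule sum_mono2) (use I A g in auto)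
  finally show ?thesis .
qed

lemma exp_le_one_minus_power:
  fixes p :: real
  assumes "0 \<le> p" "p < 1"
  shows "exp (- (p / (1 - p) * real M)) \<le> (1 - p) ^ M"
proof -
  have "1 / (1 - p) \<le> exp (p / (1 - p))"
    using exp_ge_add_one_self[of "p / (1 - p)"] assms by (simp add: field_simps)
  then have "exp (- (p / (1 - p))) \<le> 1 - p"
    using assms by (simp add: exp_minus field_simps)
  then have "exp (- (p / (1 - p))) ^ M \<le> (1 - p) ^ M" by (rule power_mono) simp
  then show ?thesis by (simp add: exp_of_nat_mult[symmetric] mult.commute)
qed

lemma binomial_real_prod: "real (M choose K) * fact K = (\<Prod>i=0..<K. real M - real i)"
  by (simp add: binomial_gbinomial gbinomial_prod_rev)

lemma binomial_lower:
  assumes "K \<le> M"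
  shows "(real M + 1 - real K) ^ K \<le> real (M choose K) * fact K"
proof -
  have "(\<Prod>i=0..<K. real M + 1 - real K) \<le> (\<Prod>i=0..<K. real M - real i)"
    by (rule prod_mono) (use assms in auto)
  then show ?thesis unfolding binomial_real_prod by simp
qed

lemma binomial_upper: "real (M choose K) * fact K \<le> real M ^ K"
  using binomial_fact_pow[of M K] by (metis of_nat_fact of_nat_le_iff of_nat_mult of_nat_power)

lemma binomial_ratio:
  assumes "1 \<le> s" "s \<le> n" "K < n"
  shows "real ((s - 1) choose K) * real n ^ K \<le> real ((n - 1) choose K) * real s ^ K"
proof (cases "K \<le> s - 1")
  case True
  have "(\<Prod>i=0..<K. (real (s - 1) - real i) * real n) \<le> (\<Prod>i=0..<K. (real (n - 1) - real i) * real s)"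
  proof (rule prod_mono, intro conjI)
    fix i assume i: "i \<in> {0..<K}"
    show "0 \<le> (real (s - 1) - real i) * real n" using i True by simp
    have "real s * (1 + real i) \<le> real n * (1 + real i)" using assms by (intro mult_right_mono) auto
    then show "(real (s - 1) - real i) * real n \<le> (real (n - 1) - real i) * real s"
      using assms by (simp add: of_nat_diff algebra_simps)
  qed
  then have "(real ((s - 1) choose K) * fact K) * real n ^ K
      \<le> (real ((n - 1) choose K) * fact K) * real s ^ K"
    unfolding binomial_real_prod prod.distrib by simp
  then have "fact K * (real ((s - 1) choose K) * real n ^ K)
      \<le> fact K * (real ((n - 1) choose K) * real s ^ K)" by (simp only: mult_ac)
  then show ?thesis by (rule mult_left_le_imp_le) simp
next
  case False
  then show ?thesis by (simp add: binomial_eq_0)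
qed

text \<open>The exponent \<Lambda> per uncovered vertex for t classes on w n vertices. The factor t
  \<epsilon> / (1 + \<epsilon>) counts the classes that are not too large and the inner 1 +
  \<epsilon> bounds their size, both by Markov. The outer 1 + \<epsilon> absorbs the lower-order
  factors from binomial coefficients and from replacing 1 - p by an exponential.\<close>

definition stage_rate :: "nat \<Rightarrow> real \<Rightarrow> real \<Rightarrow> nat \<Rightarrow> real \<Rightarrow> real" where
  "stage_rate k d \<epsilon> t w =
     t * \<epsilon> / (1 + \<epsilon>) * exp (- ((1 + \<epsilon>) * d * ((1 + \<epsilon>) * w / t) ^ (k - 1)))"

definition bad_stage :: "nat \<Rightarrow> nat \<Rightarrow> nat \<Rightarrow> real \<Rightarrow> nat set set \<Rightarrow> bool" where
  "bad_stage n u t s E \<longleftrightarrow> (\<exists>U f. U \<subseteq> {1..n} \<and> card U = u \<and> f \<in> U \<rightarrow> {0..t} \<and>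
     s \<le> real (card {v \<in> U. f v = 0}) \<and> blocked U t f E)"

text \<open>There are (n choose u) sets \<open>U\<close> and (t + 1)^u assignments on each. For a
  fixed pair, \<open>card_blocked\<close> gives exp (- \<Lambda>) for each of the at least s
  uncovered vertices.\<close>

lemma card_bad_stage:
  fixes p d \<epsilon> s :: real and t u :: nat
  assumes k: "k \<ge> 2" "n \<ge> k" and m: "m \<le> n choose k"
    and p: "p = real m / real (n choose k)" "p < 1" "p \<le> d / real ((n - 1) choose (k - 1))"
    and \<epsilon>: "\<epsilon> > 0" "(real n / (real n - real (k - 1))) ^ (k - 1) / (1 - p) \<le> 1 + \<epsilon>"
    and d: "d > 0" and t: "t > 0" and u: "u > 0"
  shows "real (card {E. E \<subseteq> edges_on n k \<and> card E = m \<and> bad_stage n u t s E})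
    \<le> (real (n choose k) + 1) * real ((n choose k) choose m) * real (n choose u) * (real t + 1) ^ u *
      exp (- (stage_rate k d \<epsilon> t (u / n) * s))"
proof -
  let ?\<Lambda> = "stage_rate k d \<epsilon> t (u / n)" and ?K = "k - 1"
  let ?A = "\<lambda>U f. {E. E \<subseteq> edges_on n k \<and> card E = m \<and> blocked U t f E}"
  let ?F = "\<lambda>U. {f \<in> U \<rightarrow>\<^sub>E {0..t}. s \<le> real (card {v \<in> U. f v = 0})}"
  let ?U = "{U. U \<subseteq> {1..n} \<and> card U = u}"
  let ?c = "(real (n choose k) + 1) * real ((n choose k) choose m) * exp (- (?\<Lambda> * s))"
  have pos: "n choose k > 0" using k by simp
  have p0: "0 \<le> p" using p by simp
  have \<Lambda>0: "0 \<le> ?\<Lambda>" unfolding stage_rate_def using \<epsilon> by simp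
  have finF: "finite (?F U)" if "U \<in> ?U" for U
  proof (rule finite_subset)
    show "?F U \<subseteq> U \<rightarrow>\<^sub>E {0..t}" by auto
    show "finite (U \<rightarrow>\<^sub>E {0..t})"
      by (rule finite_PiE) (use that finite_subset[of U "{1..n}"] in auto)
  qed
  have bound: "real (card (?A U f)) \<le> ?c" if U: "U \<in> ?U" and f: "f \<in> ?F U" for U f
  proof -
    define N where "N i = card {x \<in> U. f x = i}" for i
    have finU: "finite U" using U finite_subset[of U "{1..n}"] by auto
    have N_le: "(\<Sum>i=1..t. real (N i)) \<le> real u"
    proof -
      have "(\<Sum>i=1..t. N i) = card (\<Union>i\<in>{1..t}. {x \<in> U. f x = i})"
        unfolding N_def by (rule card_UN_disjoint[symmetric]) (use finU in auto)
      also have "\<dots> \<le> card U" by (rule card_mono[OF finU]) auto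
      finally have "(\<Sum>i=1..t. N i) \<le> u" using U by simp
      then have "real (\<Sum>i=1..t. N i) \<le> real u" by (rule of_nat_mono)
      then show ?thesis by simp
    qed
    have "?\<Lambda> \<le> (\<Sum>i=1..t. (1 - p) ^ (N i choose ?K))"
      unfolding stage_rate_def
    proof (rule sum_ge_of_small_average[where N = "\<lambda>i. real (N i)" and u = "real u"])
      fix i assume i: "real (N i) \<le> (1 + \<epsilon>) * real u / real t"
      have K: "?K < n" using k by simp
      have nK: "real n - real ?K > 0" using K by simp
      have ch: "real ((n - 1) choose ?K) > 0" using K by simp
      have "p * real (N i choose ?K) \<le> d * (real (N i) / (real n - real ?K)) ^ ?K"
      proof -
        have le: "real (N i choose ?K) * (real n - real ?K) ^ ?K
            \<le> real ((n - 1) choose ?K) * real (N i) ^ ?K"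
        proof -
          have "(real (N i choose ?K) * fact ?K) * (real n - real ?K) ^ ?K
              \<le> real (N i) ^ ?K * (real ((n - 1) choose ?K) * fact ?K)"
            using binomial_lower[of ?K "n - 1"] K nK
            by (intro mult_mono binomial_upper) (auto simp: of_nat_diff)
          then have "fact ?K * (real (N i choose ?K) * (real n - real ?K) ^ ?K)
              \<le> fact ?K * (real ((n - 1) choose ?K) * real (N i) ^ ?K)" by (simp only: mult_ac)
          then show ?thesis by (rule mult_left_le_imp_le) simp
        qed
        have "p * real (N i choose ?K) \<le> d / real ((n - 1) choose ?K) * real (N i choose ?K)"
          using p(3) by (rule mult_right_mono) simp
        also have "\<dots> = d * (real (N i choose ?K) / real ((n - 1) choose ?K))" by simp
        also have "\<dots> \<le> d * (real (N i) / (real n - real ?K)) ^ ?K"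
          using le ch nK d by (intro mult_left_mono) (auto simp: power_divide field_simps)
        finally show ?thesis .
      qed
      also have "\<dots> \<le> d * (((1 + \<epsilon>) * real u / real t) / (real n - real ?K)) ^ ?K"
        using i nK d by (intro mult_left_mono power_mono divide_right_mono) auto
      finally have "p * real (N i choose ?K) / (1 - p)
          \<le> d * (((1 + \<epsilon>) * real u / real t) / (real n - real ?K)) ^ ?K / (1 - p)"
        using p(2) by (intro divide_right_mono) auto
      also have "\<dots> = d * ((1 + \<epsilon>) * (u / n) / t) ^ ?K *
          ((real n / (real n - real ?K)) ^ ?K / (1 - p))"
      proof -
        have "((1 + \<epsilon>) * real u / real t) / (real n - real ?K)
            = ((1 + \<epsilon>) * (u / n) / t) * (real n / (real n - real ?K))"
          using K by simp
        then show ?thesis by (simp only: power_mult_distrib) simp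
      qed
      also have "\<dots> \<le> d * ((1 + \<epsilon>) * (u / n) / t) ^ ?K * (1 + \<epsilon>)"
        using \<epsilon> d by (intro mult_left_mono) auto
      finally have "p / (1 - p) * real (N i choose ?K)
          \<le> (1 + \<epsilon>) * d * ((1 + \<epsilon>) * (u / n) / t) ^ ?K"
        by (simp add: mult_ac)
      then have "exp (- ((1 + \<epsilon>) * d * ((1 + \<epsilon>) * (u / n) / t) ^ ?K))
          \<le> exp (- (p / (1 - p) * real (N i choose ?K)))" by simp
      also have "\<dots> \<le> (1 - p) ^ (N i choose ?K)" by (rule exp_le_one_minus_power) (use p0 p in auto)
      finally show "exp (- ((1 + \<epsilon>) * d * ((1 + \<epsilon>) * (real u / real n) / real t) ^ ?K))
          \<le> (1 - p) ^ (N i choose ?K)" .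
    qed (use t u \<epsilon> p N_le in auto)
    then have "real (card (?A U f)) \<le> (real (n choose k) + 1) * real ((n choose k) choose m) *
        exp (- ?\<Lambda>) ^ card {v \<in> U. f v = 0}"
      unfolding N_def by (intro card_blocked[OF k(1) _ m pos p(1)]) (use U in auto)
    also have "exp (- ?\<Lambda>) ^ card {v \<in> U. f v = 0} = exp (- (?\<Lambda> * real (card {v \<in> U. f v = 0})))"
      by (simp add: exp_of_nat_mult[symmetric] mult.commute)
    also have "\<dots> \<le> exp (- (?\<Lambda> * s))" using f \<Lambda>0 by (auto intro: mult_left_mono)
    finally show ?thesis by (simp add: mult_left_mono)
  qed
  have sub: "{E. E \<subseteq> edges_on n k \<and> card E = m \<and> bad_stage n u t s E} \<subseteq> (\<Union>U\<in>?U. \<Union>f\<in>?F U. ?A U f)"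
  proof
    fix E assume "E \<in> {E. E \<subseteq> edges_on n k \<and> card E = m \<and> bad_stage n u t s E}"
    then obtain U f where E: "E \<subseteq> edges_on n k" "card E = m" and U: "U \<subseteq> {1..n}" "card U = u"
      and f: "f \<in> U \<rightarrow> {0..t}" "s \<le> real (card {v \<in> U. f v = 0})" "blocked U t f E"
      unfolding bad_stage_def by blast
    \<comment> \<open>Restricting the assignment to \<open>U\<close> changes no class and leaves
      finitely many assignments to count.\<close>
    have cls: "{v \<in> U. restrict f U v = i} = {v \<in> U. f v = i}" for i by auto
    have "restrict f U \<in> ?F U" using f unfolding mem_Collect_eq cls by auto
    moreover have "blocked U t (restrict f U) E"
      using f(3) unfolding blocked_def cls by simp
    ultimately show "E \<in> (\<Union>U\<in>?U. \<Union>f\<in>?F U. ?A U f)" using E U by blast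
  qed
  have finA: "finite (\<Union>U\<in>?U. \<Union>f\<in>?F U. ?A U f)"
    by (rule finite_subset[of _ "Pow (edges_on n k)"]) auto
  have finU: "finite ?U" by simp
  have "real (card {E. E \<subseteq> edges_on n k \<and> card E = m \<and> bad_stage n u t s E})
      \<le> real (card (\<Union>U\<in>?U. \<Union>f\<in>?F U. ?A U f))"
    using card_mono[OF finA sub] by simp
  also have "\<dots> \<le> real (\<Sum>U\<in>?U. card (\<Union>f\<in>?F U. ?A U f))"
    using card_UN_le[OF finU] by (rule of_nat_mono)
  also have "\<dots> = (\<Sum>U\<in>?U. real (card (\<Union>f\<in>?F U. ?A U f)))" by simp
  also have "\<dots> \<le> (\<Sum>U\<in>?U. (real t + 1) ^ u * ?c)"
  proof (rule sum_mono)
    fix U assume U: "U \<in> ?U"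
    have "real (card (\<Union>f\<in>?F U. ?A U f)) \<le> real (\<Sum>f\<in>?F U. card (?A U f))"
      using card_UN_le[OF finF[OF U]] by (rule of_nat_mono)
    also have "\<dots> = (\<Sum>f\<in>?F U. real (card (?A U f)))" by simp
    also have "\<dots> \<le> real (card (?F U)) * ?c" by (rule sum_bounded_above) (rule bound[OF U])
    also have "real (card (?F U)) \<le> (real t + 1) ^ u"
    proof -
      have fU: "finite U" using U finite_subset[of U "{1..n}"] by auto
      have "card (?F U) \<le> card (U \<rightarrow>\<^sub>E {0..t})"
        by (rule card_mono) (use fU in \<open>auto intro: finite_PiE\<close>)
      also have "\<dots> = (t + 1) ^ u" using U fU by (simp add: card_PiE)
      finally have "real (card (?F U)) \<le> real ((t + 1) ^ u)" by (rule of_nat_mono)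
      then show ?thesis by (simp add: add.commute)
    qed
    finally show "real (card (\<Union>f\<in>?F U. ?A U f)) \<le> (real t + 1) ^ u * ?c"
      by (simp add: mult_right_mono)
  qed
  also have "\<dots> = real (card ?U) * ((real t + 1) ^ u * ?c)" by simp
  also have "card ?U = n choose u" using n_subsets[of "{1..n}" u] by simp
  finally show ?thesis by (simp only: mult_ac)
qed

section \<open>Sparsity of small vertex sets and degeneracy of the greedy remainder\<close>

lemma card_supersets_le:
  assumes X: "finite X" and F: "F \<subseteq> X" and m: "m \<le> card X" "card X > 0"
  shows "real (card {E. E \<subseteq> X \<and> card E = m \<and> F \<subseteq> E})
    \<le> real (card X choose m) * (real m / real (card X)) ^ card F"
proof (cases "card F \<le> m")
  case True
  let ?N = "card X"
  have finF: "finite F" using X F finite_subset by blast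
  have "card {E. E \<subseteq> X \<and> card E = m \<and> F \<subseteq> E} \<le> card {E. E \<subseteq> X - F \<and> card E = m - card F}"
  proof (rule card_inj_on_le[where f = "\<lambda>E. E - F"])
    show "inj_on (\<lambda>E. E - F) {E. E \<subseteq> X \<and> card E = m \<and> F \<subseteq> E}"
      unfolding inj_on_def by blast
    show "(\<lambda>E. E - F) ` {E. E \<subseteq> X \<and> card E = m \<and> F \<subseteq> E} \<subseteq> {E. E \<subseteq> X - F \<and> card E = m - card F}"
      using finF by (auto simp: card_Diff_subset)
  qed (use X in auto)
  also have "\<dots> = (?N - card F) choose (m - card F)"
    using n_subsets[of "X - F" "m - card F"] X finF F by (simp add: card_Diff_subset)
  finally have 1: "real (card {E. E \<subseteq> X \<and> card E = m \<and> F \<subseteq> E}) \<le> real ((?N - card F) choose (m - card F))"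
    by simp
  have "real ((?N - f) choose (m - f)) \<le> real (?N choose m) * (real m / real ?N) ^ f" if "f \<le> m" for f
    using that
  proof (induction f)
    case (Suc f)
    have "Suc (m - Suc f) = m - f" "?N - f > 0" "?N - f - 1 = ?N - Suc f" using Suc.prems m by auto
    then have "real (m - f) * real ((?N - f) choose (m - f)) = real (?N - f) * real ((?N - Suc f) choose (m - Suc f))"
      using binomial_absorption[of "m - Suc f" "?N - f"] by (metis of_nat_mult)
    then have "real ((?N - Suc f) choose (m - Suc f))
        = real ((?N - f) choose (m - f)) * (real (m - f) / real (?N - f))"
      using \<open>?N - f > 0\<close> by (simp add: field_simps)
    also have "\<dots> \<le> real ((?N - f) choose (m - f)) * (real m / real ?N)"
    proof (rule mult_left_mono)
      have "real f * real m \<le> real f * real ?N" using m by (intro mult_left_mono) auto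
      then show "real (m - f) / real (?N - f) \<le> real m / real ?N"
        using Suc.prems m by (simp add: of_nat_diff field_simps)
    qed simp
    also have "\<dots> \<le> (real (?N choose m) * (real m / real ?N) ^ f) * (real m / real ?N)"
      by (rule mult_right_mono) (use Suc in auto)
    finally show ?case by (simp add: mult_ac)
  qed simp
  with True 1 show ?thesis by (meson order_trans)
next
  case False
  have "{E. E \<subseteq> X \<and> card E = m \<and> F \<subseteq> E} = {}"
    using False X card_mono finite_subset by (metis (mono_tags, lifting) Collect_empty_eq)
  then show ?thesis by (simp only: card.empty) simp
qed

definition dense_small_set :: "nat \<Rightarrow> nat \<Rightarrow> real \<Rightarrow> nat set set \<Rightarrow> bool" where
  "dense_small_set n b w E \<longleftrightarrow>
     (\<exists>S. S \<subseteq> {1..n} \<and> S \<noteq> {} \<and> real (card S) \<le> w \<and> card S * b \<le> card {e \<in> E. e \<subseteq> S})"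

lemma sum_id_half_power: "(\<Sum>s=1..M. real s * (1 / 2) ^ s) \<le> 2"
proof -
  have "(\<Sum>s=1..M. real s * (1 / 2) ^ s) = 2 - (real M + 2) * (1 / 2) ^ M"
  proof (induction M)
    case (Suc M)
    define X where "X = (1 / 2 :: real) ^ M"
    have "(\<Sum>s=1..Suc M. real s * (1 / 2) ^ s) = 2 - (real M + 2) * X + (real M + 1) * (X / 2)"
      using Suc by (simp add: X_def)
    also have "\<dots> = 2 - (real (Suc M) + 2) * (X / 2)" by (simp add: field_simps)
    finally show ?case by (simp add: X_def)
  qed simp
  then show ?thesis by simp
qed

text \<open>First moment over sets of size s = x n and s b edges inside them. By \<open>c1\<close>
  the edges contribute at most (exp (- 1) (x / x0)^(k-1))^(s b), and b (k - 1) \<ge> 2 leaves (x /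
  x0)^2 per vertex: one factor x cancels the 1 / x of the choice of the set, and \<open>c2\<close>
  turns the constants into 1 / 2.\<close>

lemma card_dense_small_set:
  fixes p d x0 :: real
  assumes k: "k \<ge> 2" "n \<ge> k" and m: "m \<le> n choose k"
    and p: "p = real m / real (n choose k)" "p \<le> d / real ((n - 1) choose (k - 1))"
    and d: "d > 0" and b: "b \<ge> 2" and x0: "0 < x0" "x0 \<le> 1"
    and c1: "exp 2 * d * x0 ^ (k - 1) \<le> real k * real b" and c2: "2 * exp 1 \<le> exp (real b) * x0"
  shows "real (card {E. E \<subseteq> edges_on n k \<and> card E = m \<and> dense_small_set n b (x0 * n) E})
    \<le> real ((n choose k) choose m) * (2 / (x0 * n))"
proof -
  let ?X = "edges_on n k" and ?K = "k - 1"
  let ?M = "nat \<lfloor>x0 * n\<rfloor>"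
  let ?S = "\<lambda>s. {S. S \<subseteq> {1..n} \<and> card S = s}"
  let ?F = "\<lambda>S. {F. F \<subseteq> {e. e \<subseteq> S \<and> card e = k} \<and> card F = card S * b}"
  let ?A = "\<lambda>F. {E. E \<subseteq> ?X \<and> card E = m \<and> F \<subseteq> E}"
  have n0: "n > 0" using k by simp
  have pos: "n choose k > 0" using k by simp
  have p0: "0 \<le> p" using p by simp
  have sub: "{E. E \<subseteq> ?X \<and> card E = m \<and> dense_small_set n b (x0 * n) E}
      \<subseteq> (\<Union>s\<in>{1..?M}. \<Union>S\<in>?S s. \<Union>F\<in>?F S. ?A F)"
  proof
    fix E assume "E \<in> {E. E \<subseteq> ?X \<and> card E = m \<and> dense_small_set n b (x0 * n) E}"
    then obtain S where E: "E \<subseteq> ?X" "card E = m" and S: "S \<subseteq> {1..n}" "S \<noteq> {}"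
      "real (card S) \<le> x0 * n" "card S * b \<le> card {e \<in> E. e \<subseteq> S}"
      unfolding dense_small_set_def by blast
    obtain F where F: "F \<subseteq> {e \<in> E. e \<subseteq> S}" "card F = card S * b"
      using obtain_subset_with_card_n[OF S(4)] by metis
    have "finite S" using S(1) finite_subset by blast
    then have "card S \<in> {1..?M}" using S by (auto simp: Suc_le_eq card_gt_0_iff le_nat_floor)
    moreover have "S \<in> ?S (card S)" using S by simp
    moreover have "F \<in> ?F S" using F E(1) unfolding edges_on_def by auto
    moreover have "E \<in> ?A F" using E F by auto
    ultimately show "E \<in> (\<Union>s\<in>{1..?M}. \<Union>S\<in>?S s. \<Union>F\<in>?F S. ?A F)" by blast
  qed
  have finA: "finite (\<Union>s\<in>{1..?M}. \<Union>S\<in>?S s. \<Union>F\<in>?F S. ?A F)"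
    by (rule finite_subset[of _ "Pow ?X"]) auto
  have inner: "real (card (\<Union>S\<in>?S s. \<Union>F\<in>?F S. ?A F))
      \<le> real (n choose s) * (real ((s choose k) choose (s * b)) * (real ((n choose k) choose m) * p ^ (s * b)))"
    for s
  proof -
    have "real (card (\<Union>F\<in>?F S. ?A F))
        \<le> real ((s choose k) choose (s * b)) * (real ((n choose k) choose m) * p ^ (s * b))"
      if S: "S \<in> ?S s" for S
    proof -
      have finS: "finite S" using S finite_subset[of S "{1..n}"] by auto
      have finF: "finite (?F S)" by (rule finite_subset[of _ "Pow (Pow S)"]) (use finS in auto)
      have "real (card (\<Union>F\<in>?F S. ?A F)) \<le> real (\<Sum>F\<in>?F S. card (?A F))"
        using card_UN_le[OF finF] by (rule of_nat_mono)
      also have "\<dots> = (\<Sum>F\<in>?F S. real (card (?A F)))" by simp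
      also have "\<dots> \<le> real (card (?F S)) * (real ((n choose k) choose m) * p ^ (s * b))"
      proof (rule sum_bounded_above)
        fix F assume F: "F \<in> ?F S"
        then have "F \<subseteq> ?X" using S unfolding edges_on_def by blast
        from card_supersets_le[OF finite_edges_on this, of m] F S m pos p
        show "real (card (?A F)) \<le> real ((n choose k) choose m) * p ^ (s * b)" by simp
      qed
      also have "card (?F S) = (s choose k) choose (s * b)"
        using n_subsets[of "{e. e \<subseteq> S \<and> card e = k}" "card S * b"] n_subsets[OF finS, of k] finS S
        by simp
      finally show ?thesis .
    qed
    then have "(\<Sum>S\<in>?S s. real (card (\<Union>F\<in>?F S. ?A F))) \<le> real (card (?S s)) *
        (real ((s choose k) choose (s * b)) * (real ((n choose k) choose m) * p ^ (s * b)))"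
      by (rule sum_bounded_above)
    moreover have "card (?S s) = n choose s" using n_subsets[of "{1..n}" s] by simp
    moreover have "real (card (\<Union>S\<in>?S s. \<Union>F\<in>?F S. ?A F)) \<le> real (\<Sum>S\<in>?S s. card (\<Union>F\<in>?F S. ?A F))"
      by (intro of_nat_mono card_UN_le) simp
    ultimately show ?thesis by simp
  qed
  have term_le: "real (n choose s) * (real ((s choose k) choose (s * b)) * p ^ (s * b))
      \<le> (1 / (x0 * n)) * (real s * (1 / 2) ^ s)" if s: "s \<in> {1..?M}" for s
  proof -
    define x where "x = real s / real n"
    have "real s \<le> real ?M" using s by (simp only: atLeastAtMost_iff of_nat_le_iff)
    also have "\<dots> \<le> x0 * n" by (rule of_nat_floor) (use x0 in simp)
    finally have s1: "s \<ge> 1" "real s \<le> x0 * n" using s by auto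
    have sn: "s \<le> n"
    proof -
      have "real s \<le> 1 * real n" using s1(2) x0 by (meson mult_right_mono of_nat_0_le_iff order_trans)
      then show ?thesis by simp
    qed
    have x: "0 < x" "x \<le> x0" unfolding x_def using s1 n0 by (auto simp: field_simps)
    have "real (s choose k) * p / (real s * real b) \<le> d * x ^ ?K / (real k * real b)"
    proof -
      have "k * (s choose k) = s * ((s - 1) choose ?K)"
        using binomial_absorption[of ?K s] k by simp
      then have sk: "real (s choose k) = real s / real k * real ((s - 1) choose ?K)"
        using k by (simp add: field_simps) (metis of_nat_mult)
      have ch: "real ((n - 1) choose ?K) > 0" using k by simp
      have "real ((s - 1) choose ?K) * p \<le> real ((s - 1) choose ?K) * (d / real ((n - 1) choose ?K))"
        using p(2) by (rule mult_left_mono) simp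
      also have "\<dots> = d * (real ((s - 1) choose ?K) / real ((n - 1) choose ?K))" by simp
      also have "\<dots> \<le> d * x ^ ?K"
        using binomial_ratio[OF s1(1) sn, of ?K] ch n0 d k
        by (intro mult_left_mono) (auto simp: x_def power_divide field_simps)
      finally have le: "real ((s - 1) choose ?K) * p \<le> d * x ^ ?K" .
      have "real (s choose k) * p / (real s * real b) = (real ((s - 1) choose ?K) * p) / (real k * real b)"
        unfolding sk using s1 by simp
      also have "\<dots> \<le> d * x ^ ?K / (real k * real b)" using le by (rule divide_right_mono) simp
      finally show ?thesis .
    qed
    also have "\<dots> = (d * x0 ^ ?K / (real k * real b)) * (x / x0) ^ ?K"
      using x0 by (simp add: power_divide)
    also have "\<dots> \<le> exp (- 2) * (x / x0) ^ ?K"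
      using c1 b k x x0 by (intro mult_right_mono) (auto simp: exp_minus field_simps)
    finally have q: "real (s choose k) * p / (real s * real b) \<le> exp (- 2) * (x / x0) ^ ?K" .
    have "real ((s choose k) choose (s * b)) * p ^ (s * b)
        \<le> (exp 1 * real (s choose k) / real (s * b)) ^ (s * b) * p ^ (s * b)"
      by (intro mult_right_mono binomial_le_exp_power) (use s1 b p0 in auto)
    also have "\<dots> = (exp 1 * (real (s choose k) * p / (real s * real b))) ^ (s * b)"
      by (simp add: power_mult_distrib[symmetric] mult_ac)
    also have "\<dots> \<le> (exp 1 * (exp (- 2) * (x / x0) ^ ?K)) ^ (s * b)"
      by (intro power_mono mult_left_mono q) (use p0 in auto)
    also have "\<dots> = ((exp (- 1) * (x / x0) ^ ?K) ^ b) ^ s"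
      by (simp add: power_mult[symmetric] mult_exp_exp mult.assoc[symmetric] mult.commute[of b s])
    also have "((exp (- 1) * (x / x0) ^ ?K) ^ b) ^ s \<le> (exp (- real b) * (x / x0) ^ 2) ^ s"
    proof (rule power_mono)
      have "2 * 1 \<le> b * ?K" by (intro mult_le_mono) (use b k in auto)
      then have "(x / x0) ^ (b * ?K) \<le> (x / x0) ^ 2"
        by (intro power_decreasing) (use x x0 in auto)
      moreover have "exp (- 1) ^ b = exp (- real b)" by (simp add: exp_of_nat_mult[symmetric])
      ultimately show "(exp (- 1) * (x / x0) ^ ?K) ^ b \<le> exp (- real b) * (x / x0) ^ 2"
        by (simp add: power_mult_distrib power_mult[symmetric] mult.commute[of b])
    qed (use x x0 in simp)
    finally have 1: "real ((s choose k) choose (s * b)) * p ^ (s * b)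
        \<le> (exp (- real b) * (x / x0) ^ 2) ^ s" .
    have 2: "real (n choose s) \<le> (exp 1 / x) ^ s"
      using binomial_le_exp_power[of s n] s1 unfolding x_def by simp
    have "real (n choose s) * (real ((s choose k) choose (s * b)) * p ^ (s * b))
        \<le> (exp 1 / x) ^ s * (exp (- real b) * (x / x0) ^ 2) ^ s"
      by (intro mult_mono 1 2) (use x p0 in auto)
    also have "\<dots> = (exp 1 / x * (exp (- real b) * (x / x0) ^ 2)) ^ s"
      by (rule power_mult_distrib[symmetric])
    also have "exp 1 / x * (exp (- real b) * (x / x0) ^ 2) = (x / x0) * (exp 1 * exp (- real b) / x0)"
      using x x0 by (simp add: power2_eq_square field_simps)
    also have "((x / x0) * (exp 1 * exp (- real b) / x0)) ^ s \<le> ((x / x0) * (1 / 2)) ^ s"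
      using c2 x x0 by (intro power_mono mult_left_mono) (auto simp: exp_minus field_simps)
    also have "\<dots> = (x / x0) ^ s * (1 / 2) ^ s" by (rule power_mult_distrib)
    \<comment> \<open>One factor x / x0 = s / (x0 n) is kept; it makes the whole sum O(1 / n), while
      the powers of 1 / 2 give convergence in s.\<close>
    also have "\<dots> \<le> (x / x0) ^ 1 * (1 / 2) ^ s"
      by (intro mult_right_mono power_decreasing) (use s1 x x0 in auto)
    also have "\<dots> = (1 / (x0 * n)) * (real s * (1 / 2) ^ s)"
      unfolding x_def by (simp add: field_simps)
    finally show ?thesis .
  qed
  have "real (card {E. E \<subseteq> ?X \<and> card E = m \<and> dense_small_set n b (x0 * n) E})
      \<le> real (card (\<Union>s\<in>{1..?M}. \<Union>S\<in>?S s. \<Union>F\<in>?F S. ?A F))"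
    using card_mono[OF finA sub] by simp
  also have "\<dots> \<le> real (\<Sum>s\<in>{1..?M}. card (\<Union>S\<in>?S s. \<Union>F\<in>?F S. ?A F))"
    by (intro of_nat_mono card_UN_le) simp
  also have "\<dots> = (\<Sum>s\<in>{1..?M}. real (card (\<Union>S\<in>?S s. \<Union>F\<in>?F S. ?A F)))" by simp
  also have "\<dots> \<le> (\<Sum>s\<in>{1..?M}. real ((n choose k) choose m) *
      ((1 / (x0 * n)) * (real s * (1 / 2) ^ s)))"
  proof (rule sum_mono)
    fix s assume s: "s \<in> {1..?M}"
    have "real (n choose s) * (real ((s choose k) choose (s * b)) * (real ((n choose k) choose m) * p ^ (s * b)))
        = real ((n choose k) choose m) * (real (n choose s) * (real ((s choose k) choose (s * b)) * p ^ (s * b)))"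
      by (simp only: mult_ac)
    also have "\<dots> \<le> real ((n choose k) choose m) * ((1 / (x0 * n)) * (real s * (1 / 2) ^ s))"
      by (rule mult_left_mono[OF term_le[OF s]]) simp
    finally show "real (card (\<Union>S\<in>?S s. \<Union>F\<in>?F S. ?A F))
        \<le> real ((n choose k) choose m) * ((1 / (x0 * n)) * (real s * (1 / 2) ^ s))"
      using inner[of s] by linarith
  qed
  also have "\<dots> = real ((n choose k) choose m) * ((1 / (x0 * n)) * (\<Sum>s=1..?M. real s * (1 / 2) ^ s))"
    by (simp only: sum_distrib_left)
  also have "\<dots> \<le> real ((n choose k) choose m) * ((1 / (x0 * n)) * 2)"
    by (intro mult_left_mono sum_id_half_power) (use x0 in auto)
  finally show ?thesis by simp
qed

text \<open>Double counting of incidences: if all degrees inside T were at least k b, then T would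
  span at least |T| b edges.\<close>

lemma degenerate_if_sparse:
  assumes fin: "finite R" and E: "\<forall>e\<in>E. card e = k" and kb: "k * b > 0"
    and sparse: "\<And>T. T \<subseteq> R \<Longrightarrow> T \<noteq> {} \<Longrightarrow> card {e \<in> E. e \<subseteq> T} < card T * b"
  shows "degenerate E (k * b - 1) R"
  unfolding degenerate_def
proof (intro allI impI, rule ccontr)
  fix T assume T: "T \<subseteq> R" "T \<noteq> {}" and big: "\<not> (\<exists>v\<in>T. card {e \<in> E. e \<subseteq> T \<and> v \<in> e} \<le> k * b - 1)"
  have deg: "k * b \<le> card {e \<in> E. e \<subseteq> T \<and> v \<in> e}" if "v \<in> T" for v
  proof (rule ccontr)
    assume "\<not> k * b \<le> card {e \<in> E. e \<subseteq> T \<and> v \<in> e}"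
    then have "card {e \<in> E. e \<subseteq> T \<and> v \<in> e} \<le> k * b - 1" by linarith
    with big that show False by blast
  qed
  have finT: "finite T" using T fin finite_subset by blast
  define F where "F = {e \<in> E. e \<subseteq> T}"
  have finF: "finite F" by (rule finite_subset[of _ "Pow T"]) (use finT in \<open>auto simp: F_def\<close>)
  have "card T * (k * b) \<le> (\<Sum>v\<in>T. card {e \<in> F. v \<in> e})"
    using sum_bounded_below[of T "k * b" "\<lambda>v. card {e \<in> F. v \<in> e}"] deg
    by (simp add: F_def conj_assoc)
  also have "\<dots> = (\<Sum>v\<in>T. \<Sum>e\<in>F. if v \<in> e then 1 else 0)"
    using finF by (simp add: sum.If_cases Int_def)
  also have "\<dots> = (\<Sum>e\<in>F. \<Sum>v\<in>T. if v \<in> e then 1 else 0)" by (rule sum.swap)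
  also have "\<dots> = (\<Sum>e\<in>F. k)"
  proof (rule sum.cong[OF refl])
    fix e assume e: "e \<in> F"
    then have "T \<inter> e = e" unfolding F_def by auto
    then show "(\<Sum>v\<in>T. if v \<in> e then 1 else 0) = k"
      using finT E e by (simp add: sum.If_cases F_def)
  qed
  also have "\<dots> = k * card F" by simp
  finally have "k * (card T * b) \<le> k * card F" by (simp only: mult_ac)
  then have "card T * b \<le> card F" using kb by simp
  with sparse[OF T] show False unfolding F_def by simp
qed

text \<open>The first \<open>t1\<close> greedy classes leave fewer than \<open>u\<close> vertices uncovered. The other \<open>t2\<close> classes
  live on these, so that a union bound over vertex sets of size \<open>u\<close> is enough to control them.\<close>

lemma greedy_degenerate_if_not_bad:
  fixes t1 t2 b u k n :: nat and w :: real
  assumes k: "k \<ge> 2" and E: "E \<subseteq> edges_on n k" and t: "t2 > 0" and b: "b > 0" and u: "u \<le> n"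
    and nb1: "\<not> bad_stage n n t1 (real u) E" and nb2: "\<not> bad_stage n u t2 w E"
    and nd: "\<not> dense_small_set n b w E"
  shows "greedy_degenerate {1..n} E (t1 + t2) (k * b - 1)"
proof -
  let ?V = "{1..n}" and ?a = "t1 + t2"
  have edge: "e \<subseteq> ?V" "card e = k" if "e \<in> E" for e
    using that E unfolding edges_on_def by auto
  interpret edge_hypergraph ?V E
    by unfold_locales (use edge k in auto)
  show ?thesis
  proof unfold_locales
    fix ds \<sigma> assume ds: "length ds = ?a" "distinct ds" and max: "maximal_classes ds \<sigma>"
    define g where "g = inv_into {..<?a} ((!) ds)"
    define f where "f v = (if \<sigma> v \<in> set ds then Suc (g (\<sigma> v)) else 0)" for v
    have bij: "bij_betw ((!) ds) {..<?a} (set ds)" using bij_betw_nth[OF ds(2)] ds(1) by auto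
    have g: "g (ds ! i) = i" if "i < ?a" for i
      unfolding g_def using bij that by (intro inv_into_f_f) (auto simp: bij_betw_def)
    have f_nth: "f v = Suc i" if "i < ?a" "\<sigma> v = ds ! i" for v i
      unfolding f_def using that g ds(1) by simp
    have f0: "f v = 0 \<longleftrightarrow> \<sigma> v \<notin> set ds" for v unfolding f_def by simp
    \<comment> \<open>Maximality also concerns vertices absorbed by a later class. Therefore the
      first stage may count them as uncovered, together with the true remainder.\<close>
    have absorb: "\<exists>e\<in>E. v \<in> e \<and> (\<forall>x\<in>e - {v}. f x = i)"
      if v: "v \<in> ?V" and i: "i \<in> {1..?a}" and fv: "f v = 0 \<or> f v > i" for v i
    proof -
      obtain j where j: "i = Suc j" "j < ?a" using i by (cases i) auto
      have "\<sigma> v \<notin> set (take (Suc j) ds)"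
      proof
        assume "\<sigma> v \<in> set (take (Suc j) ds)"
        then obtain l where l: "l < Suc j" "\<sigma> v = ds ! l" using j ds by (auto simp: in_set_conv_nth)
        then have "f v = Suc l" using j by (intro f_nth) auto
        with fv l j show False by auto
      qed
      then obtain e where "e \<in> E" "v \<in> e" "\<forall>x\<in>e - {v}. \<sigma> x = ds ! j"
        using max v j ds(1) unfolding maximal_classes_def by metis
      then show ?thesis using f_nth[OF j(2)] j(1) by blast
    qed
    define R1 where "R1 = {v \<in> ?V. f v = 0 \<or> f v > t1}"
    define f1 where "f1 v = (if f v \<le> t1 then f v else 0)" for v
    have "blocked ?V t1 f1 E"
      unfolding blocked_def
    proof (intro ballI impI)
      fix v i assume v: "v \<in> ?V" "f1 v = 0" and i: "i \<in> {1..t1}"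
      have "f v = 0 \<or> f v > i" using v(2) i unfolding f1_def by (auto split: if_splits)
      then obtain e where e: "e \<in> E" "v \<in> e" "\<forall>x\<in>e - {v}. f x = i"
        using absorb[OF v(1), of i] i by auto
      have "e - {v} \<subseteq> {u \<in> ?V. f1 u = i}" using e edge(1)[OF e(1)] i unfolding f1_def by auto
      with e show "\<exists>e\<in>E. v \<in> e \<and> e - {v} \<subseteq> {u \<in> ?V. f1 u = i}" by blast
    qed
    moreover have "f1 \<in> ?V \<rightarrow> {0..t1}" unfolding f1_def by auto
    moreover have "{v \<in> ?V. f1 v = 0} = R1" unfolding R1_def f1_def by auto
    ultimately have "bad_stage n n t1 (real u) E" if "real u \<le> real (card R1)"
      unfolding bad_stage_def using that by (intro exI[of _ ?V] exI[of _ f1]) simp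
    with nb1 have "\<not> real u \<le> real (card R1)" by blast
    then have "card R1 \<le> u" by simp
    moreover have "R1 \<subseteq> ?V" unfolding R1_def by auto
    \<comment> \<open>The set left by the first stage is padded to exactly u vertices, the size for
      which the second union bound is made.\<close>
    ultimately obtain U where U: "R1 \<subseteq> U" "U \<subseteq> ?V" "card U = u"
      using exists_subset_between[of R1 u ?V] u by auto
    \<comment> \<open>Padding vertices join class 1, which exists as t2 > 0. Then they do not count
      as uncovered, and enlarging a class keeps the other vertices blocked.\<close>
    define f2 where "f2 v = (if v \<in> R1 then f v - t1 else 1)" for v
    have f_le: "f v \<le> ?a" for v
    proof (cases "\<sigma> v \<in> set ds")
      case True
      then obtain i where "i < ?a" "\<sigma> v = ds ! i" using ds(1) by (metis in_set_conv_nth)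
      then show ?thesis using f_nth by fastforce
    qed (simp add: f_def)
    have "blocked U t2 f2 E"
      unfolding blocked_def
    proof (intro ballI impI)
      fix v i assume v: "v \<in> U" "f2 v = 0" and i: "i \<in> {1..t2}"
      have vV: "v \<in> ?V" using v(1) U by blast
      have "f v = 0" using v(2) unfolding f2_def R1_def by (auto split: if_splits)
      then obtain e where e: "e \<in> E" "v \<in> e" "\<forall>x\<in>e - {v}. f x = t1 + i"
        using absorb[OF vV, of "t1 + i"] i by auto
      have "e - {v} \<subseteq> {u \<in> U. f2 u = i}"
      proof
        fix x assume x: "x \<in> e - {v}"
        then have "x \<in> R1" using e edge(1)[OF e(1)] i unfolding R1_def by auto
        then show "x \<in> {u \<in> U. f2 u = i}" using x e U unfolding f2_def by auto
      qed
      with e show "\<exists>e\<in>E. v \<in> e \<and> e - {v} \<subseteq> {u \<in> U. f2 u = i}" by blast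
    qed
    moreover have "f2 \<in> U \<rightarrow> {0..t2}" using f_le t unfolding f2_def by (auto simp: le_diff_conv add.commute)
    ultimately have "\<not> w \<le> real (card {v \<in> U. f2 v = 0})"
      using nb2 U unfolding bad_stage_def by blast
    moreover have "{v \<in> U. f2 v = 0} = {v \<in> ?V. f v = 0}"
      using U unfolding f2_def R1_def by (auto split: if_splits)
    ultimately have small: "real (card {v \<in> ?V. \<sigma> v \<notin> set ds}) < w"
      unfolding f0 by simp
    show "degenerate E (k * b - 1) {v \<in> ?V. \<sigma> v \<notin> set ds}"
    proof (rule degenerate_if_sparse)
      fix T assume T: "T \<subseteq> {v \<in> ?V. \<sigma> v \<notin> set ds}" "T \<noteq> {}"
      have "card T \<le> card {v \<in> ?V. \<sigma> v \<notin> set ds}" by (rule card_mono[OF _ T(1)]) simp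
      with small have "real (card T) \<le> w" by linarith
      with nd T show "card {e \<in> E. e \<subseteq> T} < card T * b"
        unfolding dense_small_set_def by (metis (no_types, lifting) leI mem_Collect_eq subset_iff)
    qed (use edge k b in auto)
  qed
qed

section \<open>From counting bounds to statements with high probability\<close>

lemma whpI:
  assumes \<delta>: "\<delta> \<longlonglongrightarrow> 0"
    and ev: "\<forall>\<^sub>F n in sequentially. edge_count k d n \<le> n choose k \<and>
      real (card {E. E \<subseteq> edges_on n k \<and> card E = edge_count k d n \<and> \<not> P n ({1..n}, E)})
        \<le> real ((n choose k) choose edge_count k d n) * \<delta> n"
  shows "whp k d P"
  unfolding whp_def
proof (rule tendsto_sandwich)
  show "(\<lambda>n. 1 - \<delta> n) \<longlonglongrightarrow> 1" using tendsto_diff[OF tendsto_const \<delta>, of 1] by simp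
  show "\<forall>\<^sub>F n in sequentially. 1 - \<delta> n \<le>
      measure_pmf.prob (random_hypergraph n (edge_count k d n) k) {H. P n H}"
    using ev
  proof eventually_elim
    case (elim n)
    let ?m = "edge_count k d n"
    define S where "S = {E. E \<subseteq> edges_on n k \<and> card E = ?m}"
    have S: "uniform_hypergraphs n ?m k = Pair {1..n} ` S"
      unfolding uniform_hypergraphs_def S_def edges_on_def by auto
    have finS: "finite S" unfolding S_def by simp
    have inj: "inj_on (Pair {1..n}) A" for A :: "nat set set set" by (simp add: inj_on_def)
    have cardS: "card S = (n choose k) choose ?m"
      using n_subsets[OF finite_edges_on[of n k], of ?m] unfolding S_def by simp
    then have pos: "card S > 0" using elim by simp
    then have ne: "S \<noteq> {}" by auto
    have "measure_pmf.prob (random_hypergraph n ?m k) {H. P n H}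
        = real (card (Pair {1..n} ` S \<inter> {H. P n H})) / real (card (Pair {1..n} ` S))"
      unfolding random_hypergraph_def S using finS ne by (intro measure_pmf_of_set) auto
    also have "Pair {1..n} ` S \<inter> {H. P n H} = Pair {1..n} ` (S - {E \<in> S. \<not> P n ({1..n}, E)})" by auto
    also have "card (Pair {1..n} ` (S - {E \<in> S. \<not> P n ({1..n}, E)}))
        = card S - card {E \<in> S. \<not> P n ({1..n}, E)}"
      using finS by (subst card_image[OF inj], subst card_Diff_subset) auto
    also have "card (Pair {1..n} ` S) = card S" by (rule card_image[OF inj])
    also have "real (card S - card {E \<in> S. \<not> P n ({1..n}, E)}) =
        real (card S) - real (card {E \<in> S. \<not> P n ({1..n}, E)})"
      using finS by (intro of_nat_diff card_mono) auto
    finally have eq: "measure_pmf.prob (random_hypergraph n ?m k) {H. P n H} =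
        (real (card S) - real (card {E \<in> S. \<not> P n ({1..n}, E)})) / real (card S)" .
    have "{E \<in> S. \<not> P n ({1..n}, E)} =
        {E. E \<subseteq> edges_on n k \<and> card E = ?m \<and> \<not> P n ({1..n}, E)}" unfolding S_def by auto
    then have "real (card {E \<in> S. \<not> P n ({1..n}, E)}) \<le> real (card S) * \<delta> n"
      using elim cardS by simp
    then show ?case unfolding eq using pos by (simp add: field_simps)
  qed
  show "\<forall>\<^sub>F n in sequentially.
      measure_pmf.prob (random_hypergraph n (edge_count k d n) k) {H. P n H} \<le> 1"
    by simp
  show "(\<lambda>_. 1 :: real) \<longlonglongrightarrow> 1" by simp
qed

lemma stage_rate_antimono:
  assumes "w \<le> w'" "0 \<le> w" "\<epsilon> > 0" "d > 0"
  shows "stage_rate k d \<epsilon> t w' \<le> stage_rate k d \<epsilon> t w"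
  unfolding stage_rate_def
  using assms by (auto intro!: mult_left_mono power_mono divide_right_mono)

lemma stage_rate_nonneg: "\<epsilon> > 0 \<Longrightarrow> 0 \<le> stage_rate k d \<epsilon> t w"
  unfolding stage_rate_def by simp

text \<open>By \<open>s1\<close> and \<open>s2\<close> the exponent of each stage exceeds its
  entropy by n: n ln (t1 + 1) in the first, and at most 2 r1 n (1 - ln r1 + ln (t2 + 1)) in the
  second. The spare exp (- n) outweighs the polynomial loss from fixing the number of edges.\<close>

lemma card_not_greedy_degenerate:
  fixes p d \<epsilon> r1 x0 :: real and t1 t2 b n k m :: nat
  assumes k: "k \<ge> 2" "n \<ge> k" and m: "m \<le> n choose k"
    and p: "p = real m / real (n choose k)" "p < 1" "p \<le> d / real ((n - 1) choose (k - 1))"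
    and \<epsilon>: "\<epsilon> > 0" "(real n / (real n - real (k - 1))) ^ (k - 1) / (1 - p) \<le> 1 + \<epsilon>"
    and d: "d > 0" and t: "t1 > 0" "t2 > 0" and b: "b \<ge> 2"
    and r1: "0 < r1" "r1 \<le> 1" "1 \<le> r1 * n" and x0: "0 < x0" "x0 \<le> 1"
    and c1: "exp 2 * d * x0 ^ (k - 1) \<le> real k * real b" and c2: "2 * exp 1 \<le> exp (real b) * x0"
    and s1: "ln (real t1 + 1) + 1 \<le> r1 * stage_rate k d \<epsilon> t1 1"
    and s2: "2 * r1 * (1 - ln r1 + ln (real t2 + 1)) + 1 \<le> x0 * stage_rate k d \<epsilon> t2 (2 * r1)"
  shows "real (card {E. E \<subseteq> edges_on n k \<and> card E = m \<and>
      \<not> greedy_degenerate {1..n} E (t1 + t2) (k * b - 1)})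
    \<le> real ((n choose k) choose m) * (2 * (real n ^ k + 1) * exp (- real n) + 2 / (x0 * n))"
proof -
  \<comment> \<open>Rounding up at most doubles \<open>r1 * n\<close>, because this is at least 1;
    hence the factors 2 in \<open>s2\<close>.\<close>
  define u where "u = nat \<lceil>r1 * n\<rceil>"
  have n0: "n > 0" using k by simp
  have u_ge: "r1 * n \<le> real u" unfolding u_def by (rule real_nat_ceiling_ge)
  have u_le2: "real u \<le> 2 * r1 * n" unfolding u_def using r1 by linarith
  have u_n: "u \<le> n"
  proof -
    have "r1 * n \<le> 1 * real n" using r1 by (intro mult_right_mono) auto
    then show ?thesis unfolding u_def by (simp add: nat_le_iff ceiling_le_iff)
  qed
  have u0: "u > 0"
  proof -
    have "0 < r1 * n" using r1 by linarith
    then have "0 < real u" using u_ge by linarith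
    then show ?thesis by simp
  qed
  let ?S = "\<lambda>P. {E. E \<subseteq> edges_on n k \<and> card E = m \<and> P E}"
  let ?M = "real ((n choose k) choose m)" and ?N = "real (n choose k) + 1"
  let ?B1 = "bad_stage n n t1 (real u)" and ?B2 = "bad_stage n u t2 (x0 * n)"
    and ?B3 = "dense_small_set n b (x0 * n)"
  have NM: "0 \<le> ?N * ?M" by simp
  have N_le: "?N \<le> real n ^ k + 1"
    using binomial_le_pow[OF k(2)] by (simp add: of_nat_power[symmetric] del: of_nat_power)
  have B1: "real (card (?S ?B1)) \<le> ?N * ?M * exp (- real n)"
  proof -
    have "real (card (?S ?B1)) \<le> ?N * ?M * real (n choose n) * (real t1 + 1) ^ n *
        exp (- (stage_rate k d \<epsilon> t1 (n / n) * real u))"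
      by (rule card_bad_stage[OF k m p \<epsilon> d t(1) n0])
    also have "\<dots> = ?N * ?M * exp (n * ln (real t1 + 1) - stage_rate k d \<epsilon> t1 1 * real u)"
    proof -
      have "(real t1 + 1) ^ n = exp (n * ln (real t1 + 1))" by (simp add: exp_of_nat_mult)
      then show ?thesis using n0 by (simp add: exp_diff exp_minus field_simps)
    qed
    also have "\<dots> \<le> ?N * ?M * exp (- real n)"
    proof -
      have "stage_rate k d \<epsilon> t1 1 * (r1 * n) \<le> stage_rate k d \<epsilon> t1 1 * real u"
        by (intro mult_left_mono u_ge stage_rate_nonneg \<epsilon>)
      moreover have "n * (ln (real t1 + 1) + 1) \<le> n * (r1 * stage_rate k d \<epsilon> t1 1)"
        by (rule mult_left_mono[OF s1]) simp
      ultimately have "n * ln (real t1 + 1) - stage_rate k d \<epsilon> t1 1 * real u \<le> - real n"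
        by (simp add: algebra_simps)
      then show ?thesis by (intro mult_left_mono[OF _ NM]) simp
    qed
    finally show ?thesis .
  qed
  have B2: "real (card (?S ?B2)) \<le> ?N * ?M * exp (- real n)"
  proof -
    let ?r = "stage_rate k d \<epsilon> t2"
    have lnr1: "ln r1 \<le> 0" using r1 by simp
    have "real (card (?S ?B2)) \<le> ?N * ?M * real (n choose u) * (real t2 + 1) ^ u *
        exp (- (?r (u / n) * (x0 * n)))"
      by (rule card_bad_stage[OF k m p \<epsilon> d t(2) u0])
    also have "\<dots> = ?N * ?M * (real (n choose u) * (real t2 + 1) ^ u * exp (- (?r (u / n) * (x0 * n))))"
      by simp
    also have "\<dots> \<le> ?N * ?M * exp (- real n)"
    proof (rule mult_left_mono[OF _ NM])
      have "real (n choose u) \<le> (exp 1 * n / u) ^ u" by (rule binomial_le_exp_power[OF u0])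
      also have "\<dots> \<le> (exp 1 / r1) ^ u"
        using u_ge u0 r1 by (intro power_mono) (auto simp: field_simps)
      also have "\<dots> = exp (u * (1 - ln r1))"
        using r1 by (simp add: exp_of_nat_mult exp_diff)
      finally have ch: "real (n choose u) \<le> exp (u * (1 - ln r1))" .
      have tu: "(real t2 + 1) ^ u = exp (u * ln (real t2 + 1))" by (simp add: exp_of_nat_mult)
      have "real u / real n \<le> 2 * r1" using u_le2 n0 by (simp add: field_simps)
      then have rate: "?r (2 * r1) \<le> ?r (u / n)" by (intro stage_rate_antimono) (use \<epsilon> d in auto)
      have "real (n choose u) * (real t2 + 1) ^ u * exp (- (?r (u / n) * (x0 * n)))
          \<le> exp (u * (1 - ln r1)) * exp (u * ln (real t2 + 1)) * exp (- (?r (2 * r1) * (x0 * n)))"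
        unfolding tu using ch rate x0 by (intro mult_mono) (auto intro: mult_right_mono)
      also have "\<dots> = exp (u * (1 - ln r1 + ln (real t2 + 1)) - ?r (2 * r1) * (x0 * n))"
        by (simp add: exp_add[symmetric] algebra_simps)
      also have "\<dots> \<le> exp (- real n)"
      proof -
        have "u * (1 - ln r1 + ln (real t2 + 1)) \<le> (2 * r1 * n) * (1 - ln r1 + ln (real t2 + 1))"
          using u_le2 lnr1 by (intro mult_right_mono) auto
        moreover have "n * (2 * r1 * (1 - ln r1 + ln (real t2 + 1)) + 1) \<le> n * (x0 * ?r (2 * r1))"
          by (rule mult_left_mono[OF s2]) simp
        ultimately show ?thesis by (simp add: algebra_simps)
      qed
      finally show "real (n choose u) * (real t2 + 1) ^ u * exp (- (?r (u / n) * (x0 * n)))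
          \<le> exp (- real n)" .
    qed
    finally show ?thesis .
  qed
  have B3: "real (card (?S ?B3)) \<le> ?M * (2 / (x0 * n))"
    by (rule card_dense_small_set[OF k m p(1,3) d b x0 c1 c2])
  have fin: "finite (?S P)" for P by (rule finite_subset[of _ "Pow (edges_on n k)"]) auto
  have "?S (\<lambda>E. \<not> greedy_degenerate {1..n} E (t1 + t2) (k * b - 1)) \<subseteq> ?S ?B1 \<union> ?S ?B2 \<union> ?S ?B3"
  proof
    fix E assume "E \<in> ?S (\<lambda>E. \<not> greedy_degenerate {1..n} E (t1 + t2) (k * b - 1))"
    then have E: "E \<subseteq> edges_on n k" "card E = m"
      and ng: "\<not> greedy_degenerate {1..n} E (t1 + t2) (k * b - 1)" by blast+
    have "?B1 E \<or> ?B2 E \<or> ?B3 E"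
    proof (rule ccontr)
      assume "\<not> (?B1 E \<or> ?B2 E \<or> ?B3 E)"
      then have "greedy_degenerate {1..n} E (t1 + t2) (k * b - 1)"
        by (intro greedy_degenerate_if_not_bad[OF k(1) E(1) t(2) _ u_n]) (use b in auto)
      with ng show False ..
    qed
    with E show "E \<in> ?S ?B1 \<union> ?S ?B2 \<union> ?S ?B3" by blast
  qed
  then have "card (?S (\<lambda>E. \<not> greedy_degenerate {1..n} E (t1 + t2) (k * b - 1)))
      \<le> card (?S ?B1 \<union> ?S ?B2 \<union> ?S ?B3)"
    by (intro card_mono finite_UnI fin)
  also have "\<dots> \<le> card (?S ?B1) + card (?S ?B2) + card (?S ?B3)"
    by (intro order_trans[OF card_Un_le] add_right_mono card_Un_le)
  finally have "card (?S (\<lambda>E. \<not> greedy_degenerate {1..n} E (t1 + t2) (k * b - 1)))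
      \<le> card (?S ?B1) + card (?S ?B2) + card (?S ?B3)" .
  then have "real (card (?S (\<lambda>E. \<not> greedy_degenerate {1..n} E (t1 + t2) (k * b - 1))))
      \<le> real (card (?S ?B1)) + real (card (?S ?B2)) + real (card (?S ?B3))"
    by (simp only: of_nat_add[symmetric] of_nat_le_iff)
  also have "\<dots> \<le> ?M * (2 * (?N * exp (- real n)) + 2 / (x0 * n))"
    using B1 B2 B3 by (simp add: algebra_simps)
  also have "\<dots> \<le> ?M * (2 * ((real n ^ k + 1) * exp (- real n)) + 2 / (x0 * n))"
    using N_le by (intro mult_left_mono add_right_mono mult_right_mono) auto
  finally show ?thesis by (simp only: mult.assoc)
qed

lemma whp_mono: "whp k d P \<Longrightarrow> (\<And>n H. P n H \<Longrightarrow> Q n H) \<Longrightarrow> whp k d Q"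
  unfolding whp_def
proof (rule tendsto_sandwich)
  assume imp: "\<And>n H. P n H \<Longrightarrow> Q n H"
  show "\<forall>\<^sub>F n in sequentially.
      measure_pmf.prob (random_hypergraph n (edge_count k d n) k) {H. P n H}
      \<le> measure_pmf.prob (random_hypergraph n (edge_count k d n) k) {H. Q n H}"
    using imp by (intro always_eventually allI measure_pmf.finite_measure_mono) auto
  show "\<forall>\<^sub>F n in sequentially.
      measure_pmf.prob (random_hypergraph n (edge_count k d n) k) {H. Q n H} \<le> 1"
    by simp
  show "(\<lambda>_. 1 :: real) \<longlonglongrightarrow> 1" by simp
qed

text \<open>No condition mentions n, so one choice of parameters serves all large n. Of the last
  four conjuncts, two make sets of at most x0 n vertices sparse and two let the stage exponents
  exceed the entropies.\<close>

definition stage_conditions ::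
    "nat \<Rightarrow> real \<Rightarrow> real \<Rightarrow> nat \<Rightarrow> nat \<Rightarrow> nat \<Rightarrow> real \<Rightarrow> real \<Rightarrow> bool" where
  "stage_conditions k d \<epsilon> t1 t2 b r1 x0 \<longleftrightarrow>
     \<epsilon> > 0 \<and> d > 0 \<and> t1 > 0 \<and> t2 > 0 \<and> b \<ge> 2 \<and> 0 < r1 \<and> r1 \<le> 1 \<and> 0 < x0 \<and> x0 \<le> 1 \<and>
     exp 2 * d * x0 ^ (k - 1) \<le> real k * real b \<and> 2 * exp 1 \<le> exp (real b) * x0 \<and>
     ln (real t1 + 1) + 1 \<le> r1 * stage_rate k d \<epsilon> t1 1 \<and>
     2 * r1 * (1 - ln r1 + ln (real t2 + 1)) + 1 \<le> x0 * stage_rate k d \<epsilon> t2 (2 * r1)"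

lemma whp_greedy_degenerate:
  fixes d \<epsilon> r1 x0 :: real and t1 t2 b k :: nat
  assumes k: "k \<ge> 2" and conditions: "stage_conditions k d \<epsilon> t1 t2 b r1 x0"
  shows "whp k d (\<lambda>n H. fst H = {1..n} \<and> greedy_degenerate {1..n} (snd H) (t1 + t2) (k * b - 1))"
proof (rule whpI)
  have \<epsilon>: "\<epsilon> > 0" and d: "d > 0" and t: "t1 > 0" "t2 > 0" and b: "b \<ge> 2"
    and r1: "0 < r1" "r1 \<le> 1" and x0: "0 < x0" "x0 \<le> 1"
    and c1: "exp 2 * d * x0 ^ (k - 1) \<le> real k * real b" and c2: "2 * exp 1 \<le> exp (real b) * x0"
    and s1: "ln (real t1 + 1) + 1 \<le> r1 * stage_rate k d \<epsilon> t1 1"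
    and s2: "2 * r1 * (1 - ln r1 + ln (real t2 + 1)) + 1 \<le> x0 * stage_rate k d \<epsilon> t2 (2 * r1)"
    using conditions unfolding stage_conditions_def by blast+
  let ?K = "k - 1"
  define \<delta> where "\<delta> n = 2 * (real n ^ k + 1) * exp (- real n) + 2 / (x0 * real n)" for n
  show "\<delta> \<longlonglongrightarrow> 0" unfolding \<delta>_def using x0(1) by real_asymp
  \<comment> \<open>A crude bound for p: of the falling factorial of degree k - 1 in the denominator
    a single factor n - (k - 1) is kept, which is enough for p to tend to 0.\<close>
  define s where "s n = d * fact ?K / (real n - real ?K)" for n
  have "s \<longlonglongrightarrow> 0" unfolding s_def by real_asymp
  then have ev_s: "\<forall>\<^sub>F n in sequentially. s n < 1" by (rule order_tendstoD) simp
  have "(\<lambda>n. (real n / (real n - real ?K)) ^ ?K) \<longlonglongrightarrow> 1" by real_asymp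
  then have "(\<lambda>n. (real n / (real n - real ?K)) ^ ?K / (1 - s n)) \<longlonglongrightarrow> 1 / (1 - 0)"
    using \<open>s \<longlonglongrightarrow> 0\<close> by (intro tendsto_intros) auto
  then have ev_\<epsilon>: "\<forall>\<^sub>F n in sequentially. (real n / (real n - real ?K)) ^ ?K / (1 - s n) < 1 + \<epsilon>"
    by (rule order_tendstoD) (use \<epsilon> in simp)
  have ev_r1: "\<forall>\<^sub>F n in sequentially. 1 \<le> r1 * real n" using r1(1) by real_asymp
  show "\<forall>\<^sub>F n in sequentially. edge_count k d n \<le> n choose k \<and>
      real (card {E. E \<subseteq> edges_on n k \<and> card E = edge_count k d n \<and>
        \<not> (fst ({1..n}, E) = {1..n} \<and> greedy_degenerate {1..n} (snd ({1..n}, E)) (t1 + t2) (k * b - 1))})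
      \<le> real ((n choose k) choose edge_count k d n) * \<delta> n"
    using ev_s ev_\<epsilon> ev_r1 eventually_ge_at_top[of k]
  proof eventually_elim
    case (elim n)
    let ?m = "edge_count k d n"
    define p where "p = real ?m / real (n choose k)"
    have N0: "real (n choose k) > 0" using elim by simp
    have ch0: "real ((n - 1) choose ?K) > 0" using elim k by simp
    have nK: "1 \<le> real n - real ?K" using elim k by (simp add: of_nat_diff)
    have "0 \<le> real (n choose k) * edge_prob k d n" unfolding edge_prob_def using d by simp
    then have "real ?m \<le> real (n choose k) * edge_prob k d n"
      unfolding edge_count_def by (intro of_nat_floor)
    then have p1: "p \<le> d / real ((n - 1) choose ?K)"
      unfolding p_def edge_prob_def using N0 by (simp add: field_simps)
    also have "\<dots> \<le> s n"
    proof -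
      have "(real n - real ?K) ^ 1 \<le> (real n - real ?K) ^ ?K"
        using k nK by (intro power_increasing) auto
      also have "\<dots> \<le> real ((n - 1) choose ?K) * fact ?K"
        using binomial_lower[of ?K "n - 1"] elim k by (simp add: of_nat_diff)
      finally have "d * (real n - real ?K) \<le> d * (real ((n - 1) choose ?K) * fact ?K)"
        using d by (intro mult_left_mono) auto
      then show ?thesis unfolding s_def using ch0 nK by (simp add: field_simps)
    qed
    finally have ps: "p \<le> s n" .
    then have p_lt: "p < 1" using elim by linarith
    then have m: "?m \<le> n choose k" unfolding p_def using N0 by simp
    have "(real n / (real n - real ?K)) ^ ?K / (1 - p) \<le> (real n / (real n - real ?K)) ^ ?K / (1 - s n)"
      using ps elim nK by (intro divide_left_mono) auto
    then have hn: "(real n / (real n - real ?K)) ^ ?K / (1 - p) \<le> 1 + \<epsilon>" using elim by linarith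
    have "k \<le> n" "1 \<le> r1 * real n" using elim by auto
    from card_not_greedy_degenerate[OF k this(1) m p_def p_lt p1 \<epsilon> hn d t b r1 this(2) x0 c1 c2 s1 s2] m
    show ?case unfolding \<delta>_def by simp
  qed
qed

section \<open>Choice of the parameters\<close>

text \<open>Here l = log d, A = \<alpha> and K = k - 1. As d / A^K = Q / K, an average class leaves
  a vertex unabsorbed with probability about exp (- Q / K) = l^5 exp (- l / K). Since A \<ge> exp (l
  / K) / l and \<epsilon> = 1 / l costs another power of l, the first rate is of order at least l^3.
  That is the purpose of the 5 in \<alpha>: two powers of l are lost and three are wanted.\<close>

lemma stage_parameters:
  fixes K :: nat and d l Q A :: real
  assumes K: "K \<ge> 1" and d: "d = exp l"
    and Q: "Q = l - 5 * real K * ln l" "Q \<ge> 2 * real K"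
    and l: "l \<ge> 8" "l \<ge> real K + 1" "l \<ge> exp 2" "l \<ge> 64 * exp 5" "l \<ge> 4 * exp (64 * exp 5)"
      "exp l \<ge> l ^ (3 * K + 1)"
      "(1 + 1 / l) ^ (K + 1) / (1 - 2 / l) ^ K * l \<le> l + 3 * real K + 2"
    and A: "A > 0" "A ^ K = real K * d / Q"
  shows "\<exists>t1 t2 b r1 x0. stage_conditions (Suc K) d (1 / l) t1 t2 b r1 x0 \<and>
    real (t1 + t2 + 2 * (Suc K * b) + 1) \<le> A + 3 * l ^ (3 * Suc K) + 1"
proof -
  have K0: "real K \<ge> 1" using K by simp
  have l0: "l > 0" "l \<ge> 1" using l(1) by auto
  have lnl: "0 \<le> ln l" "ln l \<le> l" using l0 ln_le_minus_one[of l] by auto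
  have Ql: "Q \<le> l" using Q(1) lnl K0 by simp
  have Q0: "Q > 0" using Q(2) K0 by linarith
  have d0: "d > 0" using d by simp
  have QA: "d / A ^ K = Q / real K" unfolding A(2) using Q0 d0 K0 by simp
  have dl: "d / l \<le> A ^ K"
  proof -
    have "d / l \<le> d / Q" using Ql Q0 d0 by (intro divide_left_mono) auto
    also have "\<dots> \<le> real K * d / Q" using K0 d0 Q0 by (intro divide_right_mono) auto
    finally show ?thesis using A(2) by simp
  qed
  have A_l3: "l ^ 3 \<le> A"
  proof (rule power_le_imp_le_base[where n = "K - 1"])
    have "(l ^ 3) ^ K = l ^ (3 * K + 1) / l" using l0 by (simp add: power_mult[symmetric])
    also have "\<dots> \<le> d / l" using l(6) d l0 by (intro divide_right_mono) auto
    also note dl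
    finally show "(l ^ 3) ^ Suc (K - 1) \<le> A ^ Suc (K - 1)" using K by simp
  qed (use A in simp)
  have l_l3: "l \<le> l ^ 3" using power_increasing[of 1 3 l] l0 by simp
  have Al: "l \<le> A" using A_l3 l_l3 by linarith
  have A_exp: "exp (l / real K) / l \<le> A"
  proof (rule power_le_imp_le_base[where n = "K - 1"])
    have "(exp (l / real K) / l) ^ K = d / l ^ K"
      using K0 d by (simp add: power_divide exp_of_nat_mult[symmetric])
    also have "\<dots> \<le> d / l ^ 1" using d0 l0 K by (intro divide_left_mono power_increasing) auto
    also have "\<dots> \<le> A ^ K" using dl by simp
    finally show "(exp (l / real K) / l) ^ Suc (K - 1) \<le> A ^ Suc (K - 1)" using K by simp
  qed (use A in simp)
  have A_d: "A \<le> d / 2"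
  proof -
    have "A ^ 1 \<le> A ^ K" using K Al l0 by (intro power_increasing) auto
    also have "\<dots> \<le> real K * d / (2 * real K)" unfolding A(2) using Q(2) d0 K0 by (intro divide_left_mono) auto
    also have "\<dots> = d / 2" using K0 by simp
    finally show ?thesis by simp
  qed
  have d4: "d \<ge> 4"
  proof -
    have "d \<ge> 1 + l" unfolding d by (rule exp_ge_add_one_self)
    then show ?thesis using l(1) by linarith
  qed
  define a where "a = nat \<lceil>A\<rceil>"
  define t2 where "t2 = nat \<lceil>A / l\<rceil>"
  define t1 where "t1 = a - t2"
  \<comment> \<open>Chosen so that r1 times the first rate, which is at least l^3 / (4 exp 5), is at
    least 2 l and thus exceeds the entropy.\<close>
  define c where "c = 8 * exp (5::real)"
  \<comment> \<open>In the second stage the exponent is at most 2 d (4 r1 l / A)^K. Already for K =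
    1 this is 8 r1 l Q, so r1 must be of order 1 / l^2 to keep it bounded.\<close>
  define r1 where "r1 = c / l ^ 2"
  \<comment> \<open>The second rate is at least A exp (- 8 c) / (2 l^2). Two of the three powers of
    l cancel l^2, and the third outweighs the constant 4 exp (8 c).\<close>
  define x0 where "x0 = l ^ 3 / A"
  \<comment> \<open>The origin of the exponent 3k: d x0^K \<le> l^(3 K + 1), and exp 2 \<le> l
    raises this to l^(3 K + 2); one more power of l covers the loss of up to k from rounding
    down.\<close>
  define b where "b = nat \<lfloor>l ^ (3 * Suc K) / real (Suc K)\<rfloor>"
  have a: "A \<le> real a" "real a \<le> A + 1" unfolding a_def using A by linarith+
  have Al0: "A / l > 0" using A l0 by simp
  have t2: "A / l \<le> real t2" "real t2 \<le> A / l + 1" unfolding t2_def using Al0 by linarith+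
  have t2_pos: "t2 > 0" using t2 Al0 by simp
  have one_Al: "1 \<le> A / l" using Al l0 by simp
  have Al2: "A * (1 - 2 / l) = A - 2 * (A / l)" by (simp add: algebra_simps)
  have half: "2 / l \<le> 1 / 2" using l(1) by (simp add: field_simps)
  have A_half: "A / 2 \<le> A * (1 - 2 / l)" using mult_left_mono[of "1 / 2" "1 - 2 / l" A] half A by simp
  have t1: "A * (1 - 2 / l) \<le> real t1"
    using a t2 one_Al unfolding t1_def Al2 by linarith
  have t1_half: "A / 2 \<le> real t1" using t1 A_half by linarith
  have t1_pos: "t1 > 0" using t1_half A by simp
  have sum_t: "t1 + t2 = a" using t1_pos unfolding t1_def by simp
  have l_div_A: "A / l \<le> A" using A l0 by (simp add: field_simps)
  have ln_t: "ln (real t1 + 1) \<le> l" "ln (real t2 + 1) \<le> l"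
  proof -
    have "real t1 \<le> real a" "real t2 \<le> A + 1" using sum_t t2 l_div_A by auto
    then have "real t1 + 1 \<le> d" "real t2 + 1 \<le> d" using a A_d d4 by linarith+
    then have "ln (real t1 + 1) \<le> ln d" "ln (real t2 + 1) \<le> ln d" using d0 by simp_all
    then show "ln (real t1 + 1) \<le> l" "ln (real t2 + 1) \<le> l" unfolding d by simp_all
  qed
  have c: "c \<ge> 1" "8 * c \<le> l" "l \<ge> 4 * exp (8 * c)"
    using l(4,5) exp_ge_add_one_self[of 5] unfolding c_def by auto
  have r1_pos: "r1 > 0" unfolding r1_def using c l0 by simp
  have r1_le: "r1 \<le> 1"
  proof -
    have "c \<le> l * 1" using c by simp
    also have "\<dots> \<le> l * l" using l0 by (intro mult_left_mono) auto
    finally show ?thesis unfolding r1_def using l0 by (simp add: power2_eq_square)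
  qed
  have x0_pos: "x0 > 0" unfolding x0_def using A l0 by simp
  have x0_le: "x0 \<le> 1" unfolding x0_def using A_l3 A by simp
  have eps: "1 / l / (1 + 1 / l) \<ge> 1 / (2 * l)" using l0 by (simp add: field_simps)
  have L3: "l ^ (3 * Suc K) = l ^ (3 * K) * l ^ 3"
    by (simp add: power_add[symmetric] add.commute)
  have b_le: "real (Suc K) * real b \<le> l ^ (3 * Suc K)"
  proof -
    have "real b \<le> l ^ (3 * Suc K) / real (Suc K)" unfolding b_def using l0 by (intro of_nat_floor) auto
    then show ?thesis by (simp add: field_simps)
  qed
  have b_gt: "l ^ (3 * Suc K) / real (Suc K) - 1 < real b" unfolding b_def by linarith
  then have b_ge: "l ^ (3 * Suc K) - real (Suc K) \<le> real (Suc K) * real b"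
    by (simp add: field_simps)
  have lb: "l + 2 \<le> real b"
  proof -
    have "(l + 3) * real (Suc K) \<le> (l + 3) * l" using l by (intro mult_left_mono) auto
    also have "\<dots> \<le> (2 * l) * l" using l by (intro mult_right_mono) auto
    also have "\<dots> \<le> (l * l) * l" using l by (intro mult_right_mono) auto
    also have "\<dots> = l ^ 3" by (simp add: power3_eq_cube)
    also have "\<dots> \<le> l ^ (3 * Suc K)" using l0 by (intro power_increasing) auto
    finally have "l + 3 \<le> l ^ (3 * Suc K) / real (Suc K)" by (simp add: field_simps)
    with b_gt show ?thesis by linarith
  qed
  have C1: "exp 2 * d * x0 ^ K \<le> real (Suc K) * real b"
  proof -
    have "d * x0 ^ K = l ^ (3 * K) * (d / A ^ K)" unfolding x0_def by (simp add: power_divide power_mult)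
    also have "\<dots> \<le> l ^ (3 * K) * l"
    proof -
      have "Q / real K \<le> Q / 1" using Q0 K0 by (intro divide_left_mono) auto
      then show ?thesis unfolding QA using Ql l0 by (intro mult_left_mono) auto
    qed
    finally have le: "d * x0 ^ K \<le> l ^ (3 * K) * l" .
    have "exp 2 * (d * x0 ^ K) \<le> l * (l ^ (3 * K) * l)"
      by (rule mult_mono[OF l(3) le]) (use d0 x0_pos l0 in auto)
    also have "\<dots> \<le> l ^ (3 * Suc K) - real (Suc K)"
    proof -
      have "1 \<le> l ^ (3 * K)" using l0 by (intro one_le_power) auto
      then have "1 * (l * 1) \<le> l ^ (3 * K) * (l * l)" using l0 by (intro mult_mono) auto
      then have "real (Suc K) \<le> l ^ (3 * K) * (l * l)"
        unfolding mult_1_left mult_1_right using l(2) by linarith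
      moreover have "l * (l ^ (3 * K) * l) = l ^ (3 * K) * (l * l)" by simp
      ultimately have "real (Suc K) + l * (l ^ (3 * K) * l) \<le> 2 * (l ^ (3 * K) * (l * l))"
        by linarith
      also have "\<dots> \<le> l * (l ^ (3 * K) * (l * l))" using l by (intro mult_right_mono) auto
      also have "\<dots> = l ^ (3 * Suc K)" unfolding L3 by (simp add: power3_eq_cube)
      finally show ?thesis by simp
    qed
    also note b_ge
    finally show ?thesis by (simp add: mult.assoc)
  qed
  \<comment> \<open>The crude bound x0 \<ge> 1 / d suffices, since b \<ge> log d + 2.\<close>
  have C2: "2 * exp 1 \<le> exp (real b) * x0"
  proof -
    have "1 \<le> l ^ 3" using l0 by (intro one_le_power) auto
    then have "1 / d \<le> x0" unfolding x0_def using A A_d d0 l0 by (intro frac_le) auto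
    moreover have "2 * exp 1 * d \<le> exp (real b)"
    proof -
      have "2 \<le> exp (1::real)" using exp_ge_add_one_self[of "1::real"] by simp
      then have "2 * exp 1 * d \<le> exp 1 * exp 1 * d" using d0 by (intro mult_right_mono) auto
      also have "\<dots> = exp (l + 2)" unfolding d by (simp add: mult_exp_exp)
      also have "\<dots> \<le> exp (real b)" using lb by simp
      finally show ?thesis .
    qed
    ultimately have "2 * exp 1 * d * (1 / d) \<le> exp (real b) * x0"
      using d0 by (intro mult_mono) auto
    then show ?thesis using d0 by simp
  qed
  have rate: "stage_rate (Suc K) d (1 / l) t w =
      real t * (1 / l / (1 + 1 / l)) * exp (- ((1 + 1 / l) * d * ((1 + 1 / l) * w / t) ^ K))" for t w
    unfolding stage_rate_def by (simp only: diff_Suc_1 times_divide_eq_right)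
  have S1: "ln (real t1 + 1) + 1 \<le> r1 * stage_rate (Suc K) d (1 / l) t1 1"
  proof -
    \<comment> \<open>The total loss factor from \<epsilon> = 1 / l and from giving about A / l
      classes to the second stage. It is 1 + (3 K + 1) / l + O(1 / l^2), so G l / K exceeds l / K by
      less than 5 and costs only the constant factor exp 5 in the rate.\<close>
    define G where "G = (1 + 1 / l) ^ (K + 1) / (1 - 2 / l) ^ K"
    have pos: "1 - 2 / l > 0" using half by linarith
    have "G \<ge> 1"
    proof -
      have "(1 - 2 / l) ^ K \<le> 1" using pos l0 by (intro power_le_one) auto
      moreover have "1 \<le> (1 + 1 / l) ^ (K + 1)" using l0 by (intro one_le_power) auto
      ultimately have "(1 - 2 / l) ^ K \<le> (1 + 1 / l) ^ (K + 1)" by linarith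
      then show ?thesis unfolding G_def using pos by simp
    qed
    have "(1 + 1 / l) * d * ((1 + 1 / l) * 1 / t1) ^ K
        \<le> (1 + 1 / l) * d * ((1 + 1 / l) * 1 / (A * (1 - 2 / l))) ^ K"
      using t1 l0 d0 A pos t1_pos by (intro mult_left_mono power_mono divide_left_mono) auto
    also have "\<dots> = G * (d / A ^ K)"
      unfolding G_def by (simp add: power_divide power_mult_distrib mult_ac)
    also have "\<dots> = (G * l) / K - 5 * (G * ln l)" unfolding QA Q(1) using K0 by (simp add: field_simps)
    also have "\<dots> \<le> (l + 3 * real K + 2) / K - 5 * (1 * ln l)"
      using l(7) \<open>G \<ge> 1\<close> lnl K0 unfolding G_def[symmetric]
      by (intro diff_mono divide_right_mono mult_left_mono mult_right_mono) auto
    also have "(l + 3 * real K + 2) / K \<le> l / K + 5" using K0 by (simp add: field_simps)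
    finally have "(1 + 1 / l) * d * ((1 + 1 / l) * 1 / t1) ^ K \<le> l / K + 5 - 5 * ln l" by simp
    then have "exp (- (l / K + 5 - 5 * ln l)) \<le> exp (- ((1 + 1 / l) * d * ((1 + 1 / l) * 1 / t1) ^ K))"
      by simp
    moreover have "exp (- (l / K + 5 - 5 * ln l)) = l ^ 5 / (exp (l / K) * exp 5)"
    proof -
      have "exp (5 * ln l) = l ^ 5" using exp_of_nat_mult[of 5 "ln l"] l0 by simp
      moreover have "- (l / K + 5 - 5 * ln l) = 5 * ln l - (l / K + 5)" by simp
      ultimately show ?thesis by (simp only: exp_diff exp_add)
    qed
    ultimately have e: "l ^ 5 / (exp (l / K) * exp 5)
        \<le> exp (- ((1 + 1 / l) * d * ((1 + 1 / l) * 1 / t1) ^ K))" by (simp only:)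
    have h: "exp (l / K) / l / 2 * (1 / (2 * l)) \<le> real t1 * (1 / l / (1 + 1 / l))"
      using A_exp t1_half eps l0 by (intro mult_mono) auto
    have "exp (l / K) / l / 2 * (1 / (2 * l)) * (l ^ 5 / (exp (l / K) * exp 5))
        \<le> stage_rate (Suc K) d (1 / l) t1 1"
      unfolding rate by (rule mult_mono[OF h e]) (use l0 in auto)
    moreover have "exp (l / K) / l / 2 * (1 / (2 * l)) * (l ^ 5 / (exp (l / K) * exp 5))
        = l ^ 3 / (4 * exp 5)"
      using l0 by (simp add: field_simps eval_nat_numeral)
    ultimately have "r1 * (l ^ 3 / (4 * exp 5)) \<le> r1 * stage_rate (Suc K) d (1 / l) t1 1"
      using r1_pos by (intro mult_left_mono) auto
    moreover have "r1 * (l ^ 3 / (4 * exp 5)) = 2 * l"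
      unfolding r1_def c_def using l0 by (simp add: field_simps eval_nat_numeral)
    ultimately show ?thesis using ln_t(1) l0 by linarith
  qed
  have S2: "2 * r1 * (1 - ln r1 + ln (real t2 + 1)) + 1 \<le> x0 * stage_rate (Suc K) d (1 / l) t2 (2 * r1)"
  proof -
    have "ln r1 = ln c - 2 * ln l" unfolding r1_def using c l0 by (simp add: ln_div ln_realpow)
    moreover have "ln c \<ge> 0" using c by simp
    ultimately have "1 - ln r1 + ln (real t2 + 1) \<le> 4 * l" using lnl ln_t(2) l0 by linarith
    then have "2 * r1 * (1 - ln r1 + ln (real t2 + 1)) \<le> 2 * r1 * (4 * l)"
      using r1_pos by (intro mult_left_mono) auto
    also have "\<dots> = 8 * c / l" unfolding r1_def using l0 by (simp add: power2_eq_square)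
    also have "\<dots> \<le> 1" using c l0 by simp
    finally have le2: "2 * r1 * (1 - ln r1 + ln (real t2 + 1)) + 1 \<le> 2" by simp
    have l1: "1 + 1 / l \<le> 2" using l0 by simp
    have "(1 + 1 / l) * d * ((1 + 1 / l) * (2 * r1) / t2) ^ K \<le> 2 * d * (2 * (2 * r1) / (A / l)) ^ K"
      using l1 d0 r1_pos t2 Al0 l0 t2_pos by (intro mult_mono power_mono frac_le) auto
    also have "2 * (2 * r1) / (A / l) = (4 * c / l) / A" unfolding r1_def using l0 A
      by (simp add: field_simps power2_eq_square)
    also have "2 * d * ((4 * c / l) / A) ^ K = 2 * (4 * c / l) ^ K * (Q / real K)"
      unfolding QA[symmetric] by (simp add: power_divide power_mult_distrib mult_ac)
    also have "\<dots> \<le> 2 * (4 * c / l) ^ 1 * l"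
    proof -
      have "(4 * c / l) ^ K \<le> (4 * c / l) ^ 1" using c l0 K by (intro power_decreasing) auto
      moreover have "Q / real K \<le> l"
      proof -
        have "Q / real K \<le> Q / 1" using Q0 K0 by (intro divide_left_mono) auto
        then show ?thesis using Ql by simp
      qed
      ultimately show ?thesis using c l0 Q0 K0 by (intro mult_mono) auto
    qed
    also have "\<dots> = 8 * c" using l0 by simp
    finally have e: "exp (- (8 * c)) \<le> exp (- ((1 + 1 / l) * d * ((1 + 1 / l) * (2 * r1) / t2) ^ K))" by simp
    have h: "A / l * (1 / (2 * l)) \<le> real t2 * (1 / l / (1 + 1 / l))"
      using t2 eps l0 Al0 by (intro mult_mono) auto
    have "A / l * (1 / (2 * l)) * exp (- (8 * c)) \<le> stage_rate (Suc K) d (1 / l) t2 (2 * r1)"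
      unfolding rate by (rule mult_mono[OF h e]) (use l0 in auto)
    then have "x0 * (A / l * (1 / (2 * l)) * exp (- (8 * c))) \<le> x0 * stage_rate (Suc K) d (1 / l) t2 (2 * r1)"
      using x0_pos by (intro mult_left_mono) auto
    moreover have "x0 * (A / l * (1 / (2 * l)) * exp (- (8 * c))) = l / (2 * exp (8 * c))"
      unfolding x0_def using l0 A by (simp add: field_simps eval_nat_numeral exp_minus)
    moreover have "2 \<le> l / (2 * exp (8 * c))" using c(3) by (simp add: field_simps)
    ultimately show ?thesis using le2 by linarith
  qed
  \<comment> \<open>The left side is a + 2D + 3 for D = k b - 1. Twice k b uses two of the three
    copies of l^(3k) in \<beta>, and the third pays for rounding A up.\<close>
  have "real (t1 + t2 + 2 * (Suc K * b) + 1) \<le> A + 3 * l ^ (3 * Suc K) + 1"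
  proof -
    have "1 \<le> l ^ (3 * Suc K)" using l0 by (intro one_le_power) auto
    moreover have "real (2 * (Suc K * b)) = 2 * (real (Suc K) * real b)"
      by (simp only: of_nat_mult of_nat_numeral)
    ultimately show ?thesis unfolding sum_t using a(2) b_le by (simp only: of_nat_add)
  qed
  moreover have "b \<ge> 2" using lb l0 by linarith
  moreover have "1 / l > 0" using l0 by simp
  ultimately have "stage_conditions (Suc K) d (1 / l) t1 t2 b r1 x0 \<and>
      real (t1 + t2 + 2 * (Suc K * b) + 1) \<le> A + 3 * l ^ (3 * Suc K) + 1"
    unfolding stage_conditions_def diff_Suc_1
    by (intro conjI t1_pos t2_pos r1_pos r1_le x0_pos x0_le C1 C2 S1 S2 d0)
  then show ?thesis by blast
qed

lemma eventually_stage_parameters: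
  assumes k: "k \<ge> 2"
  shows "\<forall>\<^sub>F d in at_top. \<exists>t1 t2 b \<epsilon> r1 x0. stage_conditions k d \<epsilon> t1 t2 b r1 x0 \<and>
    real (t1 + t2 + 2 * (k * b) + 1) \<le> color_alpha k d + color_beta k d + 1"
proof -
  obtain K where K: "k = Suc K" "K \<ge> 1" using k by (cases k) auto
  define L where "L = Max {8, real K + 1, exp 2, 64 * exp 5, 4 * exp (64 * exp (5::real))}"
  have L: "8 \<le> L" "real K + 1 \<le> L" "exp 2 \<le> L" "64 * exp 5 \<le> L" "4 * exp (64 * exp 5) \<le> L"
    unfolding L_def by (intro Max_ge; simp)+
  have "\<forall>\<^sub>F l in at_top. l \<ge> L" by (rule eventually_ge_at_top)
  moreover have "\<forall>\<^sub>F l in at_top. l - 5 * real K * ln l \<ge> 2 * real K" by real_asymp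
  moreover have "\<forall>\<^sub>F l::real in at_top. exp l \<ge> l ^ (3 * K + 1)" by real_asymp
  moreover have "\<forall>\<^sub>F l::real in at_top.
      (1 + 1 / l) ^ (K + 1) / (1 - 2 / l) ^ K * l \<le> l + 3 * real K + 2" by real_asymp
  ultimately have "\<forall>\<^sub>F l in at_top. l \<ge> L \<and> l - 5 * real K * ln l \<ge> 2 * real K \<and>
      exp l \<ge> l ^ (3 * K + 1) \<and> (1 + 1 / l) ^ (K + 1) / (1 - 2 / l) ^ K * l \<le> l + 3 * real K + 2"
    by (intro eventually_conj)
  from eventually_compose_filterlim[OF this ln_at_top] eventually_gt_at_top[of "0::real"]
  show ?thesis
  proof eventually_elim
    case (elim d)
    define l where "l = ln d"
    define Q where "Q = l - 5 * real K * ln l"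
    have d: "d > 0" "d = exp l" using elim(2) unfolding l_def by simp_all
    have l: "L \<le> l" "2 * real K \<le> Q" "l ^ (3 * K + 1) \<le> exp l"
      "(1 + 1 / l) ^ (K + 1) / (1 - 2 / l) ^ K * l \<le> l + 3 * real K + 2"
      using elim(1) unfolding l_def Q_def by blast+
    have l0: "l > 0" using l L by linarith
    have Q0: "Q > 0" using l(2) K(2) by simp
    have base: "real K * d / Q > 0" using Q0 K(2) d by simp
    have alpha: "color_alpha k d = (real K * d / Q) powr (1 / real K)"
      unfolding color_alpha_def Q_def l_def K(1) by simp
    have A0: "color_alpha k d > 0" unfolding alpha powr_gt_zero using base by (rule less_imp_neq[symmetric])
    have "color_alpha k d ^ K = color_alpha k d powr real K" using A0 by (simp add: powr_realpow)
    also have "\<dots> = (real K * d / Q) powr 1" unfolding alpha powr_powr using K(2) by simp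
    also have "\<dots> = real K * d / Q" using powr_one[OF less_imp_le[OF base]] .
    finally have AK: "color_alpha k d ^ K = real K * d / Q" .
    have bounds: "8 \<le> l" "real K + 1 \<le> l" "exp 2 \<le> l" "64 * exp 5 \<le> l" "4 * exp (64 * exp 5) \<le> l"
      using L l(1) by linarith+
    have beta: "color_beta k d = 3 * l ^ (3 * Suc K)" unfolding color_beta_def K(1) l_def ..
    obtain t1 t2 b r1 x0 where "stage_conditions (Suc K) d (1 / l) t1 t2 b r1 x0"
      "real (t1 + t2 + 2 * (Suc K * b) + 1) \<le> color_alpha k d + 3 * l ^ (3 * Suc K) + 1"
      using stage_parameters[OF K(2) d(2) Q_def l(2) bounds l(3,4) A0 AK] by (elim exE conjE)
    then show ?case unfolding beta K(1)[symmetric] by blast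
  qed
qed

theorem theorem1:
  fixes k :: nat
  assumes "k \<ge> 2"
  shows "\<exists>d0::real. \<forall>d\<ge>d0. \<forall>q :: nat \<Rightarrow> nat.
    ((\<forall>n. real (q n) \<ge> color_alpha k d + color_beta k d + 1) \<longrightarrow>
       whp k d (\<lambda>n H. Digraph_Component.connected (coloring_graph (q n) H))) \<and>
    ((\<forall>n. real (q n) \<ge> color_alpha k d + 2 * color_beta k d + 1) \<longrightarrow>
       (\<exists>C::real. whp k d (\<lambda>n H. graph_diameter (coloring_graph (q n) H) \<le> ereal (C * real n))))"
proof -
  have "\<forall>\<^sub>F d::real in at_top. ln d \<ge> 0" by real_asymp
  from eventually_conj[OF this eventually_stage_parameters[OF assms]]
  show ?thesis unfolding eventually_at_top_linorder
  proof (elim exE, intro exI allI impI)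
    fix d0 d :: real and q :: "nat \<Rightarrow> nat"
    assume d: "d \<ge> d0" and all: "\<forall>d\<ge>d0. ln d \<ge> 0 \<and> (\<exists>t1 t2 b \<epsilon> r1 x0.
      stage_conditions k d \<epsilon> t1 t2 b r1 x0 \<and>
      real (t1 + t2 + 2 * (k * b) + 1) \<le> color_alpha k d + color_beta k d + 1)"
    then obtain t1 t2 b \<epsilon> r1 x0 where par: "stage_conditions k d \<epsilon> t1 t2 b r1 x0"
      and q_le: "real (t1 + t2 + 2 * (k * b) + 1) \<le> color_alpha k d + color_beta k d + 1" by blast
    define a where "a = t1 + t2"
    define D where "D = k * b - 1"
    \<comment> \<open>All parameters depend on k and d alone, so \<open>C\<close> depends neither on
      n nor on q.\<close>
    define C where "C = real (a * (a + 2 * D + 4) + 2 * D + 2)"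
    have kb: "k * b > 0" using assms par unfolding stage_conditions_def by simp
    have aD: "a + 2 * D + 3 = t1 + t2 + 2 * (k * b) + 1" unfolding a_def D_def using kb by linarith
    have beta: "color_beta k d \<ge> 0" unfolding color_beta_def using all d by simp
    have whp: "whp k d (\<lambda>n H. fst H = {1..n} \<and> greedy_degenerate {1..n} (snd H) a D)"
      unfolding a_def D_def by (rule whp_greedy_degenerate[OF assms par])
    have key: "Digraph_Component.connected (coloring_graph (q n) H) \<and>
        graph_diameter (coloring_graph (q n) H) \<le> ereal (C * real n)"
      if q: "real (q n) \<ge> color_alpha k d + color_beta k d + 1"
        and H: "fst H = {1..n} \<and> greedy_degenerate {1..n} (snd H) a D" for n H
    proof -
      have "real (a + 2 * D + 3) \<le> real (q n)" unfolding aD using q q_le by linarith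
      then have qn: "a + 2 * D + 3 \<le> q n" by (simp only: of_nat_le_iff)
      obtain V E where HE: "H = (V, E)" by (cases H)
      then have V: "V = {1..n}" and "greedy_degenerate V E a D" using H by simp_all
      from greedy_degenerate.coloring_graph_diameter[OF this(2) qn] show ?thesis
        unfolding HE C_def using V by simp
    qed
    show "((\<forall>n. real (q n) \<ge> color_alpha k d + color_beta k d + 1) \<longrightarrow>
         whp k d (\<lambda>n H. Digraph_Component.connected (coloring_graph (q n) H))) \<and>
      ((\<forall>n. real (q n) \<ge> color_alpha k d + 2 * color_beta k d + 1) \<longrightarrow>
         (\<exists>C::real. whp k d (\<lambda>n H. graph_diameter (coloring_graph (q n) H) \<le> ereal (C * real n))))"
    proof (intro conjI impI)
      assume q: "\<forall>n. real (q n) \<ge> color_alpha k d + color_beta k d + 1"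
      show "whp k d (\<lambda>n H. Digraph_Component.connected (coloring_graph (q n) H))"
        by (rule whp_mono[OF whp conjunct1[OF key[OF q[rule_format]]]])
    next
      assume q: "\<forall>n. real (q n) \<ge> color_alpha k d + 2 * color_beta k d + 1"
      have q': "real (q n) \<ge> color_alpha k d + color_beta k d + 1" for n
        using q[rule_format, of n] beta by linarith
      have "whp k d (\<lambda>n H. graph_diameter (coloring_graph (q n) H) \<le> ereal (C * real n))"
        by (rule whp_mono[OF whp conjunct2[OF key[OF q']]])
      then show "\<exists>C::real. whp k d (\<lambda>n H. graph_diameter (coloring_graph (q n) H) \<le> ereal (C * real n))" ..
    qed
  qed
qed

end
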